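(* Consider the closed-loop system described in the context. Let $\delta>0$ and let $N\in\mathbb{N}$ satisfy $a-(n\pi)^2<-\delta$ for all $n>N$. Suppose that $K=[k_0\ k_1\ \ldots\ k_N]\in\mathbb{R}^{1\times(N+1)}$ and $L=[\ell_0\ \ell_1\ \ldots\ \ell_N]^\top\in\mathbb{R}^{N+1}$ are such that there exist matrices $P_2,P_3\in\mathbb{R}^{(N+1)\times(N+1)}$ and positive-definite matrices $P_1,S,R,Q\in\mathbb{R}^{(N+1)\times(N+1)}$ with $\Phi<0$ and $$Q(A+LC)+(A+LC)^\top Q<-2\delta Q .$$ Then for any initial value $\big(w(\cdot,0),p(0),\hat\epsilon(\cdot,0),\xi(0),\hat\chi_1(0),\hat\varphi(0),\hat\theta(0)\big)\in L^2(0,1)\times\mathbb{R}^2\times L^2(0,1)\times\mathbb{R}^4$, the tracking error satisfies $\lim_{t\to\infty}|y_e(t)|=0$ exponentially.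
   Context: Data: $a\in\mathbb{R}$, delay $\tau>0$, $d_1\in L^\infty(0,1;\mathbb{R}^{1\times 2})$, $d_2,d_3,d_4\in\mathbb{R}^{1\times 2}$, $G\in\mathbb{R}^{2\times2}$ whose spectrum is $\{i\omega,-i\omega\}$ for some (unknown) $\omega>0$. The plant and exosystem are $w_t(x,t)=w_{xx}(x,t)+aw(x,t)+d_1(x)p(t)$, $x\in(0,1)$; $w_x(0,t)=d_2p(t)$; $w_x(1,t)=U(t-\tau)+d_3p(t)$, with $U(s)=0$ for $s<0$; $\dot p(t)=Gp(t)$; tracking error $y_e(t)=w(0,t)-d_4p(t)$ (output $w(0,t)$, reference $d_4p(t)$). Let $\lambda_n=(n\pi)^2$, $\phi_0\equiv1$, $\phi_n(x)=\sqrt2\cos(n\pi x)$ for $n\ge1$ (an orthonormal basis of $L^2(0,1)$); $\langle\cdot,\cdot\rangle$ is the $L^2(0,1)$ inner product. Set $A=\mathrm{diag}(a-\lambda_0,\ldots,a-\lambda_N)$, $B=[1\ \ -\sqrt2\ \ \sqrt2\ \ldots\ (-1)^N\sqrt2]^\top$ (entries $\phi_n(1)$), $C=[1\ \sqrt2\ \ldots\ \sqrt2]\in\mathbb{R}^{1\times(N+1)}$ (entries $\phi_n(0)$). $\Phi$ is the symmetric $3\times3$ block matrix with blocks $\Phi_{11}=A^\top P_2+P_2^\top A+2\delta P_1+S-e^{-2\delta\tau}R$, $\Phi_{12}=P_1-P_2^\top+A^\top P_3$, $\Phi_{13}=e^{-2\delta\tau}R+P_2^\top BK$, $\Phi_{22}=-P_3-P_3^\top+\tau^2R$,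 $\Phi_{23}=P_3^\top BK$, $\Phi_{33}=-e^{-2\delta\tau}(S+R)$. Let $\mathcal L(x)=\sum_{n=0}^N\ell_n\phi_n(x)$, $\gamma_c=[1,0]$, and for $\vartheta\in\mathbb{R}$ let $S_c(\vartheta)=\begin{bmatrix}0&1\\-\vartheta&0\end{bmatrix}$ and let $f(\cdot,\vartheta):[0,1]\to\mathbb{R}^{1\times2}$ be the solution of $f''(x)=f(x)S_c(\vartheta)-af(x)-\mathcal L(x)f(0)$, $f'(0)=0$, $f(0)=\gamma_c$ (with $f'$ the $x$-derivative). The controller consists of: the state observer $\hat\epsilon_t=\hat\epsilon_{xx}+a\hat\epsilon+\mathcal L(x)(\hat\epsilon(0,t)-y_e(t))$, $\hat\epsilon_x(0,t)=0$, $\hat\epsilon_x(1,t)=U(t-\tau)$; the signal $y_d(t)=y_e(t)-\hat\epsilon(0,t)$; the adaptive observer $\dot\xi=-\iota\xi-y_d$, $\dot{\hat\chi}_1=\hat\varphi+\iota y_d+\hat\theta\xi+\mu_0(y_d-\hat\chi_1)$, $\dot{\hat\varphi}=-\iota\hat\varphi-\iota^2y_d$, $\dot{\hat\theta}=\mu_1\xi(y_d-\hat\chi_1)$, $\hat d(t)=(\hat d_1,\hat d_2)^\top$ with $\hat d_1=\hat\chi_1$, $\hat d_2=\hat\varphi+\xi\hat\theta+\iota\hat\chi_1$, where $\iota>0$, $\mu_0>\frac{1}{4\iota}$, $\mu_1>0$; and the control $$U(t)=\sum_{n=0}^Nk_n\langle\hat\epsilon(\cdot,t),\phi_n\rangle+\sum_{n=0}^Nk_n\langle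 f(\cdot,\hat\theta(t)),\phi_n\rangle\hat d(t)-f'(1,\hat\theta(t))e^{S_c(\hat\theta(t))\tau}\hat d(t).$$ *)

theory Defs
  imports "HOL-Analysis.Analysis"
begin

text \<open>Eigenfunctions of the Neumann Laplacian on (0,1): phi 0 = 1, phi n = sqrt 2 cos (n pi x).\<close>
definition phi :: "nat \<Rightarrow> real \<Rightarrow> real" where
  "phi n x = (if n = 0 then 1 else sqrt 2 * cos (real n * pi * x))"

definition ip01 :: "(real \<Rightarrow> real) \<Rightarrow> (real \<Rightarrow> real) \<Rightarrow> real" where
  "ip01 g h = integral {0..1} (\<lambda>x. g x * h x)"

definition ipv01 :: "(real \<Rightarrow> real^2) \<Rightarrow> (real \<Rightarrow> real) \<Rightarrow> real^2" where
  "ipv01 g h = integral {0..1} (\<lambda>x. h x *\<^sub>R g x)"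

definition L2_01 :: "(real \<Rightarrow> real) \<Rightarrow> bool" where
  "L2_01 g \<longleftrightarrow> g measurable_on {0..1} \<and> (\<lambda>x. (g x)\<^sup>2) integrable_on {0..1}"

text \<open>Membership in L-infinity(0,1;R^{1x2}) (a bounded measurable representative).\<close>
definition Linf_01 :: "(real \<Rightarrow> real^2) \<Rightarrow> bool" where
  "Linf_01 g \<longleftrightarrow> g measurable_on {0..1} \<and> (\<exists>B. \<forall>x\<in>{0..1}. norm (g x) \<le> B)"

definition cspectrum :: "real^2^2 \<Rightarrow> complex set" where
  "cspectrum G = {lam. \<exists>v::complex^2. v \<noteq> 0 \<and>
      (\<chi> i j. complex_of_real (G $ i $ j)) *v v = lam *s v}"

primrec mpow :: "real^2^2 \<Rightarrow> nat \<Rightarrow> real^2^2" where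
  "mpow M 0 = mat 1"
| "mpow M (Suc k) = M ** mpow M k"

definition mexp :: "real^2^2 \<Rightarrow> real^2^2" where
  "mexp M = (\<Sum>k. (1 / fact k) *\<^sub>R mpow M k)"

definition Sc :: "real \<Rightarrow> real^2^2" where
  "Sc th = vector [vector [0, 1], vector [- th, 0]]"

definition gamma_c :: "real^2" where
  "gamma_c = vector [1, 0]"

text \<open>Finite-dimensional matrices of size m x m as functions nat => nat => real
  (only indices < m matter).\<close>
definition mmul :: "nat \<Rightarrow> (nat \<Rightarrow> nat \<Rightarrow> real) \<Rightarrow> (nat \<Rightarrow> nat \<Rightarrow> real) \<Rightarrow> nat \<Rightarrow> nat \<Rightarrow> real" where
  "mmul m X Y = (\<lambda>i j. \<Sum>k<m. X i k * Y k j)"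

definition mtr :: "(nat \<Rightarrow> nat \<Rightarrow> real) \<Rightarrow> nat \<Rightarrow> nat \<Rightarrow> real" where
  "mtr X = (\<lambda>i j. X j i)"

definition posdef :: "nat \<Rightarrow> (nat \<Rightarrow> nat \<Rightarrow> real) \<Rightarrow> bool" where
  "posdef m X \<longleftrightarrow> (\<forall>i<m. \<forall>j<m. X i j = X j i) \<and>
     (\<forall>x::nat \<Rightarrow> real. (\<exists>i<m. x i \<noteq> 0) \<longrightarrow> (\<Sum>i<m. \<Sum>j<m. x i * X i j * x j) > 0)"

definition negdef :: "nat \<Rightarrow> (nat \<Rightarrow> nat \<Rightarrow> real) \<Rightarrow> bool" where
  "negdef m X \<longleftrightarrow> posdef m (\<lambda>i j. - X i j)"

definition Amat :: "real \<Rightarrow> nat \<Rightarrow> nat \<Rightarrow> real" where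
  "Amat a i j = (if i = j then a - (real i * pi)\<^sup>2 else 0)"

definition Bvec :: "nat \<Rightarrow> real" where "Bvec i = phi i 1"
definition Cvec :: "nat \<Rightarrow> real" where "Cvec i = phi i 0"

definition Phi :: "real \<Rightarrow> nat \<Rightarrow> (nat \<Rightarrow> real) \<Rightarrow> real \<Rightarrow> real \<Rightarrow>
    (nat \<Rightarrow> nat \<Rightarrow> real) \<Rightarrow> (nat \<Rightarrow> nat \<Rightarrow> real) \<Rightarrow> (nat \<Rightarrow> nat \<Rightarrow> real) \<Rightarrow>
    (nat \<Rightarrow> nat \<Rightarrow> real) \<Rightarrow> (nat \<Rightarrow> nat \<Rightarrow> real) \<Rightarrow> nat \<Rightarrow> nat \<Rightarrow> real" where
  "Phi a N k \<delta> \<tau> P1 P2 P3 S R =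
    (let m = N + 1; A = Amat a; BK = (\<lambda>i j. Bvec i * k j); e = exp (-2 * \<delta> * \<tau>);
         F11 = (\<lambda>i j. mmul m (mtr A) P2 i j + mmul m (mtr P2) A i j + 2 * \<delta> * P1 i j + S i j - e * R i j);
         F12 = (\<lambda>i j. P1 i j - mtr P2 i j + mmul m (mtr A) P3 i j);
         F13 = (\<lambda>i j. e * R i j + mmul m (mtr P2) BK i j);
         F22 = (\<lambda>i j. - P3 i j - mtr P3 i j + \<tau>\<^sup>2 * R i j);
         F23 = (\<lambda>i j. mmul m (mtr P3) BK i j);
         F33 = (\<lambda>i j. - e * (S i j + R i j));
         blk = (\<lambda>(r::nat) (c::nat).
           if r = 0 \<and> c = 0 then F11 else if r = 0 \<and> c = 1 then F12 else if r = 0 \<and> c = 2 then F13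
           else if r = 1 \<and> c = 0 then mtr F12 else if r = 1 \<and> c = 1 then F22 else if r = 1 \<and> c = 2 then F23
           else if r = 2 \<and> c = 0 then mtr F13 else if r = 2 \<and> c = 1 then mtr F23 else F33)
     in (\<lambda>i j. blk (i div m) (j div m) (i mod m) (j mod m)))"

end

theory Submission
  imports Defs
begin

text \<open>
  Everything is done on the cosine modes. In the observer error \<open>w - \<epsilon>\<close> (with \<open>\<epsilon>\<close> the observer state) the
  delayed input cancels, so its modes are driven by the exosystem only; since \<open>A + L C\<close> is Hurwitz, a
  Sylvester equation gives \<open>y\<^sub>d = q p + (exponentially decaying)\<close>, that is, \<open>y\<^sub>d\<close> is asymptotically a
  sinusoid \<open>d\<^sub>1\<close> of unknown frequency. The adaptive observer recovers \<open>d = (d\<^sub>1, d\<^sub>1')\<close> exponentially, and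
  the parameter \<open>\<theta> = \<omega>\<^sup>2\<close> too unless \<open>d = 0\<close>, in which case \<open>\<theta>\<close> is irrelevant. The modes of
  \<open>z = \<epsilon> + f(\<cdot>,\<theta>) d\<close> then obey the delayed closed loop with exponentially decaying perturbations; the first
  \<open>N + 1\<close> of them decay by the Lyapunov-Krasovskii functional encoded in \<open>\<Phi> < 0\<close>, the others by
  themselves. As the modes are summable, \<open>y\<^sub>e\<close> agrees with \<open>z(0,\<cdot>)\<close> up to a decaying term.
\<close>

section \<open>Exponential decay and linear differential inequalities\<close>

text \<open>One obstacle is regularity. The modal equations hold only in integrated form, and the
  trace at x = 0 is a point value, which no bound in L2 controls. The way out is that output
  injection does not reach the observer error beyond index \<open>N\<close>: those modes are
  explicit, and summing them shows that the trace of the error is continuous for t \<ge> 2. Only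
  then do the integral equations become differential equations. Traces are always recovered from
  absolutely summable modes; the gain of mode n with respect to a boundary input is of order 1 /
  n^2, which makes up for boundary coefficients that do not decay in n. The other obstacle is that
  the control depends nonlinearly on an estimated parameter. Therefore z is built with the true
  \<theta> and the exact sinusoid. No derivative of the estimate ever appears, and the estimation
  errors enter only as a perturbation of the input, evaluated at the time t - \<tau> when the
  control was issued. Rates of decay are quantified existentially throughout, as they shrink with
  every coupling of subsystems.\<close>

definition expdecay :: "(real \<Rightarrow> 'a::real_normed_vector) \<Rightarrow> bool" where
  "expdecay f \<longleftrightarrow> (\<exists>\<alpha>>0. \<exists>M T. \<forall>t\<ge>T. norm (f t) \<le> M * exp (- \<alpha> * t))"

definition evbounded :: "(real \<Rightarrow> 'a::real_normed_vector) \<Rightarrow> bool" where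
  "evbounded f \<longleftrightarrow> (\<exists>B T. \<forall>t\<ge>T. norm (f t) \<le> B)"

text \<open>A decay rate may always be lowered once the bound starts at a nonnegative time. Asking
  for a rate strictly below \<beta> keeps denominators such as \<open>\<kappa> - \<alpha>\<close>
  positive where the rule is used; \<open>Tm\<close> lets the bound start after a given
  time.\<close>

lemma expdecayE:
  assumes "expdecay f" "\<beta> > 0"
  obtains \<alpha> M T where "0 < \<alpha>" "\<alpha> < \<beta>" "M \<ge> 0" "T \<ge> Tm" "T \<ge> 0"
    "\<And>t. t \<ge> T \<Longrightarrow> norm (f t) \<le> M * exp (- \<alpha> * t)"
proof -
  obtain \<alpha> M T where h: "\<alpha> > 0" "\<And>t. t \<ge> T \<Longrightarrow> norm (f t) \<le> M * exp (- \<alpha> * t)"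
    using assms(1) unfolding expdecay_def by blast
  define \<gamma> where "\<gamma> = min \<alpha> (\<beta> / 2)"
  define T' where "T' = max T (max 0 Tm)"
  show thesis
  proof (rule that[of \<gamma> "\<bar>M\<bar>" T'])
    fix t assume t: "t \<ge> T'"
    have "norm (f t) \<le> M * exp (- \<alpha> * t)" using h(2) t by (simp add: T'_def)
    also have "\<dots> \<le> \<bar>M\<bar> * exp (- \<gamma> * t)"
    proof (rule mult_mono)
      have "\<gamma> * t \<le> \<alpha> * t" using t by (intro mult_right_mono) (auto simp: \<gamma>_def T'_def)
      then show "exp (- \<alpha> * t) \<le> exp (- \<gamma> * t)" by simp
    qed auto
    finally show "norm (f t) \<le> \<bar>M\<bar> * exp (- \<gamma> * t)" .
  qed (use assms h in \<open>auto simp: \<gamma>_def T'_def\<close>)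
qed

lemma expdecayI:
  assumes "\<alpha> > 0" "\<And>t. t \<ge> T \<Longrightarrow> norm (f t) \<le> M * exp (- \<alpha> * t)"
  shows "expdecay f"
  using assms unfolding expdecay_def by blast

lemma evboundedI:
  assumes "\<And>t. t \<ge> T \<Longrightarrow> norm (f t) \<le> B"
  shows "evbounded f"
  using assms unfolding evbounded_def by blast

lemma evboundedE:
  assumes "evbounded f"
  obtains B T where "B > 0" "T \<ge> Tm" "\<And>t. t \<ge> T \<Longrightarrow> norm (f t) \<le> B"
proof -
  obtain B T where h: "\<And>t. t \<ge> T \<Longrightarrow> norm (f t) \<le> B"
    using assms unfolding evbounded_def by blast
  show thesis
    by (rule that[of "\<bar>B\<bar> + 1" "max T Tm"]) (auto intro: order_trans[OF h])
qed

lemma expdecay_mono: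
  assumes "expdecay g" "\<And>t. t \<ge> T \<Longrightarrow> norm (f t) \<le> C * norm (g t)"
  shows "expdecay f"
proof -
  obtain \<alpha> M S where h: "0 < \<alpha>" "M \<ge> 0" "S \<ge> T" "\<And>t. t \<ge> S \<Longrightarrow> norm (g t) \<le> M * exp (- \<alpha> * t)"
    by (rule expdecayE[OF assms(1) zero_less_one, where Tm=T]) blast
  show ?thesis
  proof (rule expdecayI[OF h(1), of S _ "\<bar>C\<bar> * M"])
    fix t assume t: "t \<ge> S"
    have "norm (f t) \<le> C * norm (g t)" using assms(2) t h(3) by simp
    also have "\<dots> \<le> \<bar>C\<bar> * (M * exp (- \<alpha> * t))"
      by (rule mult_mono) (use h(4) t in auto)
    finally show "norm (f t) \<le> \<bar>C\<bar> * M * exp (- \<alpha> * t)" by (simp add: mult.assoc)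
  qed
qed

lemma expdecay_cong:
  assumes "expdecay g" "\<And>t. t \<ge> T \<Longrightarrow> f t = g t"
  shows "expdecay f"
  by (rule expdecay_mono[OF assms(1), of T _ 1]) (simp add: assms(2))

lemma expdecay_zero [intro, simp]: "expdecay (\<lambda>t. 0)"
  by (rule expdecayI[of 1 0 _ 0]) auto

lemma expdecay_add [intro]:
  assumes "expdecay f" "expdecay g"
  shows "expdecay (\<lambda>t. f t + g t)"
proof -
  obtain \<alpha> M T where f: "0 < \<alpha>" "M \<ge> 0" "\<And>t. t \<ge> T \<Longrightarrow> norm (f t) \<le> M * exp (- \<alpha> * t)"
    by (rule expdecayE[OF assms(1) zero_less_one]) blast
  obtain \<beta> K S where g: "0 < \<beta>" "K \<ge> 0" "S \<ge> 0" "S \<ge> T" "\<And>t. t \<ge> S \<Longrightarrow> norm (g t) \<le> K * exp (- \<beta> * t)"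
    by (rule expdecayE[OF assms(2) zero_less_one, where Tm=T]) blast
  show ?thesis
  proof (rule expdecayI[of "min \<alpha> \<beta>" S _ "M + K"])
    fix t assume t: "t \<ge> S"
    have "exp (- \<alpha> * t) \<le> exp (- min \<alpha> \<beta> * t)" "exp (- \<beta> * t) \<le> exp (- min \<alpha> \<beta> * t)"
      using t g(3) by (auto intro!: mult_right_mono)
    then have "M * exp (- \<alpha> * t) \<le> M * exp (- min \<alpha> \<beta> * t)" "K * exp (- \<beta> * t) \<le> K * exp (- min \<alpha> \<beta> * t)"
      using f g by (auto intro!: mult_left_mono simp del: exp_le_cancel_iff)
    moreover have "norm (f t) \<le> M * exp (- \<alpha> * t)" "norm (g t) \<le> K * exp (- \<beta> * t)"
      using f g t by auto
    ultimately show "norm (f t + g t) \<le> (M + K) * exp (- min \<alpha> \<beta> * t)"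
      unfolding distrib_right by (smt (verit) norm_triangle_ineq)
  qed (use f g in auto)
qed

lemma expdecay_minus [intro]: "expdecay f \<Longrightarrow> expdecay (\<lambda>t. - f t)"
  by (rule expdecay_mono[of f 0 _ 1]) auto

lemma expdecay_diff [intro]: "expdecay f \<Longrightarrow> expdecay g \<Longrightarrow> expdecay (\<lambda>t. f t - g t)"
  using expdecay_add[of f "\<lambda>t. - g t"] by auto

lemma expdecay_cmult [intro]: "expdecay f \<Longrightarrow> expdecay (\<lambda>t. c * f t)" for c :: real
  by (rule expdecay_mono[of f 0 _ "\<bar>c\<bar>"]) (auto simp: abs_mult)

lemma expdecay_multc [intro]: "expdecay f \<Longrightarrow> expdecay (\<lambda>t. f t * c)" for c :: real
  by (rule expdecay_mono[of f 0 _ "\<bar>c\<bar>"]) (auto simp: abs_mult)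

lemma expdecay_sum [intro]:
  "(\<And>i. i \<in> I \<Longrightarrow> expdecay (f i)) \<Longrightarrow> expdecay (\<lambda>t. \<Sum>i\<in>I. f i t)"
  by (induction I rule: infinite_finite_induct) auto

lemma expdecay_norm_mult_bounded:
  assumes "expdecay g" "evbounded h" "\<And>t. t \<ge> T \<Longrightarrow> norm (f t) \<le> norm (g t) * norm (h t)"
  shows "expdecay f"
proof -
  obtain B S where B: "B > 0" "S \<ge> T" "\<And>t. t \<ge> S \<Longrightarrow> norm (h t) \<le> B"
    by (rule evboundedE[OF assms(2), where Tm=T]) blast
  show ?thesis
  proof (rule expdecay_mono[OF assms(1)])
    fix t assume t: "t \<ge> S"
    have "norm (f t) \<le> norm (g t) * norm (h t)" using assms(3) t B by simp
    also have "\<dots> \<le> norm (g t) * B" using B t by (intro mult_left_mono) auto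
    finally show "norm (f t) \<le> B * norm (g t)" by (simp add: mult.commute)
  qed
qed

lemma expdecay_mult_bounded: "expdecay f \<Longrightarrow> evbounded g \<Longrightarrow> expdecay (\<lambda>t. f t * g t)"
  for f g :: "real \<Rightarrow> real"
  by (rule expdecay_norm_mult_bounded[of f g 0]) (auto simp: abs_mult)

lemma expdecay_shift:
  assumes "expdecay f"
  shows "expdecay (\<lambda>t. f (t - \<tau>))"
proof -
  obtain \<alpha> M T where h: "0 < \<alpha>" "M \<ge> 0" "\<And>t. t \<ge> T \<Longrightarrow> norm (f t) \<le> M * exp (- \<alpha> * t)"
    by (rule expdecayE[OF assms zero_less_one]) blast
  show ?thesis
  proof (rule expdecayI[OF h(1), of "T + \<tau>" _ "M * exp (\<alpha> * \<tau>)"])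
    fix t assume "T + \<tau> \<le> t"
    then have "norm (f (t - \<tau>)) \<le> M * exp (- \<alpha> * (t - \<tau>))" using h(3)[of "t - \<tau>"] by simp
    also have "\<dots> = M * exp (\<alpha> * \<tau>) * exp (- \<alpha> * t)"
      by (simp add: exp_add[symmetric] algebra_simps)
    finally show "norm (f (t - \<tau>)) \<le> M * exp (\<alpha> * \<tau>) * exp (- \<alpha> * t)" .
  qed
qed

lemma expdecay_imp_evbounded:
  assumes "expdecay f"
  shows "evbounded f"
proof -
  obtain \<alpha> M T where h: "0 < \<alpha>" "M \<ge> 0" "T \<ge> 0" "\<And>t. t \<ge> T \<Longrightarrow> norm (f t) \<le> M * exp (- \<alpha> * t)"
    by (rule expdecayE[OF assms zero_less_one]) blast
  show ?thesis
  proof (rule evboundedI)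
    fix t assume t: "t \<ge> T"
    have "M * exp (- \<alpha> * t) \<le> M * 1" using h t by (intro mult_left_mono) auto
    then show "norm (f t) \<le> M" using h(4)[OF t] by simp
  qed
qed

lemma evbounded_const [intro, simp]: "evbounded (\<lambda>t. c)"
  by (rule evboundedI) auto

lemma evbounded_add [intro]:
  assumes "evbounded f" "evbounded g"
  shows "evbounded (\<lambda>t. f t + g t)"
proof -
  obtain B T where f: "\<And>t. t \<ge> T \<Longrightarrow> norm (f t) \<le> B"
    using assms(1) unfolding evbounded_def by blast
  obtain C S where g: "S \<ge> T" "\<And>t. t \<ge> S \<Longrightarrow> norm (g t) \<le> C"
    by (rule evboundedE[OF assms(2), where Tm=T]) blast
  show ?thesis
    by (rule evboundedI[of S _ "B + C"])
       (use f g in \<open>auto intro!: order_trans[OF norm_triangle_ineq] add_mono\<close>)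
qed

lemma evbounded_mono:
  assumes "evbounded g" "\<And>t. t \<ge> T \<Longrightarrow> norm (f t) \<le> C * norm (g t)"
  shows "evbounded f"
proof -
  obtain B S where g: "S \<ge> T" "B > 0" "\<And>t. t \<ge> S \<Longrightarrow> norm (g t) \<le> B"
    by (rule evboundedE[OF assms(1), where Tm=T]) blast
  show ?thesis
  proof (rule evboundedI[of S _ "\<bar>C\<bar> * B"])
    fix t assume t: "t \<ge> S"
    have "norm (f t) \<le> C * norm (g t)" using assms(2) t g by simp
    also have "\<dots> \<le> \<bar>C\<bar> * B" by (rule mult_mono) (use g t in auto)
    finally show "norm (f t) \<le> \<bar>C\<bar> * B" .
  qed
qed

lemma evbounded_minus [intro]: "evbounded f \<Longrightarrow> evbounded (\<lambda>t. - f t)"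
  by (rule evbounded_mono[of f 0 _ 1]) auto

lemma evbounded_diff [intro]: "evbounded f \<Longrightarrow> evbounded g \<Longrightarrow> evbounded (\<lambda>t. f t - g t)"
  using evbounded_add[of f "\<lambda>t. - g t"] by auto

lemma evbounded_cmult [intro]: "evbounded f \<Longrightarrow> evbounded (\<lambda>t. c * f t)" for c :: real
  by (rule evbounded_mono[of f 0 _ "\<bar>c\<bar>"]) (auto simp: abs_mult)

lemma evbounded_mult [intro]:
  fixes f g :: "real \<Rightarrow> real"
  assumes "evbounded f" "evbounded g"
  shows "evbounded (\<lambda>t. f t * g t)"
proof -
  obtain B T where f: "B > 0" "\<And>t. t \<ge> T \<Longrightarrow> norm (f t) \<le> B"
    by (rule evboundedE[OF assms(1)]) blast
  obtain C S where g: "S \<ge> T" "\<And>t. t \<ge> S \<Longrightarrow> norm (g t) \<le> C"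
    by (rule evboundedE[OF assms(2), where Tm=T]) blast
  show ?thesis
  proof (rule evboundedI[of S _ "B * C"])
    fix t assume "t \<ge> S"
    then show "norm (f t * g t) \<le> B * C"
      unfolding norm_mult using f g by (intro mult_mono) auto
  qed
qed

lemma expdecay_of_square:
  fixes V :: "real \<Rightarrow> real"
  assumes "expdecay V" "\<And>t. t \<ge> T \<Longrightarrow> (norm (x t))\<^sup>2 \<le> C * V t"
  shows "expdecay x"
proof -
  obtain \<alpha> M S where h: "0 < \<alpha>" "M \<ge> 0" "S \<ge> T" "S \<ge> 0" "\<And>t. t \<ge> S \<Longrightarrow> norm (V t) \<le> M * exp (- \<alpha> * t)"
    by (rule expdecayE[OF assms(1) zero_less_one, where Tm=T]) blast
  show ?thesis
  proof (rule expdecayI[of "\<alpha>/2" S _ "sqrt (\<bar>C\<bar> * M)"])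
    fix t assume t: "t \<ge> S"
    have "(norm (x t))\<^sup>2 \<le> C * V t" using assms(2) h t by simp
    also have "\<dots> \<le> \<bar>C\<bar> * \<bar>V t\<bar>" by (metis abs_ge_self abs_mult)
    also have "\<dots> \<le> \<bar>C\<bar> * (M * exp (- \<alpha> * t))" using h(5)[OF t] by (intro mult_left_mono) auto
    also have "\<dots> = (sqrt (\<bar>C\<bar> * M) * exp (- (\<alpha>/2) * t))\<^sup>2"
      using h by (simp add: power_mult_distrib exp_double[symmetric])
    finally show "norm (x t) \<le> sqrt (\<bar>C\<bar> * M) * exp (- (\<alpha>/2) * t)"
      by (rule power2_le_imp_le) (use h in auto)
  qed (use h in auto)
qed

section \<open>Comparison arguments for scalar differential inequalities\<close>

lemma deriv_nonpos_le:
  fixes f :: "real \<Rightarrow> real"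
  assumes "\<And>s. s \<ge> T \<Longrightarrow> (f has_real_derivative f' s) (at s)" "\<And>s. s \<ge> T \<Longrightarrow> f' s \<le> 0" "t \<ge> T"
  shows "f t \<le> f T"
  by (rule DERIV_nonpos_imp_nonincreasing[OF assms(3)]) (use assms in blast)

text \<open>After multiplication by exp (\<kappa> t) the forcing is at most M exp ((\<kappa> -
  \<alpha>) t), whose explicit antiderivative can be subtracted; what remains is nonincreasing.
  Taking \<alpha> strictly below \<kappa> avoids the resonant case, and \<open>C\<close> is the
  constant of that antiderivative.\<close>

lemma lyapunov_expdecay:
  fixes V g :: "real \<Rightarrow> real"
  assumes dV: "\<And>t. t \<ge> T \<Longrightarrow> (V has_real_derivative V' t) (at t)"
    and le: "\<And>t. t \<ge> T \<Longrightarrow> V' t \<le> - \<kappa> * V t + g t"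
    and nn: "\<And>t. t \<ge> T \<Longrightarrow> V t \<ge> 0" and "\<kappa> > 0" and g: "expdecay g"
  shows "expdecay V"
proof -
  obtain \<alpha> M S where h: "0 < \<alpha>" "\<alpha> < \<kappa>" "M \<ge> 0" "S \<ge> T" "S \<ge> 0" "\<And>t. t \<ge> S \<Longrightarrow> norm (g t) \<le> M * exp (- \<alpha> * t)"
    by (rule expdecayE[OF g \<open>\<kappa> > 0\<close>, where Tm=T]) blast
  define C where "C = M / (\<kappa> - \<alpha>)"
  have C: "C \<ge> 0" "C * (\<kappa> - \<alpha>) = M" using h by (auto simp: C_def)
  define W where "W t = exp (\<kappa> * t) * V t - C * exp ((\<kappa> - \<alpha>) * t)" for t
  have W: "W t \<le> W S" if "t \<ge> S" for t
  proof (rule deriv_nonpos_le[OF _ _ that])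
    fix s assume s: "s \<ge> S"
    show "(W has_real_derivative (exp (\<kappa> * s) * (\<kappa> * V s + V' s) - C * ((\<kappa> - \<alpha>) * exp ((\<kappa> - \<alpha>) * s)))) (at s)"
      unfolding W_def using dV[of s] s h(4)
      by (auto intro!: derivative_eq_intros simp: algebra_simps)
    have "\<kappa> * V s + V' s \<le> M * exp (- \<alpha> * s)"
      using le[of s] h(6)[OF s] s h(4) by auto
    then have "exp (\<kappa> * s) * (\<kappa> * V s + V' s) \<le> exp (\<kappa> * s) * (M * exp (- \<alpha> * s))"
      by (intro mult_left_mono) auto
    also have "\<dots> = M * exp ((\<kappa> - \<alpha>) * s)"
      by (simp add: exp_add[symmetric] algebra_simps)
    also have "\<dots> = C * ((\<kappa> - \<alpha>) * exp ((\<kappa> - \<alpha>) * s))"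
      using C(2) by (simp only: mult.assoc[symmetric])
    finally show "exp (\<kappa> * s) * (\<kappa> * V s + V' s) - C * ((\<kappa> - \<alpha>) * exp ((\<kappa> - \<alpha>) * s)) \<le> 0"
      by simp
  qed
  show ?thesis
  proof (rule expdecayI[OF h(1), of S _ "\<bar>W S\<bar> + C"])
    fix t assume t: "t \<ge> S"
    have "exp (\<kappa> * t) * V t \<le> \<bar>W S\<bar> + C * exp ((\<kappa> - \<alpha>) * t)"
      using W[OF t] unfolding W_def by linarith
    also have "\<dots> \<le> \<bar>W S\<bar> * exp ((\<kappa> - \<alpha>) * t) + C * exp ((\<kappa> - \<alpha>) * t)"
      using h t mult_left_mono[of 1 "exp ((\<kappa> - \<alpha>) * t)" "\<bar>W S\<bar>"] by simp
    finally have "exp (- \<kappa> * t) * (exp (\<kappa> * t) * V t) \<le> exp (- \<kappa> * t) * ((\<bar>W S\<bar> + C) * exp ((\<kappa> - \<alpha>) * t))"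
      by (intro mult_left_mono) (auto simp: distrib_right)
    also have "exp (- \<kappa> * t) * (exp (\<kappa> * t) * V t) = V t"
      by (simp add: exp_minus)
    also have "exp (- \<kappa> * t) * ((\<bar>W S\<bar> + C) * exp ((\<kappa> - \<alpha>) * t)) = (\<bar>W S\<bar> + C) * exp (- \<alpha> * t)"
      by (simp add: exp_add[symmetric] algebra_simps)
    finally show "norm (V t) \<le> (\<bar>W S\<bar> + C) * exp (- \<alpha> * t)" using nn[of t] t h by simp
  qed
qed

text \<open>The square of \<open>x\<close> is a Lyapunov function; half of its dissipation absorbs
  the forcing by Young's inequality.\<close>

lemma linear_ode_expdecay:
  fixes x g :: "real \<Rightarrow> real"
  assumes "\<And>t. t \<ge> T \<Longrightarrow> (x has_real_derivative (- \<kappa> * x t + g t)) (at t)" "\<kappa> > 0" "expdecay g"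
  shows "expdecay x"
proof -
  have gg: "expdecay (\<lambda>t. g t * g t / \<kappa>)"
    using expdecay_multc[OF expdecay_mult_bounded[OF assms(3) expdecay_imp_evbounded[OF assms(3)]], of "1/\<kappa>"] by simp
  have "expdecay (\<lambda>t. (x t)\<^sup>2)"
  proof (rule lyapunov_expdecay[OF _ _ _ \<open>\<kappa> > 0\<close> gg])
    fix t assume "t \<ge> T"
    then show "((\<lambda>t. (x t)\<^sup>2) has_real_derivative (2 * x t * (- \<kappa> * x t + g t))) (at t)"
      by (auto intro!: derivative_eq_intros assms simp: algebra_simps)
    have "0 \<le> (\<kappa> * x t - g t)\<^sup>2 / \<kappa>" using assms by simp
    also have "\<dots> = \<kappa> * (x t)\<^sup>2 - 2 * x t * g t + g t * g t / \<kappa>"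
      using assms(2) by (simp add: field_simps power2_eq_square)
    finally show "2 * x t * (- \<kappa> * x t + g t) \<le> - \<kappa> * (x t)\<^sup>2 + g t * g t / \<kappa>"
      by (simp add: algebra_simps power2_eq_square)
  qed auto
  then show ?thesis
    by (rule expdecay_of_square[where C=1 and T=0]) auto
qed

text \<open>The forcing multiplies \<open>1 + V\<close>, so ln (1 + V) grows at most at the rate
  \<open>g\<close>, which is integrable on a half-line. The second summand of \<open>W\<close> is
  the integral from t to infinity of the bound on \<open>g\<close>.\<close>

lemma gronwall_evbounded:
  fixes V g :: "real \<Rightarrow> real"
  assumes dV: "\<And>t. t \<ge> T \<Longrightarrow> (V has_real_derivative V' t) (at t)"
    and le: "\<And>t. t \<ge> T \<Longrightarrow> V' t \<le> g t * (1 + V t)"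
    and nn: "\<And>t. t \<ge> T \<Longrightarrow> V t \<ge> 0" and g: "expdecay g"
  shows "evbounded V"
proof -
  obtain \<alpha> M S where h: "0 < \<alpha>" "M \<ge> 0" "S \<ge> T" "S \<ge> 0" "\<And>t. t \<ge> S \<Longrightarrow> norm (g t) \<le> M * exp (- \<alpha> * t)"
    by (rule expdecayE[OF g zero_less_one, where Tm=T]) blast
  define W where "W t = ln (1 + V t) + M / \<alpha> * exp (- \<alpha> * t)" for t
  have W: "W t \<le> W S" if "t \<ge> S" for t
  proof (rule deriv_nonpos_le[OF _ _ that])
    fix s assume s: "s \<ge> S"
    have V0: "V s \<ge> 0" using nn s h by simp
    show "(W has_real_derivative (V' s / (1 + V s) - M * exp (- \<alpha> * s))) (at s)"
    proof -
      have "((\<lambda>t. ln (1 + V t)) has_real_derivative V' s / (1 + V s)) (at s)"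
        using dV[of s] s h V0 by (auto intro!: derivative_eq_intros)
      moreover have "((\<lambda>t. M / \<alpha> * exp (- \<alpha> * t)) has_real_derivative - M * exp (- \<alpha> * s)) (at s)"
        using h(1) by (auto intro!: derivative_eq_intros)
      ultimately show ?thesis
        unfolding W_def using DERIV_add by fastforce
    qed
    have "V' s / (1 + V s) \<le> g s" using le[of s] s h V0 by (simp add: divide_le_eq)
    then show "V' s / (1 + V s) - M * exp (- \<alpha> * s) \<le> 0" using h(5)[OF s] by simp
  qed
  show ?thesis
  proof (rule evboundedI[of S _ "exp (W S)"])
    fix t assume t: "t \<ge> S"
    have V0: "V t \<ge> 0" using nn t h by simp
    have "ln (1 + V t) \<le> W t" using h by (simp add: W_def)
    then have "1 + V t \<le> exp (W S)" using W[OF t] V0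
      by (smt (verit) exp_le_cancel_iff exp_ln)
    then show "norm (V t) \<le> exp (W S)" using V0 by simp
  qed
qed

text \<open>The constants are explicit, unlike in \<open>linear_ode_expdecay\<close>: the estimate
  is applied to infinitely many modes at once, and the gain 1 / (m - \<alpha>) is what makes the sum
  over the modes converge.\<close>

lemma mode_bound:
  fixes x g :: "real \<Rightarrow> real"
  assumes d: "\<And>t. t \<ge> T \<Longrightarrow> (x has_real_derivative (- m * x t + g t)) (at t)"
    and g: "\<And>t. t \<ge> T \<Longrightarrow> \<bar>g t\<bar> \<le> C * exp (- \<alpha> * t)" and "m > \<alpha>" "C \<ge> 0" "t \<ge> T"
  shows "\<bar>x t\<bar> \<le> exp (- m * (t - T)) * \<bar>x T\<bar> + C / (m - \<alpha>) * exp (- \<alpha> * t)"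
proof -
  define c where "c = C / (m - \<alpha>)"
  have c: "c \<ge> 0" "c * (m - \<alpha>) = C" using assms by (auto simp: c_def)
  \<comment> \<open>Both signs of \<sigma> are treated together, since the absolute value of
    \<open>x\<close> need not be differentiable.\<close>
  have key: "\<sigma> * x t \<le> exp (- m * (t - T)) * \<bar>x T\<bar> + c * exp (- \<alpha> * t)" if sg: "\<bar>\<sigma>\<bar> = 1" for \<sigma>
  proof -
    define W where "W t = exp (m * t) * (\<sigma> * x t) - c * exp ((m - \<alpha>) * t)" for t
    have "W t \<le> W T"
    proof (rule deriv_nonpos_le[OF _ _ \<open>t \<ge> T\<close>])
      fix s assume s: "s \<ge> T"
      show "(W has_real_derivative (exp (m * s) * (\<sigma> * g s) - c * ((m - \<alpha>) * exp ((m - \<alpha>) * s)))) (at s)"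
        unfolding W_def using d[OF s]
        by (auto intro!: derivative_eq_intros simp: algebra_simps)
      have "\<sigma> * g s \<le> \<bar>\<sigma> * g s\<bar>" by simp
      also have "\<dots> \<le> C * exp (- \<alpha> * s)" using g[OF s] sg by (simp add: abs_mult)
      finally have "exp (m * s) * (\<sigma> * g s) \<le> exp (m * s) * (C * exp (- \<alpha> * s))"
        by (intro mult_left_mono) auto
      also have "\<dots> = C * exp ((m - \<alpha>) * s)"
        by (simp add: exp_add[symmetric] algebra_simps)
      also have "\<dots> = c * ((m - \<alpha>) * exp ((m - \<alpha>) * s))" using c by (simp only: mult.assoc[symmetric])
      finally show "exp (m * s) * (\<sigma> * g s) - c * ((m - \<alpha>) * exp ((m - \<alpha>) * s)) \<le> 0" by simp
    qed
    also have "W T \<le> exp (m * T) * \<bar>x T\<bar>"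
    proof -
      have "\<sigma> * x T \<le> \<bar>x T\<bar>" using sg by (metis abs_ge_self abs_mult mult_1)
      then have "exp (m * T) * (\<sigma> * x T) \<le> exp (m * T) * \<bar>x T\<bar>" by simp
      moreover have "0 \<le> c * exp ((m - \<alpha>) * T)" using c by simp
      ultimately show ?thesis unfolding W_def by linarith
    qed
    finally have "exp (m * t) * (\<sigma> * x t) \<le> exp (m * T) * \<bar>x T\<bar> + c * exp ((m - \<alpha>) * t)"
      unfolding W_def by simp
    then have "exp (- m * t) * (exp (m * t) * (\<sigma> * x t)) \<le> exp (- m * t) * (exp (m * T) * \<bar>x T\<bar> + c * exp ((m - \<alpha>) * t))"
      by (intro mult_left_mono) auto
    also have "exp (- m * t) * (exp (m * t) * (\<sigma> * x t)) = \<sigma> * x t" by (simp add: exp_minus)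
    also have "exp (- m * t) * (exp (m * T) * \<bar>x T\<bar> + c * exp ((m - \<alpha>) * t)) = exp (- m * (t - T)) * \<bar>x T\<bar> + c * exp (- \<alpha> * t)"
    proof -
      have "exp (- m * t) * exp (m * T) = exp (- m * (t - T))" "exp (- m * t) * exp ((m - \<alpha>) * t) = exp (- \<alpha> * t)"
        by (simp_all add: exp_add[symmetric] algebra_simps)
      then show ?thesis
        by (metis (no_types, lifting) distrib_left mult.assoc mult.left_commute)
    qed
    finally show ?thesis .
  qed
  have "x t \<le> exp (- m * (t - T)) * \<bar>x T\<bar> + c * exp (- \<alpha> * t)"
    "- x t \<le> exp (- m * (t - T)) * \<bar>x T\<bar> + c * exp (- \<alpha> * t)"
    using key[of 1] key[of "-1"] by simp_all
  then show ?thesis unfolding c_def by (rule abs_leI)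
qed

text \<open>The integral identity starts at 0, where the integrand may be irregular. Cutting the
  integral at \<open>T\<close> leaves a continuous integrand, to which the fundamental theorem
  applies.\<close>

lemma has_integral_imp_deriv:
  fixes x g :: "real \<Rightarrow> real"
  assumes I: "\<And>t. t \<ge> 0 \<Longrightarrow> (g has_integral x t - x 0) {0..t}"
    and c: "continuous_on {T..} g" and "0 \<le> T" "T < t"
  shows "(x has_real_derivative g t) (at t)"
proof -
  have eq: "x s = x T + integral {T..s} g" if "s \<ge> T" for s
  proof -
    have gi: "g integrable_on {0..s}" using I[of s] that \<open>0 \<le> T\<close> by (auto simp: integrable_on_def)
    have "integral {0..T} g + integral {T..s} g = integral {0..s} g"
      by (rule Henstock_Kurzweil_Integration.integral_combine) (use that \<open>0 \<le> T\<close> gi in auto)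
    moreover have "integral {0..T} g = x T - x 0" "integral {0..s} g = x s - x 0"
      using I[of T] I[of s] that \<open>0 \<le> T\<close> by (auto intro: integral_unique)
    ultimately show ?thesis by simp
  qed
  have "((\<lambda>s. integral {T..s} g) has_real_derivative g t) (at t within {T..t+1})"
    by (rule integral_has_real_derivative) (use assms in \<open>auto intro: continuous_on_subset\<close>)
  then have "((\<lambda>s. integral {T..s} g) has_real_derivative g t) (at t)"
    using \<open>T < t\<close> by (simp add: at_within_Icc_at)
  then have "((\<lambda>s. x T + integral {T..s} g) has_real_derivative g t) (at t)"
    by (auto intro!: derivative_eq_intros)
  then show ?thesis
    by (rule has_field_derivative_transform_within_open[where S="{T<..}"]) (use eq[symmetric] \<open>T < t\<close> in auto)
qed

text \<open>An indefinite integral is continuous for any integrable integrand. This makes the modes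
  and the adaptive states continuous before anything is known about the trace that drives
  them.\<close>

lemma has_integral_imp_continuous:
  fixes x g :: "real \<Rightarrow> real"
  assumes I: "\<And>t. t \<ge> 0 \<Longrightarrow> (g has_integral x t - x 0) {0..t}"
  shows "continuous_on {0..} x"
  unfolding continuous_on_eq_continuous_within
proof
  fix t :: real assume t: "t \<in> {0..}"
  have gi: "g integrable_on {0..t+1}" using I[of "t+1"] t by (auto simp: integrable_on_def)
  have eq: "x s = x 0 + integral {0..s} g" if "s \<ge> 0" for s
    using I[OF that] by (simp add: integral_unique)
  have "continuous_on {0..t+1} (\<lambda>s. x 0 + integral {0..s} g)"
    by (intro continuous_intros indefinite_integral_continuous_1 gi)
  then have "continuous_on {0..t+1} x"
    by (rule continuous_on_eq) (use eq[symmetric] in auto)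
  then have "continuous (at t within {0..t+1}) x"
    using t by (auto simp: continuous_on_eq_continuous_within)
  moreover have "at t within {0..} = at t within {0..t+1}"
    by (rule at_within_nhd[of _ "{..<t+1}"]) auto
  ultimately show "continuous (at t within {0..}) x" by simp
qed

section \<open>Cosine expansions\<close>

lemma phi_alt: "phi n x = (if n = 0 then 1 else sqrt 2) * cos (real n * pi * x)"
  by (simp add: phi_def)

lemma phi_abs_le: "\<bar>phi n x\<bar> \<le> sqrt 2"
proof -
  have "\<bar>sqrt 2 * cos (real n * pi * x)\<bar> \<le> sqrt 2 * 1"
    unfolding abs_mult by (intro mult_mono) auto
  then show ?thesis by (simp add: phi_def)
qed

lemma continuous_on_phi [continuous_intros]: "continuous_on A (phi n)"
  unfolding phi_def by (cases "n = 0") (auto intro!: continuous_intros)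

lemma has_integral_cos_int_pi:
  fixes k :: int
  shows "((\<lambda>x. cos (of_int k * pi * x)) has_integral (if k = 0 then 1 else 0)) {0..1}"
proof (cases "k = 0")
  case True
  then show ?thesis using has_integral_const_real[of "1::real" 0 1] by simp
next
  case False
  have "((\<lambda>x. cos (of_int k * pi * x)) has_integral
      (sin (of_int k * pi * 1) / (of_int k * pi) - sin (of_int k * pi * 0) / (of_int k * pi))) {0..1}"
    by (rule fundamental_theorem_of_calculus)
       (use False in \<open>auto intro!: derivative_eq_intros simp flip: has_real_derivative_iff_has_vector_derivative\<close>)
  then show ?thesis using False by (simp add: sin_integer_2pi mult.commute[of _ pi] sin_zero_iff_int2)
qed

lemma ip01_phi: "ip01 (phi m) (phi n) = (if m = n then 1 else 0)"
proof -
  define c where "c n = (if n = 0 then 1 else sqrt 2)" for n :: nat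
  let ?k1 = "int m - int n" and ?k2 = "int m + int n"
  have eq: "phi m x * phi n x = c m * c n / 2 * (cos (of_int ?k1 * pi * x) + cos (of_int ?k2 * pi * x))" for x
    by (simp add: phi_alt c_def[symmetric] cos_times_cos algebra_simps)
  have "((\<lambda>x. phi m x * phi n x) has_integral
      (c m * c n / 2 * ((if ?k1 = 0 then 1 else 0) + (if ?k2 = 0 then 1 else 0)))) {0..1}"
    unfolding eq by (intro has_integral_mult_right has_integral_add has_integral_cos_int_pi)
  then have "ip01 (phi m) (phi n) = c m * c n / 2 * ((if ?k1 = 0 then 1 else 0) + (if ?k2 = 0 then 1 else 0))"
    unfolding ip01_def by (rule integral_unique)
  also have "\<dots> = (if m = n then 1 else 0)"
    by (auto simp: c_def)
  finally show ?thesis .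
qed

lemma ip01_integrable:
  "continuous_on {0..1} g \<Longrightarrow> continuous_on {0..1} h \<Longrightarrow> (\<lambda>x. g x * h x) integrable_on {0..1::real}"
  for g h :: "real \<Rightarrow> real"
  by (intro integrable_continuous_real continuous_intros)

lemma ip01_add_left:
  "continuous_on {0..1} g \<Longrightarrow> continuous_on {0..1} h \<Longrightarrow> continuous_on {0..1} u \<Longrightarrow>
   ip01 (\<lambda>x. g x + h x) u = ip01 g u + ip01 h u"
  unfolding ip01_def distrib_right by (intro integral_add ip01_integrable)

lemma ip01_diff_left:
  "continuous_on {0..1} g \<Longrightarrow> continuous_on {0..1} h \<Longrightarrow> continuous_on {0..1} u \<Longrightarrow>
   ip01 (\<lambda>x. g x - h x) u = ip01 g u - ip01 h u"
  unfolding ip01_def left_diff_distrib by (intro integral_diff ip01_integrable)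

lemma ip01_sum_phi:
  "finite J \<Longrightarrow> ip01 (\<lambda>x. \<Sum>j\<in>J. l j * phi j x) (phi n) = (if n \<in> J then l n else 0)"
proof -
  assume J: "finite J"
  have "ip01 (\<lambda>x. \<Sum>j\<in>J. l j * phi j x) (phi n) = (\<Sum>j\<in>J. l j * ip01 (phi j) (phi n))"
    unfolding ip01_def sum_distrib_right
    by (subst integral_sum)
       (auto simp: J mult.assoc intro!: integrable_continuous_real continuous_intros)
  then show ?thesis using J by (simp add: ip01_phi if_distrib[of "(*) _"] sum.delta' cong: if_cong)
qed

lemma ip01_phi_bound:
  assumes "continuous_on {0..1} g" "\<And>x. x \<in> {0..1} \<Longrightarrow> \<bar>g x\<bar> \<le> B"
  shows "\<bar>ip01 g (phi n)\<bar> \<le> B * sqrt 2"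
proof -
  have "norm (integral {0..1} (\<lambda>x. g x * phi n x)) \<le> B * sqrt 2 * (1 - 0)"
  proof (rule integral_bound)
    show "continuous_on {0..1} (\<lambda>x. g x * phi n x)" by (intro continuous_intros assms)
    fix x :: real assume "x \<in> {0..1}"
    then show "norm (g x * phi n x) \<le> B * sqrt 2"
      unfolding norm_mult using assms(2)[of x] phi_abs_le[of n x]
      by (intro mult_mono) auto
  qed auto
  then show ?thesis by (simp add: ip01_def)
qed

text \<open>The frequencies range over the integers, so that both terms of the product formula for
  cosines stay in the set. It is thus an algebra, as the Stone-Weierstrass theorem requires.\<close>

inductive_set cospoly :: "(real \<Rightarrow> real) set" where
  single: "(\<lambda>x. c * cos (of_int k * pi * x)) \<in> cospoly"
| add: "f \<in> cospoly \<Longrightarrow> g \<in> cospoly \<Longrightarrow> (\<lambda>x. f x + g x) \<in> cospoly"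

lemma cospoly_mult:
  assumes "f \<in> cospoly" "g \<in> cospoly"
  shows "(\<lambda>x. f x * g x) \<in> cospoly"
  using assms(1)
proof (induction rule: cospoly.induct)
  case (single c k)
  show ?case using assms(2)
  proof (induction rule: cospoly.induct)
    case (single d j)
    have "(\<lambda>x. c * cos (of_int k * pi * x) * (d * cos (of_int j * pi * x))) =
        (\<lambda>x. c * d / 2 * cos (of_int (k - j) * pi * x) + c * d / 2 * cos (of_int (k + j) * pi * x))"
      by (simp add: fun_eq_iff cos_times_cos algebra_simps)
        (simp add: cos_add cos_diff algebra_simps)
    then show ?case by (simp only:) (intro cospoly.intros)
  next
    case (add f g)
    then show ?case by (simp only: distrib_left) (intro cospoly.intros)
  qed
next
  case (add f h)
  then show ?case by (simp only: distrib_right) (intro cospoly.intros)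
qed

lemma continuous_on_cospoly: "f \<in> cospoly \<Longrightarrow> continuous_on A f"
  by (induction rule: cospoly.induct) (auto intro!: continuous_intros)

lemma function_ring_cospoly: "function_ring_on cospoly {0..1}"
proof
  show "(\<lambda>_. c) \<in> cospoly" for c using cospoly.single[of c 0] by simp
  fix x y :: real assume xy: "x \<in> {0..1}" "y \<in> {0..1}" "x \<noteq> y"
  \<comment> \<open>The cosine is injective on [0, pi], so a single member of the algebra separates
    all points.\<close>
  have "cos (pi * x) \<noteq> cos (pi * y)"
    using xy cos_inj_pi[of "pi * x" "pi * y"] by (auto simp: mult_le_cancel_left1)
  moreover have "(\<lambda>x. 1 * cos (of_int 1 * pi * x)) \<in> cospoly" by (rule cospoly.single)
  ultimately show "\<exists>f\<in>cospoly. f x \<noteq> f y" by (intro bexI[of _ "\<lambda>x. 1 * cos (of_int 1 * pi * x)"]) auto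
qed (auto simp: cospoly_mult continuous_on_cospoly cospoly.add)

lemma cospoly_orthogonal:
  assumes "continuous_on {0..1} g" "\<And>n. ip01 g (phi n) = 0" "r \<in> cospoly"
  shows "ip01 g r = 0"
  using assms(3)
proof (induction rule: cospoly.induct)
  case (single c k)
  define m where "m = nat \<bar>k\<bar>"
  have "cos (of_int k * pi * x) = cos (real m * pi * x)" for x
    by (cases "k \<ge> 0") (auto simp: m_def)
  then have "c * cos (of_int k * pi * x) = c / (if m = 0 then 1 else sqrt 2) * phi m x" for x
    by (simp add: phi_alt)
  then have "ip01 g (\<lambda>x. c * cos (of_int k * pi * x)) = ip01 g (\<lambda>x. c / (if m = 0 then 1 else sqrt 2) * phi m x)"
    by presburger
  also have "\<dots> = c / (if m = 0 then 1 else sqrt 2) * ip01 g (phi m)"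
    unfolding ip01_def by (simp only: mult.left_commute[of "g _"] integral_mult_right)
  finally show ?case by (simp add: assms)
next
  case (add f h)
  have "ip01 g (\<lambda>x. f x + h x) = ip01 g f + ip01 g h"
    unfolding ip01_def distrib_left
    by (intro integral_add ip01_integrable assms continuous_on_cospoly add)
  then show ?case using add by simp
qed

text \<open>If \<open>r\<close> is a cosine polynomial uniformly close to \<open>g\<close>, the
  integral of g^2 equals that of g (g - r), because \<open>g\<close> is orthogonal to
  \<open>r\<close>; hence it is arbitrarily small. Continuity turns the vanishing integral into
  pointwise vanishing.\<close>

lemma phi_complete:
  assumes c: "continuous_on {0..1} g" and z: "\<And>n. ip01 g (phi n) = 0" and x: "x \<in> {0..1}"
  shows "g x = 0"
proof -
  interpret function_ring_on cospoly "{0..1}" by (rule function_ring_cospoly)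
  have "bounded (g ` {0..1})" by (intro compact_imp_bounded compact_continuous_image c) auto
  then obtain B where B: "B > 0" "\<And>x. x \<in> {0..1} \<Longrightarrow> \<bar>g x\<bar> \<le> B"
    by (auto simp: bounded_pos)
  have le: "integral {0..1} (\<lambda>x. (g x)\<^sup>2) \<le> e" if "e > 0" for e
  proof -
    obtain r where r: "r \<in> cospoly" "\<And>x. x \<in> {0..1} \<Longrightarrow> \<bar>g x - r x\<bar> < e / B"
      using Stone_Weierstrass_basic[OF c divide_pos_pos[OF \<open>e > 0\<close> B(1)]] by blast
    have cr: "continuous_on {0..1} r" by (rule continuous_on_cospoly[OF r(1)])
    have "integral {0..1} (\<lambda>x. (g x)\<^sup>2) = integral {0..1} (\<lambda>x. g x * (g x - r x) + g x * r x)"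
      by (simp add: algebra_simps power2_eq_square)
    also have "\<dots> = integral {0..1} (\<lambda>x. g x * (g x - r x)) + ip01 g r"
      unfolding ip01_def by (intro integral_add ip01_integrable continuous_intros c cr)
    also have "\<dots> = integral {0..1} (\<lambda>x. g x * (g x - r x))"
      by (simp add: cospoly_orthogonal[OF c z r(1)])
    also have "\<dots> \<le> norm (integral {0..1} (\<lambda>x. g x * (g x - r x)))" by simp
    also have "\<dots> \<le> e * (1 - 0)"
    proof (rule integral_bound)
      fix x :: real assume x: "x \<in> {0..1}"
      have "\<bar>g x\<bar> * \<bar>g x - r x\<bar> \<le> B * (e / B)"
        using r(2)[OF x] B(2)[OF x] by (intro mult_mono) auto
      then show "norm (g x * (g x - r x)) \<le> e" using B by (simp add: abs_mult)
    qed (auto intro!: continuous_intros c cr)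
    finally show ?thesis by simp
  qed
  have "integral {0..1} (\<lambda>x. (g x)\<^sup>2) \<le> 0" by (rule field_le_epsilon) (use le in auto)
  moreover have "integral {0..1} (\<lambda>x. (g x)\<^sup>2) \<ge> 0" by (rule integral_nonneg) (auto intro!: integrable_continuous_real continuous_intros c)
  ultimately have "integral {0..1} (\<lambda>x. (g x)\<^sup>2) = 0" by simp
  then have "\<forall>x\<in>{0..1}. (g x)\<^sup>2 = 0"
    by (subst (asm) integral_eq_0_iff) (auto intro!: continuous_intros c)
  then show ?thesis using x by simp
qed

text \<open>Summability makes the series converge uniformly to some \<open>h\<close>. Termwise
  integration shows that \<open>h\<close> has the coefficients of \<open>g\<close>, and completeness
  identifies the two. This is how values at x = 0 are read off from the modes.\<close>

lemma fourier_sums: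
  assumes c: "continuous_on {0..1} g" and s: "summable (\<lambda>n. \<bar>ip01 g (phi n)\<bar>)" and x: "x \<in> {0..1}"
  shows "(\<lambda>n. ip01 g (phi n) * phi n x) sums g x"
proof -
  define cf where "cf n = ip01 g (phi n)" for n
  define h where "h x = (\<Sum>n. cf n * phi n x)" for x
  have sm: "summable (\<lambda>n. \<bar>cf n\<bar> * sqrt 2)" using s by (intro summable_mult2) (simp add: cf_def)
  have nb: "norm (cf n * phi n y) \<le> \<bar>cf n\<bar> * sqrt 2" for n y
    unfolding norm_mult by (intro mult_mono) (auto simp: phi_abs_le)
  have ul: "uniform_limit {0..1} (\<lambda>n x. \<Sum>i<n. cf i * phi i x) h sequentially"
    unfolding h_def by (rule Weierstrass_m_test[OF nb sm])
  have ch: "continuous_on {0..1} h"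
    by (rule uniform_limit_theorem[OF _ ul]) (auto intro!: continuous_intros always_eventually)
  have mom: "ip01 h (phi m) = cf m" for m
  proof -
    have ul2: "uniform_limit {0..1} (\<lambda>n x. (\<Sum>i<n. cf i * phi i x) * phi m x) (\<lambda>x. h x * phi m x) sequentially"
    proof (intro uniform_lim_mult ul uniform_limit_const)
      show "bounded (h ` {0..1})" by (intro compact_imp_bounded compact_continuous_image ch) auto
      show "bounded (phi m ` {0..1})" by (intro compact_imp_bounded compact_continuous_image continuous_intros) auto
    qed
    obtain I J where IJ: "\<And>n. ((\<lambda>x. (\<Sum>i<n. cf i * phi i x) * phi m x) has_integral I n) {0..1}"
      "((\<lambda>x. h x * phi m x) has_integral J) {0..1}" "(I \<longlongrightarrow> J) sequentially"
      by (rule uniform_limit_integral[OF ul2]) (auto intro!: continuous_intros)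
    have "I n = ip01 (\<lambda>x. \<Sum>i<n. cf i * phi i x) (phi m)" for n
      using IJ(1)[of n] by (simp add: ip01_def integral_unique)
    then have I: "I n = (if m < n then cf m else 0)" for n by (simp add: ip01_sum_phi)
    have "(I \<longlongrightarrow> cf m) sequentially"
      by (rule tendsto_eventually, rule eventually_mono[OF eventually_gt_at_top[of m]]) (simp add: I)
    then have "J = cf m" using IJ(3) LIMSEQ_unique by blast
    then show ?thesis using IJ(2) by (simp add: ip01_def integral_unique)
  qed
  have "(\<lambda>y. g y - h y) x = 0"
    by (rule phi_complete) (use x in \<open>auto intro!: continuous_intros c ch simp: ip01_diff_left[OF c ch] continuous_on_phi mom cf_def\<close>)
  moreover have "summable (\<lambda>n. cf n * phi n x)"
    by (rule summable_comparison_test'[OF sm]) (use nb in auto)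
  ultimately show ?thesis by (simp add: cf_def h_def summable_sums)
qed

section \<open>Quadratic forms and Sylvester equations\<close>

definition qf :: "nat \<Rightarrow> (nat \<Rightarrow> nat \<Rightarrow> real) \<Rightarrow> (nat \<Rightarrow> real) \<Rightarrow> (nat \<Rightarrow> real) \<Rightarrow> real" where
  "qf m X x y = (\<Sum>i<m. \<Sum>j<m. x i * X i j * y j)"

definition mv :: "nat \<Rightarrow> (nat \<Rightarrow> nat \<Rightarrow> real) \<Rightarrow> (nat \<Rightarrow> real) \<Rightarrow> nat \<Rightarrow> real" where
  "mv m X x = (\<lambda>i. \<Sum>j<m. X i j * x j)"

definition sq :: "nat \<Rightarrow> (nat \<Rightarrow> real) \<Rightarrow> real" where
  "sq m x = (\<Sum>i<m. (x i)\<^sup>2)"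

lemma sq_nonneg [simp]: "sq m x \<ge> 0" by (simp add: sq_def sum_nonneg)

lemma sq_component: "i < m \<Longrightarrow> (x i)\<^sup>2 \<le> sq m x"
  unfolding sq_def by (rule member_le_sum) auto

lemma qf_alt: "qf m X x y = (\<Sum>i<m. x i * mv m X y i)"
  by (simp add: qf_def mv_def sum_distrib_left mult.assoc)

lemma qf_cong: "(\<And>i. i < m \<Longrightarrow> x i = x' i) \<Longrightarrow> (\<And>i. i < m \<Longrightarrow> y i = y' i) \<Longrightarrow> qf m X x y = qf m X x' y'"
  by (simp add: qf_def)

lemma qf_mtr: "qf m (mtr X) x y = qf m X y x"
  unfolding qf_def mtr_def by (subst sum.swap) (simp add: mult_ac)

lemma qf_sym: "(\<And>i j. i < m \<Longrightarrow> j < m \<Longrightarrow> X i j = X j i) \<Longrightarrow> qf m X x y = qf m X y x"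
  unfolding qf_def by (subst sum.swap) (simp add: mult_ac)

lemma qf_mmul: "qf m (mmul m X Y) x y = qf m X x (mv m Y y)"
proof -
  have "mv m (mmul m X Y) y = mv m X (mv m Y y)"
    unfolding mv_def mmul_def sum_distrib_left sum_distrib_right
    by (subst sum.swap) (simp add: mult.assoc)
  then show ?thesis by (simp add: qf_alt)
qed

lemma mtr_mmul: "mtr (mmul m X Y) = mmul m (mtr Y) (mtr X)"
  by (simp add: mtr_def mmul_def mult.commute)

lemma mtr_mtr [simp]: "mtr (mtr X) = X"
  by (simp add: mtr_def)

lemma qf_mmul_mtr: "qf m (mmul m (mtr X) Y) x y = qf m Y (mv m X x) y"
proof -
  have "qf m (mmul m (mtr X) Y) x y = qf m (mtr (mmul m (mtr Y) X)) x y" by (simp add: mtr_mmul)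
  also have "\<dots> = qf m (mtr Y) y (mv m X x)" by (simp add: qf_mtr qf_mmul)
  finally show ?thesis by (simp add: qf_mtr)
qed

lemma qf_matrix_add: "qf m (\<lambda>i j. X i j + Y i j) x y = qf m X x y + qf m Y x y"
  by (simp add: qf_def sum.distrib algebra_simps)

lemma qf_matrix_diff: "qf m (\<lambda>i j. X i j - Y i j) x y = qf m X x y - qf m Y x y"
  by (simp add: qf_def sum_subtractf algebra_simps)

lemma qf_matrix_minus: "qf m (\<lambda>i j. - X i j) x y = - qf m X x y"
  by (simp add: qf_def sum_negf)

lemma qf_matrix_scale: "qf m (\<lambda>i j. c * X i j) x y = c * qf m X x y"
  by (simp add: qf_def sum_distrib_left mult_ac)

lemma qf_add_right: "qf m X x (\<lambda>i. y i + z i) = qf m X x y + qf m X x z"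
  by (simp add: qf_def sum.distrib algebra_simps)

lemma qf_diff_right: "qf m X x (\<lambda>i. y i - z i) = qf m X x y - qf m X x z"
  by (simp add: qf_def sum_subtractf algebra_simps)

lemma qf_diff_left: "qf m X (\<lambda>i. y i - z i) x = qf m X y x - qf m X z x"
  by (simp add: qf_def sum_subtractf algebra_simps)

lemma qf_scale_right: "qf m X x (\<lambda>i. c * y i) = c * qf m X x y"
  by (simp add: qf_def sum_distrib_left mult_ac)

lemma qf_scale_left: "qf m X (\<lambda>i. c * x i) y = c * qf m X x y"
  by (simp add: qf_def sum_distrib_left mult_ac)

lemma posdef_sym: "posdef m X \<Longrightarrow> i < m \<Longrightarrow> j < m \<Longrightarrow> X i j = X j i"
  by (simp add: posdef_def)

lemma posdef_qf_pos: "posdef m X \<Longrightarrow> i < m \<Longrightarrow> x i \<noteq> 0 \<Longrightarrow> qf m X x x > 0"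
  unfolding posdef_def qf_def by blast

lemma posdef_qf_nonneg:
  assumes "posdef m X"
  shows "qf m X x x \<ge> 0"
proof (cases "\<exists>i<m. x i \<noteq> 0")
  case True
  then obtain i where "i < m" "x i \<noteq> 0" by blast
  then show ?thesis using posdef_qf_pos[OF assms, of i x] by simp
next
  case False
  then show ?thesis by (simp add: qf_def)
qed

text \<open>The constant is the minimum of the form over the unit sphere; homogeneity extends the
  bound to all vectors.\<close>

lemma posdef_coercive:
  assumes "posdef m X"
  obtains \<kappa> where "\<kappa> > 0" "\<And>x. \<kappa> * sq m x \<le> qf m X x x"
proof (cases "m = 0")
  case True
  then show thesis using that[of 1] by (simp add: sq_def qf_def)
next
  case False
  \<comment> \<open>Vectors are functions on all of nat, so the coordinates from \<open>m\<close> on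
    are pinned to 0. The sphere becomes a closed subset of a product of compact sets, compact by
    Tychonoff's theorem.\<close>
  define P where "P = (\<Pi>\<^sub>E i\<in>(UNIV::nat set). if i < m then {-1..1::real} else {0})"
  define K where "K = P \<inter> {x. sq m x = 1}"
  have "compactin (product_topology (\<lambda>i. euclidean) UNIV) P"
    unfolding P_def compactin_PiE by auto
  then have "compact P" by (simp add: euclidean_product_topology)
  moreover have "closed {x. sq m x = 1}"
    unfolding sq_def by (intro closed_Collect_eq continuous_intros continuous_on_product_coordinates)
  ultimately have cK: "compact K" unfolding K_def by (rule compact_Int_closed)
  have "(\<lambda>i. if i = 0 then 1 else 0) \<in> K"
    using False by (auto simp: K_def P_def sq_def PiE_def if_distrib[of "\<lambda>x. x ^ 2"] cong: if_cong)
  then have neK: "K \<noteq> {}" by blast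
  have cont: "continuous_on K (\<lambda>x. qf m X x x)"
    unfolding qf_def
    by (intro continuous_intros; rule continuous_on_subset[OF continuous_on_product_coordinates subset_UNIV])
  obtain x0 where x0: "x0 \<in> K" "\<And>x. x \<in> K \<Longrightarrow> qf m X x0 x0 \<le> qf m X x x"
    using continuous_attains_inf[OF cK neK cont] by blast
  have "\<exists>i<m. x0 i \<noteq> 0"
  proof (rule ccontr)
    assume "\<not> ?thesis"
    then have "sq m x0 = 0" by (simp add: sq_def)
    then show False using x0(1) by (simp add: K_def)
  qed
  then have pos: "qf m X x0 x0 > 0" using posdef_qf_pos[OF assms] by blast
  show thesis
  proof (rule that[OF pos])
    fix x
    show "qf m X x0 x0 * sq m x \<le> qf m X x x"
    proof (cases "sq m x = 0")
      case True
      then show ?thesis using posdef_qf_nonneg[OF assms] by simp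
    next
      case F: False
      define r where "r = sqrt (sq m x)"
      have r: "r > 0" "r\<^sup>2 = sq m x" using F sq_nonneg[of m x] by (auto simp: r_def less_le)
      define y where "y i = (if i < m then (1 / r) * x i else 0)" for i
      have "sq m y = 1"
      proof -
        have "sq m y = (\<Sum>i<m. (x i)\<^sup>2) / r\<^sup>2"
          by (simp add: sq_def y_def power_divide sum_divide_distrib)
        then show ?thesis using r F by (simp add: sq_def[symmetric])
      qed
      moreover have "\<bar>y i\<bar> \<le> 1" if "i < m" for i
        using sq_component[OF that, of y] calculation by (simp add: abs_square_le_1)
      moreover have "y i = 0" if "\<not> i < m" for i using that by (simp add: y_def)
      ultimately have "y \<in> K" unfolding K_def P_def PiE_def by (auto simp: abs_le_iff minus_le_iff)
      then have "qf m X x0 x0 \<le> qf m X y y" by (rule x0)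
      also have "qf m X y y = qf m X (\<lambda>i. 1 / r * x i) (\<lambda>i. 1 / r * x i)"
        by (rule qf_cong) (auto simp: y_def)
      also have "\<dots> = qf m X x x / r\<^sup>2"
        by (simp only: qf_scale_left qf_scale_right) (simp add: power2_eq_square)
      finally show ?thesis using r zero_less_power[OF r(1), of 2] by (simp add: field_simps)
    qed
  qed
qed

lemma qf_young:
  assumes "\<epsilon> > 0"
  obtains C where "C \<ge> 0" "\<And>x y. 2 * qf m X x y \<le> \<epsilon> * sq m x + C * sq m y"
proof -
  \<comment> \<open>Each component of \<open>x\<close> occurs in \<open>m\<close> summands, each of
    which gets one share of \<epsilon>; the denominator m + 1 also covers m = 0.\<close>
  define e where "e = \<epsilon> / real (m + 1)"
  have e: "e > 0" "e * real m \<le> \<epsilon>" using assms by (auto simp: e_def field_simps)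
  define D where "D = (\<Sum>i<m. \<Sum>j<m. (X i j)\<^sup>2) / e"
  have XD: "(X i j)\<^sup>2 / e \<le> D" if "i < m" "j < m" for i j
  proof -
    have "(X i j)\<^sup>2 \<le> (\<Sum>j<m. (X i j)\<^sup>2)" by (rule member_le_sum) (use that in auto)
    also have "\<dots> \<le> (\<Sum>i<m. \<Sum>j<m. (X i j)\<^sup>2)"
      by (rule member_le_sum) (use that in \<open>auto intro: sum_nonneg\<close>)
    finally show ?thesis using e by (simp add: D_def divide_right_mono)
  qed
  have D0: "D \<ge> 0" using e by (auto simp: D_def intro!: divide_nonneg_pos sum_nonneg)
  show thesis
  proof (rule that[of "real m * D"])
    fix x y :: "nat \<Rightarrow> real"
    have "2 * qf m X x y = (\<Sum>i<m. \<Sum>j<m. 2 * (x i * X i j * y j))"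
      by (simp add: qf_def sum_distrib_left)
    also have "\<dots> \<le> (\<Sum>i<m. \<Sum>j<m. e * (x i)\<^sup>2 + D * (y j)\<^sup>2)"
    proof (intro sum_mono)
      fix i j assume ij: "i \<in> {..<m}" "j \<in> {..<m}"
      have "0 \<le> (e * x i - X i j * y j)\<^sup>2 / e" using e by simp
      also have "\<dots> = e * (x i)\<^sup>2 - 2 * (x i * X i j * y j) + (X i j)\<^sup>2 / e * (y j)\<^sup>2"
        using e by (simp add: field_simps power2_eq_square)
      finally have "2 * (x i * X i j * y j) \<le> e * (x i)\<^sup>2 + (X i j)\<^sup>2 / e * (y j)\<^sup>2" by simp
      also have "\<dots> \<le> e * (x i)\<^sup>2 + D * (y j)\<^sup>2"
        using XD ij by (intro add_left_mono mult_right_mono) auto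
      finally show "2 * (x i * X i j * y j) \<le> e * (x i)\<^sup>2 + D * (y j)\<^sup>2" .
    qed
    also have "\<dots> = e * real m * sq m x + real m * D * sq m y"
      by (simp add: sum.distrib sq_def sum_distrib_left[symmetric] sum_distrib_right[symmetric])
    also have "\<dots> \<le> \<epsilon> * sq m x + real m * D * sq m y"
      using e by (intro add_right_mono mult_right_mono) auto
    finally show "2 * qf m X x y \<le> \<epsilon> * sq m x + real m * D * sq m y" .
  qed (use D0 in auto)
qed

lemma has_real_derivative_qf:
  assumes "\<And>i. i < m \<Longrightarrow> (x i has_real_derivative x' i) (at t)"
    and "\<And>i. i < m \<Longrightarrow> (y i has_real_derivative y' i) (at t)"
  shows "((\<lambda>t. qf m X (\<lambda>i. x i t) (\<lambda>i. y i t)) has_real_derivative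
      (qf m X x' (\<lambda>i. y i t) + qf m X (\<lambda>i. x i t) y')) (at t)"
  unfolding qf_def sum.distrib[symmetric]
proof (intro DERIV_sum)
  fix i j assume "i \<in> {..<m}" "j \<in> {..<m}"
  then show "((\<lambda>t. x i t * X i j * y j t) has_real_derivative
      (x' i * X i j * y j t + x i t * X i j * y' j)) (at t)"
    using assms by (auto intro!: derivative_eq_intros)
qed

lemma expdecay_sq:
  assumes "\<And>i. i < m \<Longrightarrow> expdecay (g i)"
  shows "expdecay (\<lambda>t. sq m (\<lambda>i. g i t))"
  unfolding sq_def power2_eq_square
  by (intro expdecay_sum expdecay_mult_bounded expdecay_imp_evbounded assms) auto

lemma qf_lyapunov:
  assumes "posdef m Q"
  shows "qf m (\<lambda>i j. mmul m Q M i j + mmul m (mtr M) Q i j + c * Q i j) x x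
    = 2 * qf m Q x (mv m M x) + c * qf m Q x x"
proof -
  have "qf m Q (mv m M x) x = qf m Q x (mv m M x)"
    by (rule qf_sym) (rule posdef_sym[OF assms])
  then show ?thesis by (simp only: qf_matrix_add qf_matrix_scale qf_mmul_mtr) (simp add: qf_mmul)
qed

text \<open>The Lyapunov function is the quadratic form of \<open>Q\<close>. The matrix inequality
  supplies the rate 2 \<delta>, and its strictness leaves a multiple \<kappa> of the squared norm,
  which absorbs the cross term with the forcing.\<close>

lemma finite_dim_expdecay:
  fixes D g :: "nat \<Rightarrow> real \<Rightarrow> real"
  assumes Q: "posdef m Q"
    and neg: "negdef m (\<lambda>i j. mmul m Q M i j + mmul m (mtr M) Q i j + 2 * \<delta> * Q i j)"
    and "\<delta> > 0"
    and D: "\<And>i t. i < m \<Longrightarrow> t \<ge> T \<Longrightarrow> (D i has_real_derivative (mv m M (\<lambda>j. D j t) i + g i t)) (at t)"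
    and g: "\<And>i. i < m \<Longrightarrow> expdecay (g i)" and i: "i < m"
  shows "expdecay (D i)"
proof -
  obtain \<kappa> where k: "\<kappa> > 0" "\<And>x. \<kappa> * sq m x \<le> qf m (\<lambda>i j. - (mmul m Q M i j + mmul m (mtr M) Q i j + 2 * \<delta> * Q i j)) x x"
    using posdef_coercive[OF neg[unfolded negdef_def]] by blast
  obtain q where q: "q > 0" "\<And>x. q * sq m x \<le> qf m Q x x"
    using posdef_coercive[OF Q] by blast
  obtain C where C: "C \<ge> 0" "\<And>x y. 2 * qf m Q x y \<le> \<kappa> * sq m x + C * sq m y"
    using qf_young[OF k(1)] by blast
  define V where "V t = qf m Q (\<lambda>i. D i t) (\<lambda>i. D i t)" for t
  have "expdecay V"
  proof (rule lyapunov_expdecay[of T _ _ "2 * \<delta>" "\<lambda>t. C * sq m (\<lambda>i. g i t)"])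
    fix t assume t: "t \<ge> T"
    let ?D = "\<lambda>i. D i t" and ?g = "\<lambda>i. g i t"
    let ?F = "\<lambda>i. mv m M ?D i + ?g i"
    show "(V has_real_derivative (qf m Q ?F ?D + qf m Q ?D ?F)) (at t)"
      unfolding V_def by (rule has_real_derivative_qf) (auto intro: D t)
    have "qf m Q ?F ?D = qf m Q ?D ?F" by (rule qf_sym) (rule posdef_sym[OF Q])
    then have "qf m Q ?F ?D + qf m Q ?D ?F = 2 * qf m Q ?D (mv m M ?D) + 2 * qf m Q ?D ?g"
      by (simp add: qf_add_right)
    also have "\<dots> \<le> - 2 * \<delta> * V t + C * sq m ?g"
      using k(2)[of ?D, unfolded qf_matrix_minus qf_lyapunov[OF Q]] C(2)[of ?D ?g] by (simp add: V_def)
    finally show "qf m Q ?F ?D + qf m Q ?D ?F \<le> - (2 * \<delta>) * V t + C * sq m ?g" by simp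
  qed (use \<open>\<delta> > 0\<close> in \<open>auto simp: V_def posdef_qf_nonneg[OF Q] intro!: expdecay_cmult expdecay_sq g\<close>)
  then show ?thesis
  proof (rule expdecay_of_square)
    fix t assume "t \<ge> T"
    have "q * (D i t)\<^sup>2 \<le> q * sq m (\<lambda>i. D i t)" using q sq_component[OF i, of "\<lambda>i. D i t"] by simp
    also have "\<dots> \<le> V t" unfolding V_def by (rule q)
    finally show "(norm (D i t))\<^sup>2 \<le> (1 / q) * V t" using q by (simp add: field_simps)
  qed
qed

section \<open>Solvability of linear systems over finite index sets\<close>

lemma underdetermined_nontrivial:
  fixes A :: "'i \<Rightarrow> 'j \<Rightarrow> real"
  assumes "finite I" "finite J" "card I < card J"
  shows "\<exists>x. (\<exists>j\<in>J. x j \<noteq> 0) \<and> (\<forall>i\<in>I. (\<Sum>j\<in>J. A i j * x j) = 0)"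
  using assms
proof (induction I arbitrary: A J rule: finite_induct)
  case empty
  then have "J \<noteq> {}" by auto
  then show ?case by (intro exI[of _ "\<lambda>_. 1"]) auto
next
  case (insert i0 I)
  show ?case
  proof (cases "\<forall>j\<in>J. A i0 j = 0")
    case True
    obtain x where "\<exists>j\<in>J. x j \<noteq> 0" "\<forall>i\<in>I. (\<Sum>j\<in>J. A i j * x j) = 0"
      using insert.IH[of J A] insert.prems insert.hyps by auto
    then show ?thesis using True by auto
  next
    case False
    then obtain j0 where j0: "j0 \<in> J" "A i0 j0 \<noteq> 0" by blast
    define J' where "J' = J - {j0}"
    have J': "finite J'" "J = insert j0 J'" "j0 \<notin> J'" using j0 insert.prems by (auto simp: J'_def)
    have "card I < card J'" using insert.prems insert.hyps J' by simp
    then obtain x where x: "\<exists>j\<in>J'. x j \<noteq> 0"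
      "\<And>i. i \<in> I \<Longrightarrow> (\<Sum>j\<in>J'. (A i j - A i j0 * A i0 j / A i0 j0) * x j) = 0"
      using insert.IH[OF J'(1), of "\<lambda>i j. A i j - A i j0 * A i0 j / A i0 j0"] by blast
    \<comment> \<open>Equation \<open>i0\<close> determines the pivot unknown \<open>j0\<close>; the
      reduced system solved by \<open>x\<close> is what the other equations become after this
      substitution.\<close>
    define s where "s = - (\<Sum>j\<in>J'. A i0 j * x j) / A i0 j0"
    define y where "y = x(j0 := s)"
    have sm: "(\<Sum>j\<in>J. A i j * y j) = A i j0 * s + (\<Sum>j\<in>J'. A i j * x j)" for i
    proof -
      have "(\<Sum>j\<in>J'. A i j * y j) = (\<Sum>j\<in>J'. A i j * x j)"
        by (rule sum.cong) (use J' in \<open>auto simp: y_def\<close>)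
      then show ?thesis using J' by (simp add: y_def)
    qed
    have "(\<Sum>j\<in>J. A i j * y j) = 0" if "i \<in> I" for i
    proof -
      have "0 = (\<Sum>j\<in>J'. A i j * x j - A i j0 / A i0 j0 * (A i0 j * x j))"
        using x(2)[OF that] by (simp add: algebra_simps)
      also have "\<dots> = (\<Sum>j\<in>J'. A i j * x j) - A i j0 / A i0 j0 * (\<Sum>j\<in>J'. A i0 j * x j)"
        by (simp only: sum_subtractf sum_distrib_left)
      also have "\<dots> = (\<Sum>j\<in>J'. A i j * x j) + A i j0 * s"
        by (simp add: s_def)
      finally show ?thesis by (simp add: sm)
    qed
    moreover have "(\<Sum>j\<in>J. A i0 j * y j) = 0" using j0 by (simp add: sm s_def)
    moreover have "\<exists>j\<in>J. y j \<noteq> 0" using x(1) J' by (auto simp: y_def)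
    ultimately show ?thesis by (intro exI[of _ y]) auto
  qed
qed

text \<open>The right-hand side is appended as one more column, indexed by \<open>None\<close>. The
  enlarged system has more unknowns than equations, hence a nontrivial solution. Injectivity forces
  its \<open>None\<close> component to be nonzero, and dividing by that component solves the
  original system.\<close>

lemma injective_imp_solvable:
  fixes A :: "'i \<Rightarrow> 'i \<Rightarrow> real"
  assumes "finite I"
    and inj: "\<And>x. (\<And>i. i \<in> I \<Longrightarrow> (\<Sum>j\<in>I. A i j * x j) = 0) \<Longrightarrow> \<forall>j\<in>I. x j = 0"
  shows "\<exists>x. \<forall>i\<in>I. (\<Sum>j\<in>I. A i j * x j) = b i"
proof -
  define J where "J = insert None (Some ` I)"
  define A' where "A' i j = (case j of None \<Rightarrow> - b i | Some j \<Rightarrow> A i j)" for i j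
  have sm: "(\<Sum>j\<in>J. A' i j * x j) = - b i * x None + (\<Sum>j\<in>I. A i j * x (Some j))" for i x
    unfolding J_def using assms(1) by (subst sum.insert) (auto simp: A'_def sum.reindex)
  have "card I < card J" using assms(1) by (simp add: J_def card_image card_insert_if)
  then obtain x where x: "\<exists>j\<in>J. x j \<noteq> 0" "\<And>i. i \<in> I \<Longrightarrow> (\<Sum>j\<in>J. A' i j * x j) = 0"
    using underdetermined_nontrivial[of I J A'] assms(1) by (auto simp: J_def)
  have s: "x None \<noteq> 0"
  proof
    assume z: "x None = 0"
    then have "\<forall>j\<in>I. x (Some j) = 0"
      by (intro inj) (use x(2) in \<open>simp add: sm\<close>)
    then show False using x(1) z by (auto simp: J_def)
  qed
  have "(\<Sum>j\<in>I. A i j * (x (Some j) / x None)) = b i" if "i \<in> I" for i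
    using x(2)[OF that, unfolded sm] s by (simp add: sum_divide_distrib[symmetric] field_simps)
  then show ?thesis by (intro exI[of _ "\<lambda>j. x (Some j) / x None"]) blast
qed

text \<open>This is a square linear system for the 2 m entries of \<open>c\<close>, so injectivity
  suffices. If X G = M X, then x = X u and y = X (G u) satisfy M x = y and M y = - \<theta> x.
  Dissipativity of \<open>M\<close> in the inner product of \<open>Q\<close> makes Q(x, y) negative
  for nonzero x, while the same property at y makes \<theta> Q(x, y) nonnegative. The argument
  stands in for the usual comparison of the spectra of \<open>M\<close> and \<open>G\<close>,
  without complex eigenvectors.\<close>

lemma sylvester_solvable:
  fixes M Q :: "nat \<Rightarrow> nat \<Rightarrow> real" and G :: "real^2^2" and Y :: "nat \<Rightarrow> real^2"
  assumes Q: "posdef m Q"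
    and neg: "negdef m (\<lambda>i j. mmul m Q M i j + mmul m (mtr M) Q i j + 2 * \<delta> * Q i j)" and "\<delta> > 0"
    and G2: "\<And>u. G *v (G *v u) = - \<theta> *\<^sub>R u" and "\<theta> > 0"
  shows "\<exists>c. \<forall>i<m. c i v* G - (\<Sum>j<m. M i j *\<^sub>R c j) = Y i"
proof -
  define I where "I = {..<m} \<times> (UNIV :: 2 set)"
  define A where "A = (\<lambda>(i, b) (j, c). (if i = j then G $ c $ b else 0) - (if b = c then M i j else 0))"
  have sumA: "(\<Sum>jc\<in>I. A (i, b) jc * x jc) =
      ((\<chi> b. x (i, b)) v* G - (\<Sum>j<m. M i j *\<^sub>R (\<chi> b. x (j, b)))) $ b"
    if "i < m" for i b and x :: "nat \<times> 2 \<Rightarrow> real"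
  proof -
    have "(\<Sum>jc\<in>I. A (i, b) jc * x jc) = (\<Sum>j<m. \<Sum>c\<in>UNIV. A (i, b) (j, c) * x (j, c))"
      unfolding I_def by (simp add: sum.cartesian_product)
    also have "\<dots> = (\<Sum>j<m. (if i = j then \<Sum>c\<in>UNIV. G $ c $ b * x (j, c) else 0) - M i j * x (j, b))"
      by (rule sum.cong) (auto simp: A_def left_diff_distrib sum_subtractf if_distrib[of "\<lambda>u. u * _"] cong: if_cong)
    also have "\<dots> = (\<Sum>c\<in>UNIV. G $ c $ b * x (i, c)) - (\<Sum>j<m. M i j * x (j, b))"
      using that by (simp add: sum_subtractf)
    finally show ?thesis by (simp add: vector_matrix_mult_def mult.commute)
  qed
  have inj0: "\<forall>i<m. X i = 0" if X: "\<And>i. i < m \<Longrightarrow> X i v* G = (\<Sum>j<m. M i j *\<^sub>R X j)" for X :: "nat \<Rightarrow> real^2"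
  proof -
    have z: "X i \<bullet> u = 0" if i: "i < m" for i u
    proof (rule ccontr)
      assume ne: "X i \<bullet> u \<noteq> 0"
      define x y where "x = (\<lambda>i. X i \<bullet> u)" and "y = (\<lambda>i. X i \<bullet> (G *v u))"
      have step: "X i \<bullet> (G *v v) = mv m M (\<lambda>j. X j \<bullet> v) i" if "i < m" for i v
        unfolding dot_lmul_matrix[symmetric] X[OF that] by (simp add: mv_def inner_sum_left)
      have y: "y i = mv m M x i" if "i < m" for i unfolding x_def y_def by (rule step[OF that])
      have xx: "- \<theta> * x i = mv m M y i" if "i < m" for i
        using step[OF that, of "G *v u"] unfolding x_def y_def G2 by simp
      have lt: "qf m Q v (mv m M v) < 0" if "j < m" "v j \<noteq> 0" for v j
      proof -
        have "2 * qf m Q v (mv m M v) + 2 * \<delta> * qf m Q v v < 0"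
          using posdef_qf_pos[OF neg[unfolded negdef_def], of j v] that
          unfolding qf_matrix_minus qf_lyapunov[OF Q] by simp
        moreover have "2 * \<delta> * qf m Q v v \<ge> 0" using posdef_qf_nonneg[OF Q] \<open>\<delta> > 0\<close> by simp
        ultimately show ?thesis by linarith
      qed
      have le: "qf m Q v (mv m M v) \<le> 0" for v
      proof (cases "\<exists>j<m. v j \<noteq> 0")
        case True then show ?thesis using lt less_imp_le by blast
      next
        case False then show ?thesis by (simp add: qf_def)
      qed
      have 1: "qf m Q x (mv m M x) = qf m Q x y" by (rule qf_cong) (auto simp: y)
      have "qf m Q y (mv m M y) = qf m Q y (\<lambda>i. - \<theta> * x i)" by (rule qf_cong) (auto simp: xx[symmetric])
      also have "\<dots> = - \<theta> * qf m Q x y"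
        unfolding qf_scale_right using qf_sym[OF posdef_sym[OF Q], where x=y and y=x] by simp
      finally have "\<theta> * qf m Q x y \<ge> 0" using le[of y] by simp
      moreover have "qf m Q x y < 0" using lt[of i x] i ne 1 by (simp add: x_def)
      ultimately show False using \<open>\<theta> > 0\<close> by (simp add: zero_le_mult_iff)
    qed
    have "X i = 0" if "i < m" for i using z[OF that, of "X i"] by simp
    then show ?thesis by blast
  qed
  have "\<exists>x. \<forall>i\<in>I. (\<Sum>j\<in>I. A i j * x j) = (case i of (i, b) \<Rightarrow> Y i $ b)"
  proof (rule injective_imp_solvable)
    show "finite I" by (simp add: I_def)
    fix x assume x: "\<And>i. i \<in> I \<Longrightarrow> (\<Sum>j\<in>I. A i j * x j) = 0"
    have "\<forall>i<m. (\<chi> b. x (i, b)) = 0"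
    proof (rule inj0)
      fix i assume "i < m"
      have mem: "(i, b) \<in> I" for b using \<open>i < m\<close> by (simp add: I_def)
      have "((\<chi> b. x (i, b)) v* G - (\<Sum>j<m. M i j *\<^sub>R (\<chi> b. x (j, b)))) $ b = 0" for b
        unfolding sumA[OF \<open>i < m\<close>, symmetric] by (rule x[OF mem])
      then have "(\<chi> b. x (i, b)) v* G - (\<Sum>j<m. M i j *\<^sub>R (\<chi> b. x (j, b))) = 0"
        unfolding vec_eq_iff zero_index by blast
      then show "(\<chi> b. x (i, b)) v* G = (\<Sum>j<m. M i j *\<^sub>R (\<chi> b. x (j, b)))"
        by (rule eq_iff_diff_eq_0[THEN iffD2])
    qed
    then show "\<forall>j\<in>I. x j = 0" by (auto simp: I_def vec_eq_iff)
  qed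
  then obtain x where x: "\<And>i b. i < m \<Longrightarrow> (\<Sum>j\<in>I. A (i, b) j * x j) = Y i $ b"
    by (auto simp: I_def)
  have "(\<chi> b. x (i, b)) v* G - (\<Sum>j<m. M i j *\<^sub>R (\<chi> b. x (j, b))) = Y i" if "i < m" for i
    unfolding vec_eq_iff sumA[OF that, symmetric] using x[OF that] by blast
  then show ?thesis by (intro exI[of _ "\<lambda>i. \<chi> b. x (i, b)"]) blast
qed

section \<open>The Lyapunov-Krasovskii functional\<close>

lemma sum_three_blocks:
  "(\<Sum>i<3 * m. f i) = (\<Sum>i<m. f i) + (\<Sum>i<m. f (m + i)) + (\<Sum>i<m. f (2 * m + i))"
  for f :: "nat \<Rightarrow> real"
proof -
  have "{..<3 * m} = {0..<m} \<union> ({m..<m + m} \<union> {2 * m..<2 * m + m})" by auto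
  moreover have "sum f ({0..<m} \<union> ({m..<m + m} \<union> {2 * m..<2 * m + m})) =
      sum f {0..<m} + (sum f {m..<m + m} + sum f {2 * m..<2 * m + m})"
    by (subst sum.union_disjoint; (subst sum.union_disjoint)?) auto
  moreover have "sum f {k..<k + m} = (\<Sum>i<m. f (k + i))" for k
    using sum.shift_bounds_nat_ivl[of f 0 k m] by (simp add: lessThan_atLeast0 add.commute)
  ultimately show ?thesis by (metis add.assoc lessThan_atLeast0)
qed

definition three_blocks :: "nat \<Rightarrow> (nat \<Rightarrow> real) \<Rightarrow> (nat \<Rightarrow> real) \<Rightarrow> (nat \<Rightarrow> real) \<Rightarrow> nat \<Rightarrow> real" where
  "three_blocks m x y z i = (if i < m then x i else if i < 2 * m then y (i - m) else z (i - 2 * m))"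

lemma sq_three_blocks: "sq (3 * m) (three_blocks m x y z) = sq m x + sq m y + sq m z"
  by (simp add: sq_def sum_three_blocks three_blocks_def)

text \<open>Descriptor form of the matrix inequality. With \<open>x\<close> the state,
  \<open>y\<close> its derivative and \<open>z\<close> the delayed state, \<open>F\<close> is the
  residual of the delay equation, which vanishes on unperturbed solutions; \<open>P2\<close> and
  \<open>P3\<close> are free multipliers of it. The remaining terms bound V' + 2 \<delta> V for the
  Lyapunov-Krasovskii functional V, the form of \<open>R\<close> in x - z being what Jensen's
  inequality leaves of an integral term.\<close>

lemma qf_Phi:
  fixes P1 P2 P3 S R :: "nat \<Rightarrow> nat \<Rightarrow> real" and a \<delta> \<tau> :: real and k :: "nat \<Rightarrow> real" and N :: nat
  assumes R: "posdef (N + 1) R"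
  defines "m \<equiv> N + 1" and "e \<equiv> exp (- 2 * \<delta> * \<tau>)"
  defines "F \<equiv> \<lambda>x y z i. mv m (Amat a) x i + mv m (\<lambda>i j. Bvec i * k j) z i - y i"
  shows "qf (3 * (N + 1)) (Phi a N k \<delta> \<tau> P1 P2 P3 S R) (three_blocks m x y z) (three_blocks m x y z) =
    2 * qf m P1 x y + 2 * \<delta> * qf m P1 x x + qf m S x x + \<tau>\<^sup>2 * qf m R y y - e * qf m S z z
    - e * qf m R (\<lambda>i. x i - z i) (\<lambda>i. x i - z i)
    + 2 * qf m (mtr P2) x (F x y z) + 2 * qf m (mtr P3) y (F x y z)"
proof -
  define A BK where "A = Amat a" and "BK = (\<lambda>i j. Bvec i * k j)"
  define F11 where "F11 = (\<lambda>i j. mmul m (mtr A) P2 i j + mmul m (mtr P2) A i j + 2 * \<delta> * P1 i j + S i j - e * R i j)"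
  define F12 where "F12 = (\<lambda>i j. P1 i j - mtr P2 i j + mmul m (mtr A) P3 i j)"
  define F13 where "F13 = (\<lambda>i j. e * R i j + mmul m (mtr P2) BK i j)"
  define F22 where "F22 = (\<lambda>i j. - P3 i j - mtr P3 i j + \<tau>\<^sup>2 * R i j)"
  define F23 where "F23 = (\<lambda>i j. mmul m (mtr P3) BK i j)"
  define F33 where "F33 = (\<lambda>i j. - e * (S i j + R i j))"
  let ?P = "Phi a N k \<delta> \<tau> P1 P2 P3 S R"
  let ?v = "three_blocks m x y z"
  have dv: "(m + i) div m = 1" "(2 * m + i) div m = 2" "(m + i) mod m = i" "(2 * m + i) mod m = i" if "i < m" for i
    using that by (auto intro!: div_nat_eqI)
  have blk: "?P i j = F11 i j" "?P i (m + j) = F12 i j" "?P i (2 * m + j) = F13 i j"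
    "?P (m + i) j = mtr F12 i j" "?P (m + i) (m + j) = F22 i j" "?P (m + i) (2 * m + j) = F23 i j"
    "?P (2 * m + i) j = mtr F13 i j" "?P (2 * m + i) (m + j) = mtr F23 i j" "?P (2 * m + i) (2 * m + j) = F33 i j"
    if "i < m" "j < m" for i j
    unfolding Phi_def Let_def m_def[symmetric] dv[OF that(1)] dv[OF that(2)]
    using that
    by (simp_all add: F11_def F12_def F13_def F22_def F23_def F33_def A_def BK_def e_def mtr_def)
  have v: "?v i = x i" "?v (m + i) = y i" "?v (2 * m + i) = z i" if "i < m" for i
    using that by (simp_all add: three_blocks_def)
  have "qf (3 * (N + 1)) ?P ?v ?v =
      (qf m F11 x x + qf m F12 x y + qf m F13 x z) +
      (qf m (mtr F12) y x + qf m F22 y y + qf m F23 y z) +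
      (qf m (mtr F13) z x + qf m (mtr F23) z y + qf m F33 z z)"
    unfolding qf_def m_def[symmetric] sum_three_blocks sum.distrib[symmetric]
    by (intro arg_cong2[of _ _ _ _ "(+)"] sum.cong refl) (simp_all add: v blk)
  also have "\<dots> = qf m F11 x x + 2 * qf m F12 x y + 2 * qf m F13 x z + qf m F22 y y + 2 * qf m F23 y z + qf m F33 z z"
    by (simp add: qf_mtr)
  finally have 1: "qf (3 * (N + 1)) ?P ?v ?v = \<dots>" .
  have q11: "qf m F11 x x = 2 * qf m (mtr P2) x (mv m A x) + 2 * \<delta> * qf m P1 x x + qf m S x x - e * qf m R x x"
  proof -
    have "qf m (mmul m (mtr A) P2) x x = qf m (mtr P2) x (mv m A x)"
      unfolding qf_mmul_mtr by (simp add: qf_mtr)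
    then show ?thesis
      unfolding F11_def qf_matrix_diff qf_matrix_add qf_matrix_scale by (simp add: qf_mmul)
  qed
  have q12: "qf m F12 x y = qf m P1 x y - qf m (mtr P2) x y + qf m (mtr P3) y (mv m A x)"
    unfolding F12_def qf_matrix_diff qf_matrix_add qf_mmul_mtr by (simp add: qf_mtr)
  have q13: "qf m F13 x z = e * qf m R x z + qf m (mtr P2) x (mv m BK z)"
    unfolding F13_def qf_matrix_add qf_matrix_scale qf_mmul by simp
  have q22: "qf m F22 y y = - 2 * qf m (mtr P3) y y + \<tau>\<^sup>2 * qf m R y y"
    unfolding F22_def qf_matrix_add qf_matrix_diff qf_matrix_scale qf_matrix_minus qf_mtr by simp
  have q23: "qf m F23 y z = qf m (mtr P3) y (mv m BK z)"
    unfolding F23_def qf_mmul by simp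
  have q33: "qf m F33 z z = - e * qf m S z z - e * qf m R z z"
    unfolding F33_def qf_matrix_scale qf_matrix_add by (simp add: algebra_simps)
  have Rs: "qf m R z x = qf m R x z" by (rule qf_sym) (use posdef_sym[OF R] in \<open>auto simp: m_def\<close>)
  show ?thesis
    unfolding 1 q11 q12 q13 q22 q23 q33 F_def A_def[symmetric] BK_def[symmetric]
      qf_diff_right qf_diff_left qf_add_right Rs
    by (simp add: algebra_simps)
qed

lemma window_integral_deriv:
  fixes h :: "real \<Rightarrow> real"
  assumes c: "continuous_on {T..} h" and "\<tau> > 0" "t > T + \<tau>"
  shows "((\<lambda>t. integral {t - \<tau>..t} h) has_real_derivative (h t - h (t - \<tau>))) (at t)"
proof -
  define J where "J s = integral {T..s} h" for s
  have J: "(J has_real_derivative h s) (at s)" if "s > T" for s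
  proof -
    have "((\<lambda>s. integral {T..s} h) has_real_derivative h s) (at s within {T..s+1})"
      by (rule integral_has_real_derivative) (use that c in \<open>auto intro: continuous_on_subset\<close>)
    then show ?thesis unfolding J_def using that by (simp add: at_within_Icc_at)
  qed
  have eq: "J s - J (s - \<tau>) = integral {s - \<tau>..s} h" if "s > T + \<tau>" for s
  proof -
    have "integral {T..s - \<tau>} h + integral {s - \<tau>..s} h = integral {T..s} h"
      by (rule Henstock_Kurzweil_Integration.integral_combine)
         (use that \<open>\<tau> > 0\<close> c in \<open>auto intro!: integrable_continuous_real intro: continuous_on_subset\<close>)
    then show ?thesis by (simp add: J_def)
  qed
  have "((\<lambda>s. J s - J (s - \<tau>)) has_real_derivative (h t - h (t - \<tau>))) (at t)"
  proof (rule DERIV_diff)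
    show "(J has_real_derivative h t) (at t)" by (rule J) (use assms in auto)
    have "((\<lambda>s. s - \<tau>) has_real_derivative 1) (at t)" by (auto intro!: derivative_eq_intros)
    then have "((\<lambda>s. J (s - \<tau>)) has_real_derivative h (t - \<tau>) * 1) (at t)"
      by (intro DERIV_chain2[of J] J) (use assms in auto)
    then show "((\<lambda>s. J (s - \<tau>)) has_real_derivative h (t - \<tau>)) (at t)" by simp
  qed
  then show ?thesis
    by (rule has_field_derivative_transform_within_open[where S="{T + \<tau><..}"]) (use eq assms in auto)
qed

text \<open>The form is nonnegative at \<open>v s\<close> minus the mean of \<open>v\<close> over
  the window; the claim is this fact integrated over the window.\<close>

lemma qf_jensen:
  assumes R: "posdef m R" and "\<tau> > 0"
    and c: "\<And>i. i < m \<Longrightarrow> continuous_on {b - \<tau>..b} (v i)"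
  shows "qf m R (\<lambda>i. integral {b - \<tau>..b} (v i)) (\<lambda>i. integral {b - \<tau>..b} (v i))
    \<le> \<tau> * integral {b - \<tau>..b} (\<lambda>s. qf m R (\<lambda>i. v i s) (\<lambda>i. v i s))"
proof -
  define w where "w i = integral {b - \<tau>..b} (v i)" for i
  have sym: "qf m R x y = qf m R y x" for x y by (rule qf_sym) (rule posdef_sym[OF R])
  have vi: "(v i has_integral w i) {b - \<tau>..b}" if "i < m" for i
    unfolding w_def using c[OF that] by (intro integrable_integral integrable_continuous_real)
  have vv: "continuous_on {b - \<tau>..b} (\<lambda>s. qf m R (\<lambda>i. v i s) (\<lambda>i. v i s))"
    unfolding qf_def by (intro continuous_intros c) auto
  have lin: "((\<lambda>s. qf m R w (\<lambda>i. v i s)) has_integral qf m R w w) {b - \<tau>..b}"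
    unfolding qf_def by (intro has_integral_sum has_integral_mult_right vi) auto
  define Z where "Z = integral {b - \<tau>..b} (\<lambda>s. qf m R (\<lambda>i. v i s) (\<lambda>i. v i s))"
  have "((\<lambda>s. qf m R (\<lambda>i. v i s) (\<lambda>i. v i s) - 2 / \<tau> * qf m R w (\<lambda>i. v i s) + qf m R w w / \<tau>\<^sup>2)
      has_integral (Z - 2 / \<tau> * qf m R w w + \<tau> * (qf m R w w / \<tau>\<^sup>2))) {b - \<tau>..b}"
    unfolding Z_def
    using has_integral_const_real[of "qf m R w w / \<tau>\<^sup>2" "b - \<tau>" b] \<open>\<tau> > 0\<close>
    by (intro has_integral_add has_integral_diff has_integral_mult_right lin integrable_integral integrable_continuous_real vv) simp
  then have "0 \<le> Z - 2 / \<tau> * qf m R w w + \<tau> * (qf m R w w / \<tau>\<^sup>2)"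
  proof (rule has_integral_nonneg)
    fix s
    have "0 \<le> qf m R (\<lambda>i. v i s - (1 / \<tau>) * w i) (\<lambda>i. v i s - (1 / \<tau>) * w i)"
      by (rule posdef_qf_nonneg[OF R])
    also have "\<dots> = qf m R (\<lambda>i. v i s) (\<lambda>i. v i s) - 2 / \<tau> * qf m R w (\<lambda>i. v i s) + qf m R w w / \<tau>\<^sup>2"
      unfolding qf_diff_left qf_diff_right qf_scale_left qf_scale_right
      using sym[of w "\<lambda>i. v i s"] \<open>\<tau> > 0\<close> by (simp add: field_simps power2_eq_square)
    finally show "0 \<le> qf m R (\<lambda>i. v i s) (\<lambda>i. v i s) - 2 / \<tau> * qf m R w (\<lambda>i. v i s) + qf m R w w / \<tau>\<^sup>2" .
  qed
  then have "qf m R w w / \<tau> \<le> Z" using \<open>\<tau> > 0\<close> by (simp add: power2_eq_square field_simps)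
  then show ?thesis unfolding w_def[symmetric] Z_def[symmetric] using \<open>\<tau> > 0\<close> by (simp add: field_simps)
qed

text \<open>Without \<open>g\<close> the matrix inequality yields V' \<le> - 2 \<delta> V. Being
  strict, it leaves a multiple \<kappa> of the squared norms of state, derivative and delayed state,
  which pays for \<open>g\<close>. The derivative has a name of its own, \<open>X'\<close>, because
  the functional contains it under an integral and so needs it to be continuous.\<close>

lemma delay_lmi_expdecay:
  fixes X X' g :: "nat \<Rightarrow> real \<Rightarrow> real" and P1 P2 P3 S R :: "nat \<Rightarrow> nat \<Rightarrow> real"
  assumes P1: "posdef (N + 1) P1" and S: "posdef (N + 1) S" and R: "posdef (N + 1) R"
    and neg: "negdef (3 * (N + 1)) (Phi a N k \<delta> \<tau> P1 P2 P3 S R)"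
    and "\<delta> > 0" "\<tau> > 0"
    and dX: "\<And>i t. i < N + 1 \<Longrightarrow> t \<ge> T \<Longrightarrow> (X i has_real_derivative X' i t) (at t)"
    and X': "\<And>i t. i < N + 1 \<Longrightarrow> t \<ge> T \<Longrightarrow> X' i t = mv (N + 1) (Amat a) (\<lambda>j. X j t) i
        + mv (N + 1) (\<lambda>i j. Bvec i * k j) (\<lambda>j. X j (t - \<tau>)) i + g i t"
    and cX': "\<And>i. i < N + 1 \<Longrightarrow> continuous_on {T..} (X' i)"
    and g: "\<And>i. i < N + 1 \<Longrightarrow> expdecay (g i)" and i: "i < N + 1"
  shows "expdecay (X i)"
proof -
  define m where "m = N + 1"
  define e where "e = exp (- 2 * \<delta> * \<tau>)"
  have e: "e > 0" by (simp add: e_def)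
  obtain \<kappa> where k: "\<kappa> > 0" "\<And>x. \<kappa> * sq (3 * m) x \<le> qf (3 * m) (\<lambda>i j. - Phi a N k \<delta> \<tau> P1 P2 P3 S R i j) x x"
    using posdef_coercive[OF neg[unfolded negdef_def]] unfolding m_def by blast
  obtain q where q: "q > 0" "\<And>x. q * sq m x \<le> qf m P1 x x"
    using posdef_coercive[OF P1] unfolding m_def by blast
  \<comment> \<open>Both estimates may spend the full \<kappa>: the first is charged to the state
    block of the matrix inequality, the second to the derivative block.\<close>
  obtain C2 where C2: "C2 \<ge> 0" "\<And>x y. 2 * qf m (mtr P2) x y \<le> \<kappa> * sq m x + C2 * sq m y"
    using qf_young[OF k(1)] by blast
  obtain C3 where C3: "C3 \<ge> 0" "\<And>x y. 2 * qf m (mtr P3) x y \<le> \<kappa> * sq m x + C3 * sq m y"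
    using qf_young[OF k(1)] by blast
  have cX: "continuous_on {T..} (X i)" if "i < m" for i
    by (intro continuous_at_imp_continuous_on ballI, rule DERIV_isCont[OF dX]) (use that in \<open>auto simp: m_def\<close>)
  define \<sigma> where "\<sigma> s = qf m S (\<lambda>i. X i s) (\<lambda>i. X i s)" for s
  define \<rho> where "\<rho> s = qf m R (\<lambda>i. X' i s) (\<lambda>i. X' i s)" for s
  have c\<sigma>: "continuous_on {T..} \<sigma>" unfolding \<sigma>_def qf_def by (intro continuous_intros cX) auto
  have c\<rho>: "continuous_on {T..} \<rho>" unfolding \<rho>_def qf_def by (intro continuous_intros cX') (auto simp: m_def)
  have nn: "\<sigma> s \<ge> 0" "\<rho> s \<ge> 0" for s
    unfolding \<sigma>_def \<rho>_def using posdef_qf_nonneg[OF S] posdef_qf_nonneg[OF R] by (auto simp: m_def)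
  \<comment> \<open>The weight exp (- 2 \<delta> (t - s)) is split into a factor in t and a factor
    in s, so that t enters the window integrals only through their limits. The additional factor s
    in \<open>h2\<close> serves to build the weight s - (t - \<tau>).\<close>
  define h1 h2 h3 where "h1 s = exp (2 * \<delta> * s) * \<sigma> s" and "h2 s = s * (exp (2 * \<delta> * s) * \<rho> s)"
    and "h3 s = exp (2 * \<delta> * s) * \<rho> s" for s
  have ch: "continuous_on {T..} h1" "continuous_on {T..} h2" "continuous_on {T..} h3"
    unfolding h1_def h2_def h3_def by (intro continuous_intros c\<sigma> c\<rho>)+
  define W where "W h t = integral {t - \<tau>..t} h" for h :: "real \<Rightarrow> real" and t
  have hi: "h integrable_on {t - \<tau>..t}" if "continuous_on {T..} h" "t > T + \<tau>" for h :: "real \<Rightarrow> real" and t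
    by (rule integrable_continuous_real, rule continuous_on_subset[OF that(1)]) (use that in auto)
  define V1 where "V1 t = qf m P1 (\<lambda>i. X i t) (\<lambda>i. X i t)" for t
  define V2 where "V2 t = exp (- 2 * \<delta> * t) * W h1 t" for t
  \<comment> \<open>the double integral of the functional, with the order of integration exchanged\<close>
  define V3 where "V3 t = exp (- 2 * \<delta> * t) * (W h2 t - (t - \<tau>) * W h3 t)" for t
  define V where "V t = V1 t + V2 t + \<tau> * V3 t" for t
  define T1 where "T1 = T + \<tau> + 1"
  have dW: "(W h has_real_derivative (h t - h (t - \<tau>))) (at t)" if "continuous_on {T..} h" "t \<ge> T1" for h t
    unfolding W_def by (rule window_integral_deriv[OF that(1)]) (use that \<open>\<tau> > 0\<close> in \<open>auto simp: T1_def\<close>)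
  have V1nn: "V1 t \<ge> 0" for t unfolding V1_def using posdef_qf_nonneg[OF P1] by (simp add: m_def)
  have V2nn: "V2 t \<ge> 0" if "t \<ge> T1" for t
    unfolding V2_def W_def
    by (intro mult_nonneg_nonneg integral_nonneg hi ch) (use that in \<open>auto simp: T1_def h1_def nn\<close>)
  have V3nn: "V3 t \<ge> 0" if "t \<ge> T1" for t
  proof -
    have t: "t > T + \<tau>" using that by (simp add: T1_def)
    have "W h2 t - (t - \<tau>) * W h3 t = integral {t - \<tau>..t} (\<lambda>s. h2 s - (t - \<tau>) * h3 s)"
      unfolding W_def using hi[OF ch(2) t] hi[OF ch(3) t]
      by (subst Henstock_Kurzweil_Integration.integral_diff) (auto intro: integrable_on_mult_right)
    also have "\<dots> \<ge> 0"
    proof (intro Henstock_Kurzweil_Integration.integral_nonneg Henstock_Kurzweil_Integration.integrable_diff hi[OF ch(2) t] integrable_on_mult_right hi[OF ch(3) t])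
      fix s assume "s \<in> {t - \<tau>..t}"
      then have "0 \<le> (s - (t - \<tau>)) * h3 s" by (intro mult_nonneg_nonneg) (auto simp: h3_def nn)
      then show "0 \<le> h2 s - (t - \<tau>) * h3 s" by (simp add: h2_def h3_def algebra_simps)
    qed
    finally show ?thesis unfolding V3_def by simp
  qed
  have "expdecay V"
  proof (rule lyapunov_expdecay[of T1 _ _ "2 * \<delta>" "\<lambda>t. (C2 + C3) * sq m (\<lambda>i. g i t)"])
    fix t assume t: "t \<ge> T1"
    then have tT: "t \<ge> T" "t > T + \<tau>" "t - \<tau> \<ge> T" using \<open>\<tau> > 0\<close> by (auto simp: T1_def)
    let ?x = "\<lambda>i. X i t" and ?y = "\<lambda>i. X' i t" and ?z = "\<lambda>i. X i (t - \<tau>)" and ?g = "\<lambda>i. g i t"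
    define D1 where "D1 = 2 * qf m P1 ?x ?y"
    define D2 where "D2 = - 2 * \<delta> * V2 t + \<sigma> t - e * \<sigma> (t - \<tau>)"
    define D3 where "D3 = - 2 * \<delta> * V3 t + \<tau> * \<rho> t - exp (- 2 * \<delta> * t) * W h3 t"
    have "(V1 has_real_derivative qf m P1 ?y ?x + qf m P1 ?x ?y) (at t)"
      unfolding V1_def by (rule has_real_derivative_qf) (auto intro: dX tT simp: m_def)
    moreover have "qf m P1 ?y ?x = qf m P1 ?x ?y"
      by (rule qf_sym) (rule posdef_sym[OF P1], auto simp: m_def)
    ultimately have d1: "(V1 has_real_derivative D1) (at t)" by (simp add: D1_def)
    have ee: "exp (- 2 * \<delta> * t) * exp (2 * \<delta> * t) = 1" "exp (- 2 * \<delta> * t) * exp (2 * \<delta> * (t - \<tau>)) = e"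
      by (simp_all add: exp_add[symmetric] e_def algebra_simps)
    have dexp: "((\<lambda>t. exp (- 2 * \<delta> * t)) has_real_derivative - 2 * \<delta> * exp (- 2 * \<delta> * t)) (at t)"
      by (auto intro!: derivative_eq_intros)
    have "(V2 has_real_derivative (- 2 * \<delta> * exp (- 2 * \<delta> * t)) * W h1 t + (h1 t - h1 (t - \<tau>)) * exp (- 2 * \<delta> * t)) (at t)"
      unfolding V2_def by (rule DERIV_mult[OF dexp dW[OF ch(1) t]])
    moreover have "(- 2 * \<delta> * exp (- 2 * \<delta> * t)) * W h1 t + (h1 t - h1 (t - \<tau>)) * exp (- 2 * \<delta> * t) =
        - 2 * \<delta> * V2 t + (exp (- 2 * \<delta> * t) * exp (2 * \<delta> * t)) * \<sigma> t
        - (exp (- 2 * \<delta> * t) * exp (2 * \<delta> * (t - \<tau>))) * \<sigma> (t - \<tau>)"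
      unfolding V2_def h1_def by (simp only: algebra_simps)
    ultimately have d2: "(V2 has_real_derivative D2) (at t)" unfolding ee D2_def by simp
    have dl: "((\<lambda>t. t - \<tau>) has_real_derivative 1) (at t)" by (auto intro!: derivative_eq_intros)
    have din: "((\<lambda>t. W h2 t - (t - \<tau>) * W h3 t) has_real_derivative
        (h2 t - h2 (t - \<tau>)) - (1 * W h3 t + (h3 t - h3 (t - \<tau>)) * (t - \<tau>))) (at t)"
      by (rule DERIV_diff[OF dW[OF ch(2) t] DERIV_mult[OF dl dW[OF ch(3) t]]])
    have "(h2 t - h2 (t - \<tau>)) - (1 * W h3 t + (h3 t - h3 (t - \<tau>)) * (t - \<tau>)) = \<tau> * h3 t - W h3 t"
      by (simp add: h2_def h3_def algebra_simps)
    note din = din[unfolded this]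
    have "(V3 has_real_derivative (- 2 * \<delta> * exp (- 2 * \<delta> * t)) * (W h2 t - (t - \<tau>) * W h3 t)
        + (\<tau> * h3 t - W h3 t) * exp (- 2 * \<delta> * t)) (at t)"
      unfolding V3_def by (rule DERIV_mult[OF dexp din])
    moreover have "(- 2 * \<delta> * exp (- 2 * \<delta> * t)) * (W h2 t - (t - \<tau>) * W h3 t)
        + (\<tau> * h3 t - W h3 t) * exp (- 2 * \<delta> * t) =
        - 2 * \<delta> * V3 t + \<tau> * ((exp (- 2 * \<delta> * t) * exp (2 * \<delta> * t)) * \<rho> t) - exp (- 2 * \<delta> * t) * W h3 t"
      unfolding V3_def h3_def by (simp only: algebra_simps)
    ultimately have d3: "(V3 has_real_derivative D3) (at t)" unfolding ee D3_def by simp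
    show "(V has_real_derivative D1 + D2 + \<tau> * D3) (at t)"
      unfolding V_def by (intro DERIV_add DERIV_cmult d1 d2 d3)
    \<comment> \<open>On the window the weight in the integral left over by \<open>D3\<close> is at
      least e. Jensen's inequality then turns the integral of \<open>\<rho>\<close> into the form of
      the increment X(t) - X(t - \<tau>), which is the integral of \<open>X'\<close>.\<close>
    have jen: "e * qf m R (\<lambda>i. ?x i - ?z i) (\<lambda>i. ?x i - ?z i) \<le> \<tau> * (exp (- 2 * \<delta> * t) * W h3 t)"
    proof -
      have iv: "integral {t - \<tau>..t} (X' i) = ?x i - ?z i" if "i < m" for i
      proof (rule integral_unique, rule fundamental_theorem_of_calculus)
        fix s assume "s \<in> {t - \<tau>..t}"
        then have "(X i has_real_derivative X' i s) (at s)" using dX[of i s] tT that by (auto simp: m_def)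
        then show "(X i has_vector_derivative X' i s) (at s within {t - \<tau>..t})"
          by (simp add: has_real_derivative_iff_has_vector_derivative has_vector_derivative_at_within)
      qed (use \<open>\<tau> > 0\<close> in auto)
      have "qf m R (\<lambda>i. ?x i - ?z i) (\<lambda>i. ?x i - ?z i) =
          qf m R (\<lambda>i. integral {t - \<tau>..t} (X' i)) (\<lambda>i. integral {t - \<tau>..t} (X' i))"
        by (rule qf_cong) (auto simp: iv)
      also have "\<dots> \<le> \<tau> * integral {t - \<tau>..t} \<rho>"
        unfolding \<rho>_def
        by (rule qf_jensen) (use R \<open>\<tau> > 0\<close> tT in \<open>auto simp: m_def intro: continuous_on_subset[OF cX']\<close>)
      finally have "e * qf m R (\<lambda>i. ?x i - ?z i) (\<lambda>i. ?x i - ?z i) \<le> \<tau> * (e * integral {t - \<tau>..t} \<rho>)"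
        using e by (simp add: mult.left_commute)
      also have "e * integral {t - \<tau>..t} \<rho> \<le> exp (- 2 * \<delta> * t) * W h3 t"
      proof -
        have "integral {t - \<tau>..t} (\<lambda>s. e * \<rho> s) \<le> integral {t - \<tau>..t} (\<lambda>s. exp (- 2 * \<delta> * t) * h3 s)"
        proof (intro integral_le integrable_on_mult_right hi[OF c\<rho> tT(2)] hi[OF ch(3) tT(2)])
          fix s assume "s \<in> {t - \<tau>..t}"
          then have "\<delta> * (t - \<tau>) \<le> \<delta> * s" using \<open>\<delta> > 0\<close> by simp
          then have "e \<le> exp (- 2 * \<delta> * t) * exp (2 * \<delta> * s)"
            unfolding e_def exp_add[symmetric] by (simp add: right_diff_distrib)
          then have "e * \<rho> s \<le> (exp (- 2 * \<delta> * t) * exp (2 * \<delta> * s)) * \<rho> s"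
            by (intro mult_right_mono nn)
          then show "e * \<rho> s \<le> exp (- 2 * \<delta> * t) * h3 s" by (simp add: h3_def mult.assoc)
        qed
        then show ?thesis by (simp add: W_def)
      qed
      then have "\<tau> * (e * integral {t - \<tau>..t} \<rho>) \<le> \<tau> * (exp (- 2 * \<delta> * t) * W h3 t)"
        using \<open>\<tau> > 0\<close> by simp
      finally show ?thesis .
    qed
    \<comment> \<open>The residual of the descriptor form. Along the perturbed solution it equals -
      g, so the multiplier terms do not vanish but are linear in the perturbation.\<close>
    define F where "F = (\<lambda>i. mv m (Amat a) ?x i + mv m (\<lambda>i j. Bvec i * k j) ?z i - ?y i)"
    have F: "F i = - 1 * g i t" if "i < m" for i
      using X'[of i t] that tT by (simp add: F_def m_def)
    have Fq: "qf m Y u F = - qf m Y u ?g" for Y u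
    proof -
      have "qf m Y u F = qf m Y u (\<lambda>i. - 1 * g i t)" by (rule qf_cong) (auto simp: F)
      then show ?thesis by (simp only: qf_scale_right)
    qed
    have "D1 + D2 + \<tau> * D3 + 2 * \<delta> * V t =
        2 * qf m P1 ?x ?y + 2 * \<delta> * qf m P1 ?x ?x + \<sigma> t - e * \<sigma> (t - \<tau>) + \<tau>\<^sup>2 * \<rho> t
        - \<tau> * (exp (- 2 * \<delta> * t) * W h3 t)"
      unfolding D1_def D2_def D3_def V_def V1_def by (simp add: algebra_simps power2_eq_square)
    also have "\<dots> \<le> 2 * qf m P1 ?x ?y + 2 * \<delta> * qf m P1 ?x ?x + \<sigma> t - e * \<sigma> (t - \<tau>) + \<tau>\<^sup>2 * \<rho> t
        - e * qf m R (\<lambda>i. ?x i - ?z i) (\<lambda>i. ?x i - ?z i)"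
      using jen by simp
    also have "\<dots> = qf (3 * m) (Phi a N k \<delta> \<tau> P1 P2 P3 S R) (three_blocks m ?x ?y ?z) (three_blocks m ?x ?y ?z)
        + 2 * qf m (mtr P2) ?x ?g + 2 * qf m (mtr P3) ?y ?g"
      using qf_Phi[OF R, where a=a and k=k and \<delta>=\<delta> and \<tau>=\<tau> and x="?x" and y="?y" and z="?z"
          and ?P1.0=P1 and ?P2.0=P2 and ?P3.0=P3 and S=S, folded m_def e_def, folded F_def]
      unfolding Fq \<sigma>_def \<rho>_def by simp
    also have "\<dots> \<le> - (\<kappa> * (sq m ?x + sq m ?y + sq m ?z)) + (\<kappa> * sq m ?x + C2 * sq m ?g) + (\<kappa> * sq m ?y + C3 * sq m ?g)"
      using k(2)[of "three_blocks m ?x ?y ?z", unfolded qf_matrix_minus sq_three_blocks]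
        C2(2)[of ?x ?g] C3(2)[of ?y ?g] by linarith
    also have "\<dots> \<le> (C2 + C3) * sq m ?g"
      using k(1) by (simp add: algebra_simps)
    finally show "D1 + D2 + \<tau> * D3 \<le> - (2 * \<delta>) * V t + (C2 + C3) * sq m ?g" by simp
  next
    fix t assume "t \<ge> T1"
    then show "V t \<ge> 0" unfolding V_def using V1nn V2nn V3nn \<open>\<tau> > 0\<close> by simp
  qed (use \<open>\<delta> > 0\<close> g in \<open>auto simp: m_def intro!: expdecay_cmult expdecay_sq\<close>)
  then show ?thesis
  proof (rule expdecay_of_square)
    fix t assume t: "t \<ge> T1"
    have "q * (X i t)\<^sup>2 \<le> q * sq m (\<lambda>i. X i t)" using q sq_component[of i m "\<lambda>i. X i t"] i by (simp add: m_def)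
    also have "\<dots> \<le> V1 t" unfolding V1_def by (rule q)
    also have "\<dots> \<le> V t" unfolding V_def using V2nn[OF t] V3nn[OF t] \<open>\<tau> > 0\<close> by simp
    finally show "(norm (X i t))\<^sup>2 \<le> (1 / q) * V t" using q by (simp add: field_simps)
  qed
qed

section \<open>The adaptive observer\<close>

lemma evbounded_of_square:
  fixes x V :: "real \<Rightarrow> real"
  assumes "evbounded V" "\<And>t. t \<ge> T \<Longrightarrow> (x t)\<^sup>2 \<le> C * V t"
  shows "evbounded x"
proof (rule evbounded_mono[of "\<lambda>t. 1 + \<bar>C\<bar> * \<bar>V t\<bar>" T _ 1])
  have "evbounded (\<lambda>t. \<bar>V t\<bar>)" by (rule evbounded_mono[OF assms(1), of 0 _ 1]) auto
  then show "evbounded (\<lambda>t. 1 + \<bar>C\<bar> * \<bar>V t\<bar>)" by (intro evbounded_add evbounded_cmult evbounded_const)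
  fix t assume "t \<ge> T"
  then have "(x t)\<^sup>2 \<le> C * V t" by (rule assms)
  also have "\<dots> \<le> \<bar>C\<bar> * \<bar>V t\<bar>" by (metis abs_ge_self abs_mult)
  finally have "(x t)\<^sup>2 \<le> \<bar>C\<bar> * \<bar>V t\<bar>" .
  moreover have "\<bar>x t\<bar> \<le> 1 + (x t)\<^sup>2"
  proof -
    have "0 \<le> (\<bar>x t\<bar> - 1)\<^sup>2" by simp
    also have "\<dots> = (x t)\<^sup>2 + 1 - 2 * \<bar>x t\<bar>" by (simp add: power2_eq_square algebra_simps)
    finally show ?thesis by linarith
  qed
  ultimately have "\<bar>x t\<bar> \<le> 1 + \<bar>C\<bar> * \<bar>V t\<bar>" by linarith
  also have "\<dots> \<le> \<bar>1 + \<bar>C\<bar> * \<bar>V t\<bar>\<bar>" by simp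
  finally show "norm (x t) \<le> 1 * norm (1 + \<bar>C\<bar> * \<bar>V t\<bar>)" by simp
qed

text \<open>The energy has zero derivative. Besides boundedness this yields uniqueness, when applied
  to the difference of two solutions.\<close>

lemma oscillator_energy:
  fixes u v :: "real \<Rightarrow> real"
  assumes "\<And>t. t \<ge> T \<Longrightarrow> (u has_real_derivative v t) (at t)"
    and "\<And>t. t \<ge> T \<Longrightarrow> (v has_real_derivative - \<theta> * u t) (at t)" and "t \<ge> T"
  shows "(v t)\<^sup>2 + \<theta> * (u t)\<^sup>2 = (v T)\<^sup>2 + \<theta> * (u T)\<^sup>2"
proof -
  define E where "E t = (v t)\<^sup>2 + \<theta> * (u t)\<^sup>2" for t
  have d: "(E has_real_derivative 0) (at s)" if "s \<ge> T" for s
    unfolding E_def using assms(1,2)[OF that] by (auto intro!: derivative_eq_intros simp: algebra_simps)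
  have "E t \<le> E T" by (rule deriv_nonpos_le[OF d _ assms(3)]) auto
  moreover have "- E t \<le> - E T" by (rule deriv_nonpos_le[OF DERIV_minus[OF d] _ assms(3)]) auto
  ultimately show ?thesis by (simp add: E_def)
qed

lemma oscillator_bounded:
  fixes u v :: "real \<Rightarrow> real"
  assumes "\<And>t. t \<ge> T \<Longrightarrow> (v t)\<^sup>2 + \<theta> * (u t)\<^sup>2 = c" "\<theta> > 0"
  shows "evbounded u" "evbounded v"
proof -
  show "evbounded u"
  proof (rule evbounded_of_square[of "\<lambda>_. c" T _ "1/\<theta>"])
    fix t assume "t \<ge> T"
    then have "\<theta> * (u t)\<^sup>2 \<le> c" using assms(1)[of t] zero_le_power2[of "v t"] by linarith
    then show "(u t)\<^sup>2 \<le> 1 / \<theta> * c" using assms(2) by (simp add: field_simps)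
  qed auto
  show "evbounded v"
  proof (rule evbounded_of_square[of "\<lambda>_. c" T _ 1])
    fix t assume "t \<ge> T"
    moreover have "0 \<le> \<theta> * (u t)\<^sup>2" using assms(2) by simp
    ultimately show "(v t)\<^sup>2 \<le> 1 * c" using assms(1)[of t] by linarith
  qed auto
qed

text \<open>The system below is exponentially stable because \<open>s\<close> is a nonzero sinusoid. The quadratic form
  \<open>e\<^sup>2 + q\<^sup>2 / \<mu>1\<close> only dissipates \<open>e\<close>; the correction \<open>s e q + s s' q\<^sup>2 / (2 \<theta>)\<close> adds dissipation in
  \<open>q\<close>, since \<open>s\<^sup>2 + (s s')' / (2 \<theta>)\<close> is the constant \<open>c / (2 \<theta>)\<close>.\<close>
lemma persistent_excitation_expdecay:
  fixes e q s sd \<rho>1 \<rho>2 :: "real \<Rightarrow> real"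
  assumes pos: "\<mu>0 > 0" "\<mu>1 > 0" "\<theta> > 0" "c > 0"
    and ds: "\<And>t. t \<ge> T \<Longrightarrow> (s has_real_derivative sd t) (at t)"
    and dsd: "\<And>t. t \<ge> T \<Longrightarrow> (sd has_real_derivative - \<theta> * s t) (at t)"
    and en: "\<And>t. t \<ge> T \<Longrightarrow> (sd t)\<^sup>2 + \<theta> * (s t)\<^sup>2 = c"
    and de: "\<And>t. t \<ge> T \<Longrightarrow> (e has_real_derivative - \<mu>0 * e t + s t * q t + \<rho>1 t) (at t)"
    and dq: "\<And>t. t \<ge> T \<Longrightarrow> (q has_real_derivative - \<mu>1 * s t * e t + \<rho>2 t) (at t)"
    and r: "expdecay \<rho>1" "expdecay \<rho>2" and b: "evbounded e" "evbounded q"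
  shows "expdecay e" "expdecay q"
proof -
  have bs: "evbounded s" "evbounded sd"
    using oscillator_bounded[of T sd \<theta> s c] en pos(3) by blast+
  obtain B1 T1 where B1: "B1 > 0" "T1 \<ge> T" "\<And>t. t \<ge> T1 \<Longrightarrow> norm (s t) \<le> B1"
    by (rule evboundedE[OF bs(1), where Tm=T]) blast
  obtain B2 T2 where B2: "B2 > 0" "T2 \<ge> T1" "\<And>t. t \<ge> T2 \<Longrightarrow> norm (sd t) \<le> B2"
    by (rule evboundedE[OF bs(2), where Tm=T1]) blast
  have sb: "\<bar>s t\<bar> \<le> B1" "\<bar>sd t\<bar> \<le> B2" if "t \<ge> T2" for t using B1(3)[of t] B2(3)[of t] B2(2) that by auto
  define h where "h = 1 / (2 * \<theta>)"
  define u where "u = 1 / \<mu>1"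
  have h: "h > 0" "2 * \<theta> * h = 1" and u: "u > 0" "u * \<mu>1 = 1" using pos by (auto simp: h_def u_def)
  \<comment> \<open>The coefficient of e q in the derivative of \<open>X\<close>, perturbations left
    aside.\<close>
  define a where "a t = sd t - \<mu>0 * s t - 2 * h * \<mu>1 * s t * s t * sd t" for t
  have ba: "evbounded a" unfolding a_def by (intro evbounded_diff evbounded_mult evbounded_const bs)
  obtain A T3 where A: "A > 0" "T3 \<ge> T2" "\<And>t. t \<ge> T3 \<Longrightarrow> norm (a t) \<le> A"
    by (rule evboundedE[OF ba, where Tm=T2]) blast
  \<comment> \<open>The coefficient of q^2 in the derivative of \<open>X\<close>: s^2 + h (sd^2 -
    \<theta> s^2) = h c, because 2 \<theta> h = 1.\<close>
  define c2 where "c2 = c * h"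
  have c2: "c2 > 0" using pos h by (simp add: c2_def)
  define D where "D = B1 + h * B1 * B2"
  have D: "D > 0" using B1 B2 h by (simp add: D_def add_pos_pos)
  \<comment> \<open>Half of the smallest coefficient of e^2 + u q^2; the other half pays for the
    indefinite correction \<epsilon> X.\<close>
  define \<kappa>1 where "\<kappa>1 = min 1 u / 2"
  have \<kappa>1: "\<kappa>1 > 0" "2 * \<kappa>1 \<le> 1" "2 * \<kappa>1 \<le> u" using u by (auto simp: \<kappa>1_def)
  define Z where "Z = A\<^sup>2 / (2 * c2) + \<mu>1 * B1\<^sup>2 + 1"
  have Z: "Z > 0" using c2 pos by (auto simp: Z_def intro!: add_nonneg_pos)
  \<comment> \<open>The bound through \<open>Z\<close> keeps the e^2 terms coming from the
    correction below half of the dissipation 2 \<mu>0 e^2; the bound through \<open>D\<close> keeps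
    \<open>W\<close> positive definite.\<close>
  define \<epsilon> where "\<epsilon> = min (\<mu>0 / Z) (\<kappa>1 / D)"
  have \<epsilon>: "\<epsilon> > 0" "\<epsilon> * Z \<le> \<mu>0" "\<epsilon> * D \<le> \<kappa>1"
    using pos Z D \<kappa>1 by (auto simp: \<epsilon>_def min_def field_simps)
  define X where "X t = s t * e t * q t + h * (s t * sd t * (q t)\<^sup>2)" for t
  define W where "W t = (e t)\<^sup>2 + u * (q t)\<^sup>2 - \<epsilon> * X t" for t
  define n where "n t = (e t)\<^sup>2 + (q t)\<^sup>2" for t
  have n0: "n t \<ge> 0" for t by (simp add: n_def)
  have eq_le: "\<bar>e t * q t\<bar> \<le> n t" for t
  proof -
    have "0 \<le> (\<bar>e t\<bar> - \<bar>q t\<bar>)\<^sup>2" by simp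
    then have "2 * (\<bar>e t\<bar> * \<bar>q t\<bar>) \<le> n t" by (simp add: power2_diff n_def)
    then show ?thesis using n0[of t] by (simp add: abs_mult)
  qed
  have X: "\<bar>\<epsilon> * X t\<bar> \<le> \<kappa>1 * n t" if "t \<ge> T2" for t
  proof -
    have "\<bar>s t * e t * q t\<bar> \<le> B1 * n t"
      unfolding mult.assoc abs_mult[of "s t"] using sb[OF that] eq_le B1 by (intro mult_mono) auto
    moreover have "\<bar>h * (s t * sd t * (q t)\<^sup>2)\<bar> \<le> h * (B1 * B2 * n t)"
      unfolding abs_mult using sb[OF that] B1 B2 h by (intro mult_mono) (auto simp: n_def)
    ultimately have "\<bar>X t\<bar> \<le> D * n t" unfolding X_def D_def by (simp add: algebra_simps)
    then have "\<bar>\<epsilon> * X t\<bar> \<le> \<epsilon> * (D * n t)" using \<epsilon> by (simp add: abs_mult)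
    also have "\<dots> \<le> \<kappa>1 * n t" using \<epsilon> n0 by (simp add: mult.assoc[symmetric] mult_right_mono)
    finally show ?thesis .
  qed
  have W_ge: "\<kappa>1 * n t \<le> W t" if "t \<ge> T2" for t
  proof -
    have "2 * \<kappa>1 * (e t)\<^sup>2 \<le> 1 * (e t)\<^sup>2" "2 * \<kappa>1 * (q t)\<^sup>2 \<le> u * (q t)\<^sup>2"
      using \<kappa>1 by (intro mult_right_mono; simp)+
    then have "2 * \<kappa>1 * n t \<le> (e t)\<^sup>2 + u * (q t)\<^sup>2" by (simp add: n_def algebra_simps)
    then show ?thesis using X[OF that] unfolding W_def by linarith
  qed
  define K where "K = 1 + u + \<kappa>1"
  have K: "K > 0" using u \<kappa>1 by (simp add: K_def)
  have W_le: "W t \<le> K * n t" if "t \<ge> T2" for t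
  proof -
    have "u * (q t)\<^sup>2 \<le> u * n t" using u by (simp add: n_def)
    then have "(e t)\<^sup>2 + u * (q t)\<^sup>2 \<le> (1 + u) * n t" by (simp add: n_def algebra_simps)
    then show ?thesis using X[OF that] unfolding W_def K_def by (simp add: algebra_simps)
  qed
  define g where "g t = 2 * e t * \<rho>1 t + 2 * u * q t * \<rho>2 t
      - \<epsilon> * (s t * q t * \<rho>1 t + s t * e t * \<rho>2 t + 2 * h * s t * sd t * q t * \<rho>2 t)" for t
  have g_alt: "g = (\<lambda>t. \<rho>1 t * (2 * e t) + \<rho>2 t * (2 * u * q t)
      - \<epsilon> * (\<rho>1 t * (s t * q t) + \<rho>2 t * (s t * e t) + \<rho>2 t * (2 * h * s t * sd t * q t)))"
    by (simp add: fun_eq_iff g_def algebra_simps)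
  have dg: "expdecay g"
    unfolding g_alt
    by (intro expdecay_add expdecay_diff expdecay_cmult expdecay_mult_bounded evbounded_mult evbounded_const r b bs)
  define k0 where "k0 = min \<mu>0 (\<epsilon> * c2 / 2)"
  have k0: "k0 > 0" "k0 \<le> \<mu>0" "k0 \<le> \<epsilon> * c2 / 2" using pos \<epsilon> c2 by (auto simp: k0_def)
  have "expdecay W"
  proof (rule lyapunov_expdecay[of T3 W _ "k0 / K" g])
    fix t assume t: "t \<ge> T3"
    have tT: "t \<ge> T" "t \<ge> T2" using t A B1 B2 by auto
    define e' where "e' = - \<mu>0 * e t + s t * q t + \<rho>1 t"
    define q' where "q' = - \<mu>1 * s t * e t + \<rho>2 t"
    define W' where "W' = 2 * e t * e' + u * (2 * q t * q')
        - \<epsilon> * ((sd t * e t + s t * e') * q t + s t * e t * q'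
            + h * ((sd t * sd t + s t * (- \<theta> * s t)) * (q t)\<^sup>2 + s t * sd t * (2 * q t * q')))"
    note dd = ds[OF tT(1)] dsd[OF tT(1)] de[OF tT(1), folded e'_def] dq[OF tT(1), folded q'_def]
    show "(W has_real_derivative W') (at t)"
      unfolding W_def X_def W'_def
      by (rule derivative_eq_intros dd refl)+ (simp add: algebra_simps)
    have "W' = - 2 * \<mu>0 * (e t)\<^sup>2 - \<epsilon> * (c2 * (q t)\<^sup>2 + a t * (e t * q t)) + \<epsilon> * (\<mu>1 * (s t)\<^sup>2 * (e t)\<^sup>2) + g t"
    proof -
      have "c = (sd t)\<^sup>2 + \<theta> * (s t)\<^sup>2" using en[OF tT(1)] by simp
      then show ?thesis
        unfolding W'_def e'_def q'_def g_def a_def c2_def using h(2) u(2) by algebra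
    qed
    also have "\<dots> \<le> - 2 * \<mu>0 * (e t)\<^sup>2 - \<epsilon> * (c2 / 2 * (q t)\<^sup>2) + \<epsilon> * (A\<^sup>2 / (2 * c2) * (e t)\<^sup>2)
        + \<epsilon> * (\<mu>1 * B1\<^sup>2 * (e t)\<^sup>2) + g t"
    proof -
      have "- (a t * (e t * q t)) \<le> \<bar>a t\<bar> * \<bar>e t * q t\<bar>" by (metis abs_ge_minus_self abs_mult)
      also have "\<dots> \<le> A * (\<bar>e t\<bar> * \<bar>q t\<bar>)"
        unfolding abs_mult using A t by (intro mult_right_mono) auto
      also have "\<dots> \<le> c2 / 2 * (q t)\<^sup>2 + A\<^sup>2 / (2 * c2) * (e t)\<^sup>2"
      proof -
        have "0 \<le> (c2 * \<bar>q t\<bar> - A * \<bar>e t\<bar>)\<^sup>2 / (2 * c2)" using c2 by simp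
        also have "\<dots> = c2 / 2 * (q t)\<^sup>2 + A\<^sup>2 / (2 * c2) * (e t)\<^sup>2 - A * (\<bar>e t\<bar> * \<bar>q t\<bar>)"
          using c2 by (simp add: power2_diff power_mult_distrib) (simp add: field_simps power2_eq_square)
        finally show ?thesis by simp
      qed
      finally have "- (a t * (e t * q t)) \<le> c2 / 2 * (q t)\<^sup>2 + A\<^sup>2 / (2 * c2) * (e t)\<^sup>2" .
      then have "- (c2 * (q t)\<^sup>2 + a t * (e t * q t)) \<le> - (c2 / 2 * (q t)\<^sup>2) + A\<^sup>2 / (2 * c2) * (e t)\<^sup>2"
        by (simp add: field_simps)
      then have "\<epsilon> * (- (c2 * (q t)\<^sup>2 + a t * (e t * q t))) \<le> \<epsilon> * (- (c2 / 2 * (q t)\<^sup>2) + A\<^sup>2 / (2 * c2) * (e t)\<^sup>2)"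
        using \<epsilon>(1) by (intro mult_left_mono) auto
      moreover have "\<epsilon> * (\<mu>1 * (s t)\<^sup>2 * (e t)\<^sup>2) \<le> \<epsilon> * (\<mu>1 * B1\<^sup>2 * (e t)\<^sup>2)"
        using \<epsilon>(1) pos sb(1)[OF tT(2)] B1(1) by (intro mult_left_mono mult_right_mono) (auto simp: abs_le_square_iff[symmetric])
      ultimately show ?thesis by (simp add: algebra_simps)
    qed
    also have "\<dots> \<le> - \<mu>0 * (e t)\<^sup>2 - \<epsilon> * c2 / 2 * (q t)\<^sup>2 + g t"
    proof -
      have "\<epsilon> * Z * (e t)\<^sup>2 \<le> \<mu>0 * (e t)\<^sup>2" using \<epsilon>(2) by (intro mult_right_mono) auto
      moreover have "0 \<le> \<epsilon> * (e t)\<^sup>2" using \<epsilon> by simp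
      ultimately show ?thesis unfolding Z_def by (simp add: algebra_simps)
    qed
    also have "\<dots> \<le> - k0 * n t + g t"
    proof -
      have "k0 * (e t)\<^sup>2 \<le> \<mu>0 * (e t)\<^sup>2" "k0 * (q t)\<^sup>2 \<le> \<epsilon> * c2 / 2 * (q t)\<^sup>2"
        using k0 by (intro mult_right_mono; simp)+
      then show ?thesis by (simp add: n_def algebra_simps)
    qed
    also have "\<dots> \<le> - (k0 / K) * W t + g t"
    proof -
      have "k0 / K * W t \<le> k0 / K * (K * n t)" using W_le[OF tT(2)] k0 K by (intro mult_left_mono) auto
      then show ?thesis using K by simp
    qed
    finally show "W' \<le> - (k0 / K) * W t + g t" .
  next
    fix t assume "t \<ge> T3"
    then have "\<kappa>1 * n t \<le> W t" using W_ge A by auto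
    moreover have "0 \<le> \<kappa>1 * n t" using \<kappa>1 n0 by simp
    ultimately show "0 \<le> W t" by linarith
  qed (use k0 K dg in auto)
  moreover have "(e t)\<^sup>2 \<le> (1 / \<kappa>1) * W t" "(q t)\<^sup>2 \<le> (1 / \<kappa>1) * W t" if "t \<ge> T2" for t
  proof -
    have "\<kappa>1 * (e t)\<^sup>2 \<le> \<kappa>1 * n t" "\<kappa>1 * (q t)\<^sup>2 \<le> \<kappa>1 * n t" using \<kappa>1 by (auto simp: n_def)
    then have "\<kappa>1 * (e t)\<^sup>2 \<le> W t" "\<kappa>1 * (q t)\<^sup>2 \<le> W t" using W_ge[OF that] by linarith+
    then show "(e t)\<^sup>2 \<le> (1 / \<kappa>1) * W t" "(q t)\<^sup>2 \<le> (1 / \<kappa>1) * W t" using \<kappa>1 by (simp_all add: field_simps)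
  qed
  ultimately show "expdecay e" "expdecay q"
    by (auto intro!: expdecay_of_square[where V=W and T=T2 and C="1 / \<kappa>1"])
qed

text \<open>The filter state \<open>\<xi>\<close> tends to the periodic response \<open>s\<close> to
  the sinusoid, and d2 = \<iota> d1 + (\<iota>^2 + \<theta>) s is linear in the unknown \<theta>. So
  \<open>e\<close> and \<open>q\<close> satisfy the standard error equations of adaptive estimation
  with regressor \<open>\<xi>\<close>. Boundedness must come before convergence: replacing
  \<open>\<xi>\<close> by \<open>s\<close> costs a term x q, which is seen to decay only once
  \<open>q\<close> is known to be bounded.\<close>

lemma adaptive_observer_convergence:
  fixes y \<xi> \<chi>1 \<phi> \<theta>h d1 d2 :: "real \<Rightarrow> real"
  assumes pos: "\<iota> > 0" "\<mu>0 > 0" "\<mu>1 > 0" "\<theta> > 0"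
    and dd1: "\<And>t. t \<ge> T \<Longrightarrow> (d1 has_real_derivative d2 t) (at t)"
    and dd2: "\<And>t. t \<ge> T \<Longrightarrow> (d2 has_real_derivative - \<theta> * d1 t) (at t)"
    and r: "expdecay (\<lambda>t. y t - d1 t)"
    and dxi: "\<And>t. t \<ge> T \<Longrightarrow> (\<xi> has_real_derivative - \<iota> * \<xi> t - y t) (at t)"
    and dchi: "\<And>t. t \<ge> T \<Longrightarrow> (\<chi>1 has_real_derivative \<phi> t + \<iota> * y t + \<theta>h t * \<xi> t + \<mu>0 * (y t - \<chi>1 t)) (at t)"
    and dphi: "\<And>t. t \<ge> T \<Longrightarrow> (\<phi> has_real_derivative - \<iota> * \<phi> t - \<iota>\<^sup>2 * y t) (at t)"
    and dth: "\<And>t. t \<ge> T \<Longrightarrow> (\<theta>h has_real_derivative \<mu>1 * \<xi> t * (y t - \<chi>1 t)) (at t)"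
  shows "evbounded \<theta>h" "expdecay (\<lambda>t. \<chi>1 t - d1 t)" "expdecay (\<lambda>t. \<phi> t + \<xi> t * \<theta>h t + \<iota> * \<chi>1 t - d2 t)"
    and "expdecay (\<lambda>t. \<theta>h t - \<theta>) \<or> (\<forall>t\<ge>T. d1 t = 0 \<and> d2 t = 0)"
proof -
  define b where "b = \<iota>\<^sup>2 + \<theta>"
  have b: "b > 0" using pos by (simp add: b_def add_nonneg_pos)
  \<comment> \<open>The periodic solution of s' = - \<iota> s - d1.\<close>
  define s where "s t = (d2 t - \<iota> * d1 t) / b" for t
  define sd where "sd t = (- \<theta> * d1 t - \<iota> * d2 t) / b" for t
  have bs: "b * s t = d2 t - \<iota> * d1 t" for t using b by (simp add: s_def)
  have ds: "(s has_real_derivative sd t) (at t)" if "t \<ge> T" for t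
    unfolding s_def[abs_def] sd_def using dd1[OF that] dd2[OF that] b
    by (auto intro!: derivative_eq_intros)
  have dsd: "(sd has_real_derivative - \<theta> * s t) (at t)" if "t \<ge> T" for t
    unfolding sd_def[abs_def] s_def using dd1[OF that] dd2[OF that] b
    by (auto intro!: derivative_eq_intros simp: field_simps)
  define c where "c = (sd T)\<^sup>2 + \<theta> * (s T)\<^sup>2"
  have en: "(sd t)\<^sup>2 + \<theta> * (s t)\<^sup>2 = c" if "t \<ge> T" for t
    unfolding c_def by (rule oscillator_energy[OF ds dsd that])
  have bds: "evbounded s" "evbounded sd"
    using oscillator_bounded[of T sd \<theta> s c] en pos(4) by blast+
  define \<rho> where "\<rho> t = y t - d1 t" for t
  have \<rho>: "expdecay \<rho>" unfolding \<rho>_def[abs_def] by (rule r)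
  define x where "x t = \<xi> t - s t" for t
  have sd: "sd t = - \<iota> * s t - d1 t" for t using b by (simp add: s_def sd_def b_def field_simps power2_eq_square)
  have dx: "(x has_real_derivative - \<iota> * x t + - \<rho> t) (at t)" if "t \<ge> T" for t
    unfolding x_def[abs_def] using dxi[OF that] ds[OF that]
    by (auto intro!: derivative_eq_intros simp: \<rho>_def sd algebra_simps)
  have x: "expdecay x" by (rule linear_ode_expdecay[OF dx pos(1)]) (use \<rho> in auto)
  have b\<xi>: "evbounded \<xi>"
    using evbounded_add[OF expdecay_imp_evbounded[OF x] bds(1)] by (simp add: x_def)
  \<comment> \<open>\<open>\<phi>\<close> and \<iota>^2 \<xi> solve the same equation, so they
    differ only by a decaying transient.\<close>
  define f where "f t = \<phi> t - \<iota>\<^sup>2 * \<xi> t" for t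
  have df: "(f has_real_derivative - \<iota> * f t + 0) (at t)" if "t \<ge> T" for t
    unfolding f_def[abs_def] using dphi[OF that] dxi[OF that]
    by (auto intro!: derivative_eq_intros simp: algebra_simps power2_eq_square)
  have f: "expdecay f" by (rule linear_ode_expdecay[OF df pos(1)]) auto
  define e where "e t = d1 t - \<chi>1 t" for t
  define q where "q t = \<theta> - \<theta>h t" for t
  define \<rho>1 where "\<rho>1 t = - b * x t - f t - (\<iota> + \<mu>0) * \<rho> t" for t
  define \<rho>2 where "\<rho>2 t = - \<mu>1 * (\<rho> t * \<xi> t)" for t
  have \<rho>1: "expdecay \<rho>1" unfolding \<rho>1_def[abs_def] by (intro expdecay_diff expdecay_cmult x f \<rho>)
  have \<rho>2: "expdecay \<rho>2" unfolding \<rho>2_def[abs_def] by (intro expdecay_cmult expdecay_mult_bounded \<rho> b\<xi>)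
  have de: "(e has_real_derivative - \<mu>0 * e t + \<xi> t * q t + \<rho>1 t) (at t)" if "t \<ge> T" for t
  proof -
    have "(e has_real_derivative d2 t - (\<phi> t + \<iota> * y t + \<theta>h t * \<xi> t + \<mu>0 * (y t - \<chi>1 t))) (at t)"
      unfolding e_def[abs_def] by (rule DERIV_diff[OF dd1[OF that] dchi[OF that]])
    moreover have "d2 t = b * s t + \<iota> * d1 t" by (simp add: bs)
    then have "d2 t - (\<phi> t + \<iota> * y t + \<theta>h t * \<xi> t + \<mu>0 * (y t - \<chi>1 t)) = - \<mu>0 * e t + \<xi> t * q t + \<rho>1 t"
      by (simp add: e_def q_def \<rho>1_def \<rho>_def f_def x_def b_def algebra_simps)
    ultimately show ?thesis by simp
  qed
  have dq: "(q has_real_derivative - \<mu>1 * \<xi> t * e t + \<rho>2 t) (at t)" if "t \<ge> T" for t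
    unfolding q_def[abs_def] using dth[OF that]
    by (auto intro!: derivative_eq_intros simp: e_def \<rho>2_def \<rho>_def algebra_simps)
  \<comment> \<open>The weight 1 / \<mu>1 cancels the indefinite terms in \<xi> e q. The
    perturbations that remain are linear in e and q, hence at most a decaying multiple of 1 +
    V.\<close>
  define V where "V t = (e t)\<^sup>2 + (q t)\<^sup>2 / \<mu>1" for t
  have bV: "evbounded V"
  proof (rule gronwall_evbounded[of T V _ "\<lambda>t. \<bar>\<rho>1 t\<bar> + (1 + 1 / \<mu>1) * \<bar>\<rho>2 t\<bar>"])
    fix t assume t: "t \<ge> T"
    show "(V has_real_derivative 2 * e t * (- \<mu>0 * e t + \<xi> t * q t + \<rho>1 t) + 2 * q t * (- \<mu>1 * \<xi> t * e t + \<rho>2 t) / \<mu>1) (at t)"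
      unfolding V_def[abs_def] using de[OF t] dq[OF t] pos(3)
      by (auto intro!: derivative_eq_intros simp: field_simps)
    have sqb: "2 * u * v \<le> \<bar>v\<bar> * (1 + u\<^sup>2)" for u v :: real
    proof -
      have "0 \<le> \<bar>v\<bar> * (\<bar>u\<bar> - 1)\<^sup>2" by simp
      also have "\<dots> = \<bar>v\<bar> * (1 + u\<^sup>2) - 2 * \<bar>u * v\<bar>"
        by (simp add: power2_diff abs_mult algebra_simps)
      finally show ?thesis using abs_ge_self[of "u * v"] by linarith
    qed
    have "2 * e t * (- \<mu>0 * e t + \<xi> t * q t + \<rho>1 t) + 2 * q t * (- \<mu>1 * \<xi> t * e t + \<rho>2 t) / \<mu>1
        = - 2 * \<mu>0 * (e t)\<^sup>2 + 2 * e t * \<rho>1 t + 2 * q t * \<rho>2 t / \<mu>1"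
      using pos by (simp add: field_simps power2_eq_square)
    also have "\<dots> \<le> \<bar>\<rho>1 t\<bar> * (1 + (e t)\<^sup>2) + \<bar>\<rho>2 t\<bar> * (1 + (q t)\<^sup>2) / \<mu>1"
    proof -
      have "2 * q t * \<rho>2 t / \<mu>1 \<le> \<bar>\<rho>2 t\<bar> * (1 + (q t)\<^sup>2) / \<mu>1"
        using sqb pos by (intro divide_right_mono) auto
      moreover have "0 \<le> 2 * \<mu>0 * (e t)\<^sup>2" using pos by simp
      ultimately show ?thesis using sqb[of "e t" "\<rho>1 t"] by linarith
    qed
    also have "\<dots> \<le> \<bar>\<rho>1 t\<bar> * (1 + V t) + \<bar>\<rho>2 t\<bar> * ((1 + 1 / \<mu>1) * (1 + V t))"
    proof (rule add_mono)
      show "\<bar>\<rho>1 t\<bar> * (1 + (e t)\<^sup>2) \<le> \<bar>\<rho>1 t\<bar> * (1 + V t)"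
        using pos by (intro mult_left_mono) (auto simp: V_def)
      have "(1 + (q t)\<^sup>2) / \<mu>1 \<le> 1 / \<mu>1 + V t" by (simp add: V_def add_divide_distrib)
      also have "\<dots> \<le> (1 + 1 / \<mu>1) * (1 + V t)"
      proof -
        have "0 \<le> 1 / \<mu>1 * V t" using pos by (simp add: V_def)
        then show ?thesis by (simp add: distrib_left distrib_right)
      qed
      finally have "\<bar>\<rho>2 t\<bar> * ((1 + (q t)\<^sup>2) / \<mu>1) \<le> \<bar>\<rho>2 t\<bar> * ((1 + 1 / \<mu>1) * (1 + V t))"
        by (intro mult_left_mono) auto
      then show "\<bar>\<rho>2 t\<bar> * (1 + (q t)\<^sup>2) / \<mu>1 \<le> \<bar>\<rho>2 t\<bar> * ((1 + 1 / \<mu>1) * (1 + V t))" by simp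
    qed
    finally show "2 * e t * (- \<mu>0 * e t + \<xi> t * q t + \<rho>1 t) + 2 * q t * (- \<mu>1 * \<xi> t * e t + \<rho>2 t) / \<mu>1
        \<le> (\<bar>\<rho>1 t\<bar> + (1 + 1 / \<mu>1) * \<bar>\<rho>2 t\<bar>) * (1 + V t)"
      by (simp only: algebra_simps)
  next
    have "expdecay (\<lambda>t. \<bar>\<rho>1 t\<bar>)" "expdecay (\<lambda>t. \<bar>\<rho>2 t\<bar>)"
      by (rule expdecay_mono[OF \<rho>1, of 0 _ 1] expdecay_mono[OF \<rho>2, of 0 _ 1]; simp)+
    then show "expdecay (\<lambda>t. \<bar>\<rho>1 t\<bar> + (1 + 1 / \<mu>1) * \<bar>\<rho>2 t\<bar>)"
      by (intro expdecay_add expdecay_cmult)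
  qed (use pos in \<open>auto simp: V_def\<close>)
  have be: "evbounded e" by (rule evbounded_of_square[OF bV, of 0 _ 1]) (use pos in \<open>auto simp: V_def\<close>)
  have bq: "evbounded q" by (rule evbounded_of_square[OF bV, of 0 _ \<mu>1]) (use pos in \<open>auto simp: V_def field_simps\<close>)
  show "evbounded \<theta>h" using evbounded_diff[OF evbounded_const[of \<theta>] bq] by (simp add: q_def)
  define \<rho>1' where "\<rho>1' t = x t * q t + \<rho>1 t" for t
  define \<rho>2' where "\<rho>2' t = - \<mu>1 * (x t * e t) + \<rho>2 t" for t
  have \<rho>1': "expdecay \<rho>1'" unfolding \<rho>1'_def[abs_def] by (intro expdecay_add expdecay_mult_bounded x bq \<rho>1)
  have \<rho>2': "expdecay \<rho>2'" unfolding \<rho>2'_def[abs_def] by (intro expdecay_add expdecay_cmult expdecay_mult_bounded x be \<rho>2)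
  have de': "(e has_real_derivative - \<mu>0 * e t + s t * q t + \<rho>1' t) (at t)" if "t \<ge> T" for t
    using de[OF that] by (simp add: \<rho>1'_def x_def algebra_simps)
  have dq': "(q has_real_derivative - \<mu>1 * s t * e t + \<rho>2' t) (at t)" if "t \<ge> T" for t
    using dq[OF that] by (simp add: \<rho>2'_def x_def algebra_simps)
  \<comment> \<open>The energy c of the regressor decides. If c = 0, then s, d1 and d2 vanish from
    \<open>T\<close> on and \<open>\<xi>\<close> itself decays, and with it \<xi> q, as q is
    bounded. Otherwise excitation makes q decay. The product \<xi> q is recorded because it is the
    form in which q enters the estimate of d2.\<close>
  have "expdecay e \<and> (expdecay q \<or> (\<forall>t\<ge>T. d1 t = 0 \<and> d2 t = 0)) \<and> expdecay (\<lambda>t. \<xi> t * q t)"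
  proof (cases "c = 0")
    case True
    have s0: "s t = 0" "sd t = 0" if "t \<ge> T" for t
    proof -
      have "0 \<le> \<theta> * (s t)\<^sup>2" using pos by simp
      then have "\<theta> * (s t)\<^sup>2 = 0" "(sd t)\<^sup>2 = 0"
        using en[OF that] True zero_le_power2[of "sd t"] by linarith+
      then show "s t = 0" "sd t = 0" using pos by auto
    qed
    have e: "expdecay e"
      by (rule linear_ode_expdecay[OF _ pos(2) \<rho>1', of T]) (use de' s0 in fastforce)
    have "d1 t = 0 \<and> d2 t = 0" if "t \<ge> T" for t
    proof -
      have 1: "d2 t = \<iota> * d1 t" "\<theta> * d1 t + \<iota> * d2 t = 0"
        using s0[OF that] b by (auto simp: s_def sd_def)
      then have "b * d1 t = 0" by (simp add: b_def algebra_simps power2_eq_square)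
      then show ?thesis using b 1 by simp
    qed
    moreover have "expdecay (\<lambda>t. \<xi> t * q t)"
      by (rule expdecay_cong[OF expdecay_mult_bounded[OF x bq], of T]) (simp add: x_def s0)
    ultimately show ?thesis using e by blast
  next
    case False
    have "0 \<le> \<theta> * (s T)\<^sup>2" using pos by simp
    then have "c \<ge> 0" unfolding c_def by simp
    then have "c > 0" using False by simp
    have pe: "expdecay e" "expdecay q"
      by (rule persistent_excitation_expdecay[OF pos(2-4) \<open>c > 0\<close> ds dsd en de' dq' \<rho>1' \<rho>2' be bq]; assumption)+
    show ?thesis using pe expdecay_mult_bounded[OF pe(2) b\<xi>] by (simp add: mult.commute)
  qed
  then have e: "expdecay e" and q: "expdecay q \<or> (\<forall>t\<ge>T. d1 t = 0 \<and> d2 t = 0)" and \<xi>q: "expdecay (\<lambda>t. \<xi> t * q t)"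
    by blast+
  show "expdecay (\<lambda>t. \<chi>1 t - d1 t)" using expdecay_minus[OF e] by (simp add: e_def)
  have "\<phi> t + \<xi> t * \<theta>h t + \<iota> * \<chi>1 t - d2 t = f t + b * x t - \<xi> t * q t - \<iota> * e t" for t
    using bs[of t] by (simp add: f_def x_def q_def e_def b_def algebra_simps)
  then show "expdecay (\<lambda>t. \<phi> t + \<xi> t * \<theta>h t + \<iota> * \<chi>1 t - d2 t)"
    by (simp only:) (intro expdecay_diff expdecay_add expdecay_cmult f x \<xi>q e)
  show "expdecay (\<lambda>t. \<theta>h t - \<theta>) \<or> (\<forall>t\<ge>T. d1 t = 0 \<and> d2 t = 0)"
    using q expdecay_minus[of q] by (auto simp: q_def)
qed

section \<open>Locally Lipschitz functions and the matrix exponential\<close>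

text \<open>Lipschitz continuity on bounded sets is the form that suits the parameter estimate, of
  which a priori only eventual boundedness is known.\<close>

definition loclip :: "(real \<Rightarrow> 'a::real_normed_vector) \<Rightarrow> bool" where
  "loclip g \<longleftrightarrow> (\<forall>B. \<exists>L. \<forall>x y. \<bar>x\<bar> \<le> B \<longrightarrow> \<bar>y\<bar> \<le> B \<longrightarrow> norm (g x - g y) \<le> L * \<bar>x - y\<bar>)"

lemma loclipE:
  assumes "loclip g"
  obtains L where "L \<ge> 0" "\<And>x y. \<bar>x\<bar> \<le> B \<Longrightarrow> \<bar>y\<bar> \<le> B \<Longrightarrow> norm (g x - g y) \<le> L * \<bar>x - y\<bar>"
proof -
  obtain L where L: "\<And>x y. \<bar>x\<bar> \<le> B \<Longrightarrow> \<bar>y\<bar> \<le> B \<Longrightarrow> norm (g x - g y) \<le> L * \<bar>x - y\<bar>"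
    using assms unfolding loclip_def by blast
  show thesis
  proof (rule that[of "\<bar>L\<bar>"])
    fix x y assume "\<bar>x\<bar> \<le> B" "\<bar>y\<bar> \<le> B"
    then have "norm (g x - g y) \<le> L * \<bar>x - y\<bar>" by (rule L)
    also have "\<dots> \<le> \<bar>L\<bar> * \<bar>x - y\<bar>" by (intro mult_right_mono) auto
    finally show "norm (g x - g y) \<le> \<bar>L\<bar> * \<bar>x - y\<bar>" .
  qed auto
qed

lemma loclipI:
  assumes "\<And>B. B \<ge> 0 \<Longrightarrow> \<exists>L. \<forall>x y. \<bar>x\<bar> \<le> B \<longrightarrow> \<bar>y\<bar> \<le> B \<longrightarrow> norm (g x - g y) \<le> L * \<bar>x - y\<bar>"
  shows "loclip g"
  unfolding loclip_def
proof
  fix B :: real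
  show "\<exists>L. \<forall>x y. \<bar>x\<bar> \<le> B \<longrightarrow> \<bar>y\<bar> \<le> B \<longrightarrow> norm (g x - g y) \<le> L * \<bar>x - y\<bar>"
    by (cases "B \<ge> 0") (use assms in force)+
qed

lemma loclip_bounded:
  assumes "loclip g"
  obtains C where "C \<ge> 0" "\<And>x. \<bar>x\<bar> \<le> B \<Longrightarrow> norm (g x) \<le> C"
proof -
  obtain L where L: "L \<ge> 0" "\<And>x y. \<bar>x\<bar> \<le> \<bar>B\<bar> \<Longrightarrow> \<bar>y\<bar> \<le> \<bar>B\<bar> \<Longrightarrow> norm (g x - g y) \<le> L * \<bar>x - y\<bar>"
    by (rule loclipE[OF assms, of "\<bar>B\<bar>"]) blast
  show thesis
  proof (rule that[of "norm (g 0) + L * \<bar>B\<bar>"])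
    fix x assume x: "\<bar>x\<bar> \<le> B"
    have "norm (g x) \<le> norm (g 0) + norm (g x - g 0)" by (metis add.commute diff_add_cancel norm_triangle_ineq)
    also have "norm (g x - g 0) \<le> L * \<bar>x - 0\<bar>" using x by (intro L) auto
    also have "\<dots> \<le> L * \<bar>B\<bar>" using x L by (intro mult_left_mono) auto
    finally show "norm (g x) \<le> norm (g 0) + L * \<bar>B\<bar>" by simp
  qed (use L in auto)
qed

lemma loclip_continuous:
  assumes "loclip g"
  shows "continuous_on UNIV g"
  unfolding continuous_on_eq_continuous_at[OF open_UNIV]
proof
  fix x :: real
  obtain L where L: "L \<ge> 0" "\<And>u v. \<bar>u\<bar> \<le> \<bar>x\<bar> + 1 \<Longrightarrow> \<bar>v\<bar> \<le> \<bar>x\<bar> + 1 \<Longrightarrow> norm (g u - g v) \<le> L * \<bar>u - v\<bar>"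
    by (rule loclipE[OF assms, of "\<bar>x\<bar> + 1"]) blast
  have "((\<lambda>u. L * \<bar>u - x\<bar>) \<longlongrightarrow> L * \<bar>x - x\<bar>) (at x)" by (intro tendsto_intros)
  then have 0: "((\<lambda>u. L * \<bar>u - x\<bar>) \<longlongrightarrow> 0) (at x)" by simp
  have "\<forall>\<^sub>F u in at x. norm (g u - g x) \<le> L * \<bar>u - x\<bar>"
    unfolding eventually_at by (rule exI[of _ 1]) (auto simp: dist_real_def intro!: L)
  then have "((\<lambda>u. g u - g x) \<longlongrightarrow> 0) (at x)"
    by (rule Lim_null_comparison) (rule 0)
  then show "isCont g x" unfolding isCont_def by (simp add: LIM_zero_iff)
qed

lemma loclip_const: "loclip (\<lambda>x. c)"
  by (rule loclipI, rule exI[of _ 0]) simp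

lemma loclip_ident: "loclip (\<lambda>x. x)"
  by (rule loclipI, rule exI[of _ 1]) simp

lemma loclip_bounded_bilinear:
  assumes "bounded_bilinear prd" "loclip f" "loclip g"
  shows "loclip (\<lambda>x. prd (f x) (g x))"
proof (rule loclipI)
  interpret bounded_bilinear prd by (rule assms)
  fix B :: real
  obtain K where K: "K > 0" "\<And>a b. norm (prd a b) \<le> norm a * norm b * K" using pos_bounded by blast
  obtain L1 where L1: "L1 \<ge> 0" "\<And>x y. \<bar>x\<bar> \<le> B \<Longrightarrow> \<bar>y\<bar> \<le> B \<Longrightarrow> norm (f x - f y) \<le> L1 * \<bar>x - y\<bar>"
    by (rule loclipE[OF assms(2), of B]) blast
  obtain L2 where L2: "L2 \<ge> 0" "\<And>x y. \<bar>x\<bar> \<le> B \<Longrightarrow> \<bar>y\<bar> \<le> B \<Longrightarrow> norm (g x - g y) \<le> L2 * \<bar>x - y\<bar>"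
    by (rule loclipE[OF assms(3), of B]) blast
  obtain C1 where C1: "C1 \<ge> 0" "\<And>x. \<bar>x\<bar> \<le> B \<Longrightarrow> norm (f x) \<le> C1"
    by (rule loclip_bounded[OF assms(2), of B]) blast
  obtain C2 where C2: "C2 \<ge> 0" "\<And>x. \<bar>x\<bar> \<le> B \<Longrightarrow> norm (g x) \<le> C2"
    by (rule loclip_bounded[OF assms(3), of B]) blast
  have "norm (prd (f x) (g x) - prd (f y) (g y)) \<le> (L1 * C2 * K + C1 * L2 * K) * \<bar>x - y\<bar>"
    if xy: "\<bar>x\<bar> \<le> B" "\<bar>y\<bar> \<le> B" for x y
  proof -
    have "prd (f x) (g x) - prd (f y) (g y) = prd (f x - f y) (g x) + prd (f y) (g x - g y)"
      by (simp add: diff_left diff_right)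
    then have "norm (prd (f x) (g x) - prd (f y) (g y)) \<le> norm (prd (f x - f y) (g x)) + norm (prd (f y) (g x - g y))"
      by (simp only: norm_triangle_ineq)
    also have "\<dots> \<le> norm (f x - f y) * norm (g x) * K + norm (f y) * norm (g x - g y) * K"
      by (intro add_mono K)
    also have "\<dots> \<le> (L1 * \<bar>x - y\<bar>) * C2 * K + C1 * (L2 * \<bar>x - y\<bar>) * K"
      using xy K L1 L2 C1 C2 by (intro add_mono mult_mono) auto
    finally show ?thesis by (simp add: algebra_simps)
  qed
  then show "\<exists>L. \<forall>x y. \<bar>x\<bar> \<le> B \<longrightarrow> \<bar>y\<bar> \<le> B \<longrightarrow> norm (prd (f x) (g x) - prd (f y) (g y)) \<le> L * \<bar>x - y\<bar>" by blast
qed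

lemma loclip_bounded_linear:
  assumes "bounded_linear h" "loclip f"
  shows "loclip (\<lambda>x. h (f x))"
proof -
  have "bounded_bilinear (\<lambda>(r::real) v. r *\<^sub>R h v)"
    using bounded_bilinear.comp[OF bounded_bilinear_scaleR bounded_linear_ident assms(1)] by simp
  from loclip_bounded_bilinear[OF this loclip_const[of 1] assms(2)] show ?thesis by simp
qed

lemma loclip_add:
  assumes "loclip f" "loclip g"
  shows "loclip (\<lambda>x. f x + g x)"
proof (rule loclipI)
  fix B :: real
  obtain L1 where L1: "L1 \<ge> 0" "\<And>x y. \<bar>x\<bar> \<le> B \<Longrightarrow> \<bar>y\<bar> \<le> B \<Longrightarrow> norm (f x - f y) \<le> L1 * \<bar>x - y\<bar>"
    by (rule loclipE[OF assms(1), of B]) blast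
  obtain L2 where L2: "L2 \<ge> 0" "\<And>x y. \<bar>x\<bar> \<le> B \<Longrightarrow> \<bar>y\<bar> \<le> B \<Longrightarrow> norm (g x - g y) \<le> L2 * \<bar>x - y\<bar>"
    by (rule loclipE[OF assms(2), of B]) blast
  have "norm (f x + g x - (f y + g y)) \<le> (L1 + L2) * \<bar>x - y\<bar>" if "\<bar>x\<bar> \<le> B" "\<bar>y\<bar> \<le> B" for x y
    using L1(2)[OF that] L2(2)[OF that] norm_triangle_ineq[of "f x - f y" "g x - g y"]
    by (simp add: algebra_simps)
  then show "\<exists>L. \<forall>x y. \<bar>x\<bar> \<le> B \<longrightarrow> \<bar>y\<bar> \<le> B \<longrightarrow> norm (f x + g x - (f y + g y)) \<le> L * \<bar>x - y\<bar>" by blast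
qed

lemma loclip_diff: "loclip f \<Longrightarrow> loclip g \<Longrightarrow> loclip (\<lambda>x. f x - g x)"
  using loclip_add[of f "\<lambda>x. - g x"] loclip_bounded_linear[OF bounded_linear_minus[OF bounded_linear_ident], of g] by simp

lemma loclip_sum: "(\<And>i. i \<in> I \<Longrightarrow> loclip (f i)) \<Longrightarrow> loclip (\<lambda>x. \<Sum>i\<in>I. f i x)"
  by (induction I rule: infinite_finite_induct) (auto intro: loclip_const loclip_add)

section \<open>Entire series for the exponential of the companion matrix\<close>

lemma power_diff_le:
  fixes u v :: real
  assumes "\<bar>u\<bar> \<le> R" "\<bar>v\<bar> \<le> R" "R \<ge> 1"
  shows "\<bar>u ^ j - v ^ j\<bar> \<le> real j * R ^ j * \<bar>u - v\<bar>"
proof (induction j)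
  case (Suc j)
  have "\<bar>u ^ Suc j - v ^ Suc j\<bar> = \<bar>u * (u ^ j - v ^ j) + (u - v) * v ^ j\<bar>" by (simp add: algebra_simps)
  also have "\<dots> \<le> \<bar>u\<bar> * \<bar>u ^ j - v ^ j\<bar> + \<bar>u - v\<bar> * \<bar>v\<bar> ^ j"
    by (metis abs_mult abs_triangle_ineq power_abs)
  also have "\<dots> \<le> R * (real j * R ^ j * \<bar>u - v\<bar>) + \<bar>u - v\<bar> * R ^ Suc j"
  proof (intro add_mono mult_mono Suc.IH mult_left_mono)
    have "\<bar>v\<bar> ^ j \<le> R ^ j" using assms by (intro power_mono) auto
    also have "\<dots> \<le> R ^ Suc j" using assms by (intro power_increasing) auto
    finally show "\<bar>v\<bar> ^ j \<le> R ^ Suc j" .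
  qed (use assms in auto)
  also have "\<dots> = real (Suc j) * R ^ Suc j * \<bar>u - v\<bar>" by (simp add: algebra_simps)
  finally show ?case .
qed simp

text \<open>In the applications \<open>c\<close> selects the even or the odd indices, which gives
  the two halves of the exponential series with u in place of the squared variable. The exponents k
  div 2 are integers, so the sums are smooth across u = 0, where the square root is not.\<close>

lemma half_exp_series:
  fixes c :: "nat \<Rightarrow> real"
  assumes c: "\<And>k. \<bar>c k\<bar> \<le> 1"
  shows "summable (\<lambda>k. c k * u ^ (k div 2) / fact k)"
    and "loclip (\<lambda>u. \<Sum>k. c k * u ^ (k div 2) / fact k)"
proof -
  have s: "summable (\<lambda>k. c k * u ^ (k div 2) / fact k)" for u
  proof (rule summable_comparison_test'[OF summable_exp[of "\<bar>u\<bar> + 1"]])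
    fix k
    have "\<bar>u\<bar> ^ (k div 2) \<le> (\<bar>u\<bar> + 1) ^ (k div 2)" by (intro power_mono) auto
    also have "\<dots> \<le> (\<bar>u\<bar> + 1) ^ k" by (intro power_increasing) auto
    finally have "\<bar>c k\<bar> * \<bar>u\<bar> ^ (k div 2) \<le> 1 * (\<bar>u\<bar> + 1) ^ k" using c by (intro mult_mono) auto
    then show "norm (c k * u ^ (k div 2) / fact k) \<le> inverse (fact k) * (\<bar>u\<bar> + 1) ^ k"
      by (simp add: abs_mult power_abs divide_inverse mult.commute[of _ "inverse _"] mult_left_mono)
  qed
  then show "summable (\<lambda>k. c k * u ^ (k div 2) / fact k)" .
  show "loclip (\<lambda>u. \<Sum>k. c k * u ^ (k div 2) / fact k)"
  proof (rule loclipI)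
    fix B :: real assume "B \<ge> 0"
    \<comment> \<open>Enlarged to at least 1, so that R ^ (k div 2) is at most R ^ k.\<close>
    define R where "R = B + 1"
    have R: "R \<ge> 1" using \<open>B \<ge> 0\<close> by (simp add: R_def)
    have sm: "summable (\<lambda>k. real k * R ^ k / fact k)"
    proof (subst summable_Suc_iff[symmetric])
      have "summable (\<lambda>k. R * (inverse (fact k) * R ^ k))" by (intro summable_mult summable_exp)
      moreover have "real (Suc k) * R ^ Suc k / fact (Suc k) = R * (inverse (fact k) * R ^ k)" for k
        by (simp add: divide_simps del: of_nat_Suc)
      ultimately show "summable (\<lambda>k. real (Suc k) * R ^ Suc k / fact (Suc k))" by (simp only:)
    qed
    have "norm ((\<Sum>k. c k * u ^ (k div 2) / fact k) - (\<Sum>k. c k * v ^ (k div 2) / fact k))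
        \<le> (\<Sum>k. real k * R ^ k / fact k) * \<bar>u - v\<bar>" if uv: "\<bar>u\<bar> \<le> B" "\<bar>v\<bar> \<le> B" for u v
    proof -
      have le: "norm (c k * u ^ (k div 2) / fact k - c k * v ^ (k div 2) / fact k) \<le> real k * R ^ k / fact k * \<bar>u - v\<bar>" for k
      proof -
        have "\<bar>c k\<bar> * \<bar>u ^ (k div 2) - v ^ (k div 2)\<bar> \<le> 1 * (real (k div 2) * R ^ (k div 2) * \<bar>u - v\<bar>)"
          using c uv R by (intro mult_mono power_diff_le) (auto simp: R_def)
        also have "\<dots> \<le> real k * R ^ k * \<bar>u - v\<bar>"
          using R by (simp, intro mult_right_mono mult_mono power_increasing) auto
        finally have "\<bar>c k * (u ^ (k div 2) - v ^ (k div 2))\<bar> / fact k \<le> real k * R ^ k * \<bar>u - v\<bar> / fact k"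
          by (intro divide_right_mono) (auto simp: abs_mult)
        moreover have "c k * u ^ (k div 2) / fact k - c k * v ^ (k div 2) / fact k = c k * (u ^ (k div 2) - v ^ (k div 2)) / fact k"
          by (simp add: field_simps)
        ultimately show ?thesis by simp
      qed
      have "(\<Sum>k. c k * u ^ (k div 2) / fact k) - (\<Sum>k. c k * v ^ (k div 2) / fact k)
          = (\<Sum>k. c k * u ^ (k div 2) / fact k - c k * v ^ (k div 2) / fact k)"
        by (rule suminf_diff[OF s s])
      also have "norm \<dots> \<le> (\<Sum>k. real k * R ^ k / fact k * \<bar>u - v\<bar>)"
        by (rule norm_suminf_le[OF le summable_mult2[OF sm]])
      also have "\<dots> = (\<Sum>k. real k * R ^ k / fact k) * \<bar>u - v\<bar>" by (rule suminf_mult2[OF sm, symmetric])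
      finally show ?thesis .
    qed
    then show "\<exists>L. \<forall>u v. \<bar>u\<bar> \<le> B \<longrightarrow> \<bar>v\<bar> \<le> B \<longrightarrow>
        norm ((\<Sum>k. c k * u ^ (k div 2) / fact k) - (\<Sum>k. c k * v ^ (k div 2) / fact k)) \<le> L * \<bar>u - v\<bar>" by blast
  qed
qed

text \<open>The entire functions \<open>cosh (sqrt u)\<close> and \<open>sinh (sqrt u) / sqrt u\<close>: since the estimate of \<open>\<theta>\<close> may
  have either sign, the exponential of \<open>\<tau> S\<^sub>c(\<theta>)\<close> is written with them rather than with \<open>cos\<close> and \<open>sin\<close>.\<close>
definition cosh_sqrt :: "real \<Rightarrow> real" where
  "cosh_sqrt u = (\<Sum>k. (if even k then 1 else 0) * u ^ (k div 2) / fact k)"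

definition sinhc_sqrt :: "real \<Rightarrow> real" where
  "sinhc_sqrt u = (\<Sum>k. (if even k then 0 else 1) * u ^ (k div 2) / fact k)"

lemma loclip_cosh_sqrt: "loclip cosh_sqrt"
  unfolding cosh_sqrt_def[abs_def] by (rule half_exp_series(2)) auto

lemma loclip_sinhc_sqrt: "loclip sinhc_sqrt"
  unfolding sinhc_sqrt_def[abs_def] by (rule half_exp_series(2)) auto

lemma cosh_sqrt_neg: "cosh_sqrt (- x\<^sup>2) = cos x"
proof -
  have "cos_coeff k *\<^sub>R x ^ k = (if even k then 1 else 0) * (- x\<^sup>2) ^ (k div 2) / fact k" for k
  proof (cases "even k")
    case True
    then obtain j where "k = 2 * j" by blast
    then show ?thesis by (simp add: cos_coeff_def power_mult power_mult_distrib[symmetric])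
  qed (simp add: cos_coeff_def)
  then show ?thesis using cos_converges[of x] by (simp add: cosh_sqrt_def sums_iff)
qed

lemma sinhc_sqrt_neg: "x * sinhc_sqrt (- x\<^sup>2) = sin x"
proof -
  have "sin_coeff k *\<^sub>R x ^ k = x * ((if even k then 0 else 1) * (- x\<^sup>2) ^ (k div 2) / fact k)" for k
  proof (cases "even k")
    case False
    then obtain j where "k = 2 * j + 1" by (rule oddE)
    then show ?thesis by (simp add: sin_coeff_def power_mult power_mult_distrib[symmetric])
  qed (simp add: sin_coeff_def)
  then have "sin x = (\<Sum>k. x * ((if even k then 0 else 1) * (- x\<^sup>2) ^ (k div 2) / fact k))"
    using sin_converges[of x] by (simp add: sums_iff)
  also have "\<dots> = x * sinhc_sqrt (- x\<^sup>2)"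
    unfolding sinhc_sqrt_def by (rule suminf_mult) (rule half_exp_series(1), auto)
  finally show ?thesis by simp
qed

lemma Sc_mult_vec: "(Sc th *v d) $ 1 = d $ 2" "(Sc th *v d) $ 2 = - th * d $ 1"
  by (simp_all add: Sc_def matrix_vector_mult_def sum_2)

lemma vec_mult_Sc: "(x v* Sc th) $ 1 = - th * x $ 2" "(x v* Sc th) $ 2 = x $ 1"
  by (simp_all add: Sc_def vector_matrix_mult_def sum_2)

text \<open>\<open>Sc th\<close> squares to - th times the identity, so its powers alternate between
  multiples of the identity and of \<open>Sc th\<close>.\<close>

lemma mpow_Sc:
  "mpow (\<tau> *\<^sub>R Sc th) k = (if even k then (- (th * \<tau>\<^sup>2)) ^ (k div 2) *\<^sub>R mat 1
     else ((- (th * \<tau>\<^sup>2)) ^ (k div 2) * \<tau>) *\<^sub>R Sc th)"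
proof (induction k)
  case (Suc k)
  have "Sc th ** Sc th = - th *\<^sub>R mat 1"
    by (simp add: vec_eq_iff forall_2 Sc_def matrix_matrix_mult_def sum_2 mat_def)
  then show ?case
  proof (cases "even k")
    case True
    then obtain j where "k = 2 * j" by blast
    then show ?thesis using Suc by (simp add: scalar_matrix_assoc[symmetric] matrix_scalar_ac mult.commute)
  next
    case False
    then obtain j where "k = 2 * j + 1" by (rule oddE)
    then show ?thesis using Suc \<open>Sc th ** Sc th = _\<close>
      by (simp add: scalar_matrix_assoc[symmetric] matrix_scalar_ac power2_eq_square mult_ac)
  qed
qed simp

lemma mexp_Sc:
  "mexp (\<tau> *\<^sub>R Sc th) = cosh_sqrt (- (th * \<tau>\<^sup>2)) *\<^sub>R mat 1 + (\<tau> * sinhc_sqrt (- (th * \<tau>\<^sup>2))) *\<^sub>R Sc th"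
proof -
  let ?u = "- (th * \<tau>\<^sup>2)"
  let ?a = "\<lambda>k. (if even k then 1 else 0) * ?u ^ (k div 2) / fact k"
  let ?b = "\<lambda>k. (if even k then 0 else 1) * ?u ^ (k div 2) / fact k"
  have sa: "?a sums cosh_sqrt ?u" unfolding cosh_sqrt_def by (rule summable_sums, rule half_exp_series(1)) auto
  have sb: "?b sums sinhc_sqrt ?u" unfolding sinhc_sqrt_def by (rule summable_sums, rule half_exp_series(1)) auto
  have "(\<lambda>k. ?a k *\<^sub>R mat 1 + (\<tau> * ?b k) *\<^sub>R Sc th) sums
      (cosh_sqrt ?u *\<^sub>R mat 1 + (\<tau> * sinhc_sqrt ?u) *\<^sub>R Sc th)"
    by (intro sums_add sums_scaleR_left sums_mult sa sb)
  moreover have "?a k *\<^sub>R mat 1 + (\<tau> * ?b k) *\<^sub>R Sc th = (1 / fact k) *\<^sub>R mpow (\<tau> *\<^sub>R Sc th) k" for k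
    by (simp add: mpow_Sc)
  ultimately show ?thesis unfolding mexp_def by (simp add: sums_iff)
qed

lemma mexp_Sc_oscillator:
  assumes "\<omega> > 0"
  shows "(mexp (\<tau> *\<^sub>R Sc (\<omega>\<^sup>2)) *v d) $ 1 = cos (\<omega> * \<tau>) * d $ 1 + sin (\<omega> * \<tau>) / \<omega> * d $ 2"
    and "(mexp (\<tau> *\<^sub>R Sc (\<omega>\<^sup>2)) *v d) $ 2 = cos (\<omega> * \<tau>) * d $ 2 - \<omega> * sin (\<omega> * \<tau>) * d $ 1"
proof -
  have c: "cosh_sqrt (- (\<omega>\<^sup>2 * \<tau>\<^sup>2)) = cos (\<omega> * \<tau>)"
    using cosh_sqrt_neg[of "\<omega> * \<tau>"] by (simp add: power_mult_distrib)
  have "\<omega> * (\<tau> * sinhc_sqrt (- (\<omega>\<^sup>2 * \<tau>\<^sup>2))) = sin (\<omega> * \<tau>)"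
    using sinhc_sqrt_neg[of "\<omega> * \<tau>"] by (simp add: power_mult_distrib mult.assoc)
  then have s: "\<tau> * sinhc_sqrt (- (\<omega>\<^sup>2 * \<tau>\<^sup>2)) = sin (\<omega> * \<tau>) / \<omega>" using assms by (simp add: field_simps)
  have "mexp (\<tau> *\<^sub>R Sc (\<omega>\<^sup>2)) *v d = cos (\<omega> * \<tau>) *\<^sub>R d + (sin (\<omega> * \<tau>) / \<omega>) *\<^sub>R (Sc (\<omega>\<^sup>2) *v d)"
    unfolding mexp_Sc c s
    by (simp add: matrix_vector_mult_add_rdistrib scaleR_matrix_vector_assoc[symmetric])
  then show "(mexp (\<tau> *\<^sub>R Sc (\<omega>\<^sup>2)) *v d) $ 1 = cos (\<omega> * \<tau>) * d $ 1 + sin (\<omega> * \<tau>) / \<omega> * d $ 2"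
    "(mexp (\<tau> *\<^sub>R Sc (\<omega>\<^sup>2)) *v d) $ 2 = cos (\<omega> * \<tau>) * d $ 2 - \<omega> * sin (\<omega> * \<tau>) * d $ 1"
    using assms by (simp_all add: Sc_mult_vec power2_eq_square)
qed

text \<open>The difference between the solution and the explicit rotation solves the same oscillator
  with zero data at time t, so its energy is zero. This is the prediction over the delay on which
  the last term of the control rests.\<close>

lemma oscillator_flow:
  fixes u v :: "real \<Rightarrow> real"
  assumes du: "\<And>t. t \<ge> T \<Longrightarrow> (u has_real_derivative v t) (at t)"
    and dv: "\<And>t. t \<ge> T \<Longrightarrow> (v has_real_derivative - \<omega>\<^sup>2 * u t) (at t)"
    and "t \<ge> T" "\<tau> \<ge> 0" "\<omega> > 0"
  shows "vector [u (t + \<tau>), v (t + \<tau>)] = mexp (\<tau> *\<^sub>R Sc (\<omega>\<^sup>2)) *v vector [u t, v t]"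
proof -
  define x where "x s = u s - (cos (\<omega> * (s - t)) * u t + sin (\<omega> * (s - t)) / \<omega> * v t)" for s
  define y where "y s = v s - (cos (\<omega> * (s - t)) * v t - \<omega> * sin (\<omega> * (s - t)) * u t)" for s
  have dx: "(x has_real_derivative y s) (at s)" if "s \<ge> t" for s
    unfolding x_def[abs_def] y_def using du[OF order_trans[OF \<open>t \<ge> T\<close> that]] \<open>\<omega> > 0\<close>
    by (auto intro!: derivative_eq_intros simp: field_simps)
  have dy: "(y has_real_derivative - \<omega>\<^sup>2 * x s) (at s)" if "s \<ge> t" for s
    unfolding y_def[abs_def] x_def using dv[OF order_trans[OF \<open>t \<ge> T\<close> that]] \<open>\<omega> > 0\<close>
    by (auto intro!: derivative_eq_intros simp: field_simps power2_eq_square)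
  have "(y (t + \<tau>))\<^sup>2 + \<omega>\<^sup>2 * (x (t + \<tau>))\<^sup>2 = (y t)\<^sup>2 + \<omega>\<^sup>2 * (x t)\<^sup>2"
    by (rule oscillator_energy[OF dx dy]) (use assms in auto)
  also have "\<dots> = 0" by (simp add: x_def y_def)
  finally have "(y (t + \<tau>))\<^sup>2 + (\<omega> * x (t + \<tau>))\<^sup>2 = 0" by (simp add: power_mult_distrib)
  then have "y (t + \<tau>) = 0" "x (t + \<tau>) = 0" using assms by (simp_all add: sum_power2_eq_zero_iff)
  then show ?thesis using mexp_Sc_oscillator[OF \<open>\<omega> > 0\<close>, of \<tau> "vector [u t, v t]"]
    by (simp add: vec_eq_iff forall_2 x_def y_def)
qed

text \<open>The determinant of G - i \<omega> vanishes; its imaginary part gives trace 0 and its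
  real part determinant \<omega>^2, and the conclusion is the Cayley-Hamilton theorem. Consequently
  every linear functional of \<open>p\<close> is a sinusoid of frequency \<omega>.\<close>

lemma cspectrum_imaginary_square:
  assumes "\<omega> > 0" "cspectrum G = {\<i> * complex_of_real \<omega>, - \<i> * complex_of_real \<omega>}"
  shows "G *v (G *v u) = - (\<omega>\<^sup>2) *\<^sub>R u"
proof -
  have "\<i> * complex_of_real \<omega> \<in> cspectrum G" using assms(2) by simp
  then obtain v :: "complex^2" where v: "v \<noteq> 0"
    "(\<chi> i j. complex_of_real (G $ i $ j)) *v v = (\<i> * complex_of_real \<omega>) *s v"
    unfolding cspectrum_def by blast
  let ?g = "\<lambda>i j. complex_of_real (G $ i $ j)"
  let ?l = "\<i> * complex_of_real \<omega>"
  have 1: "?g 1 1 * v $ 1 + ?g 1 2 * v $ 2 = ?l * v $ 1" "?g 2 1 * v $ 1 + ?g 2 2 * v $ 2 = ?l * v $ 2"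
    using v(2) by (simp_all add: vec_eq_iff forall_2 matrix_vector_mult_def sum_2)
  define D where "D = (?g 1 1 - ?l) * (?g 2 2 - ?l) - ?g 1 2 * ?g 2 1"
  have "D * v $ 1 = 0" "D * v $ 2 = 0" unfolding D_def using 1 by algebra+
  moreover have "v $ 1 \<noteq> 0 \<or> v $ 2 \<noteq> 0" using v(1) by (simp add: vec_eq_iff forall_2)
  ultimately have D: "D = 0" by auto
  have "Im D = - \<omega> * (G $ 1 $ 1 + G $ 2 $ 2)" by (simp add: D_def algebra_simps)
  then have tr: "G $ 2 $ 2 = - G $ 1 $ 1" using D assms(1) by simp
  have "Re D = G $ 1 $ 1 * G $ 2 $ 2 - \<omega> * \<omega> - G $ 1 $ 2 * G $ 2 $ 1" by (simp add: D_def algebra_simps)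
  then have det: "G $ 1 $ 1 * G $ 2 $ 2 - G $ 1 $ 2 * G $ 2 $ 1 = \<omega>\<^sup>2" using D by (simp add: power2_eq_square)
  have "G $ 1 $ 1 * (G $ 1 $ 1 * u $ 1 + G $ 1 $ 2 * u $ 2) + G $ 1 $ 2 * (G $ 2 $ 1 * u $ 1 + G $ 2 $ 2 * u $ 2) = - (\<omega>\<^sup>2 * u $ 1)"
    "G $ 2 $ 1 * (G $ 1 $ 1 * u $ 1 + G $ 1 $ 2 * u $ 2) + G $ 2 $ 2 * (G $ 2 $ 1 * u $ 1 + G $ 2 $ 2 * u $ 2) = - (\<omega>\<^sup>2 * u $ 2)"
    using tr det by algebra+
  then show ?thesis by (simp add: vec_eq_iff forall_2 matrix_vector_mult_def sum_2)
qed

section \<open>The regulator profile\<close>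

lemma has_vector_derivative_imp_continuous_on:
  "(\<And>x. x \<in> S \<Longrightarrow> (f has_vector_derivative f' x) (at x within S)) \<Longrightarrow> continuous_on S f"
  by (auto simp: continuous_on_eq_continuous_within intro: has_vector_derivative_continuous)


text \<open>The profile is given only through its equation, so its size and its dependence on the
  parameter must come from a Gronwall estimate, applied to the profile itself and to the difference
  of two profiles. Adding D^2 to the energy makes the inequality homogeneous; in A + 2 one unit pays
  for the product of F and F', the other for the product of F' with the forcing
  \<open>D\<close>.\<close>

lemma second_order_energy:
  fixes F F' F'' :: "real \<Rightarrow> 'a::real_inner"
  assumes dF: "\<And>x. x \<in> {0..1} \<Longrightarrow> (F has_vector_derivative F' x) (at x within {0..1})"
    and dF': "\<And>x. x \<in> {0..1} \<Longrightarrow> (F' has_vector_derivative F'' x) (at x within {0..1})"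
    and le: "\<And>x. x \<in> {0..1} \<Longrightarrow> norm (F'' x) \<le> A * norm (F x) + D"
    and "A \<ge> 0" "D \<ge> 0" and x: "x \<in> {0..1}"
  shows "(norm (F x))\<^sup>2 + (norm (F' x))\<^sup>2 \<le> ((norm (F 0))\<^sup>2 + (norm (F' 0))\<^sup>2 + D\<^sup>2) * exp (A + 2)"
proof -
  define V where "V x = F x \<bullet> F x + F' x \<bullet> F' x" for x
  define E where "E x = exp (- (A + 2) * x) * (V x + D\<^sup>2)" for x
  have V0: "V x \<ge> 0" for x by (simp add: V_def)
  have "E x \<le> E 0"
  proof (rule DERIV_nonpos_imp_decreasing_open[of 0 x E])
    show "0 \<le> x" using x by simp
    have c: "continuous_on {0..1} F" "continuous_on {0..1} F'"
      by (rule has_vector_derivative_imp_continuous_on[OF dF] has_vector_derivative_imp_continuous_on[OF dF']; assumption)+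
    have "continuous_on {0..1} E" unfolding E_def V_def by (intro continuous_intros c)
    then show "continuous_on {0..x} E" by (rule continuous_on_subset) (use x in auto)
    fix y assume y: "0 < y" "y < x"
    then have y01: "y \<in> {0..1}" using x by simp
    have at: "at y within {0..1} = at y" using y x by (intro at_within_Icc_at) auto
    have d: "(F has_vector_derivative F' y) (at y)" "(F' has_vector_derivative F'' y) (at y)"
      using dF[OF y01] dF'[OF y01] by (simp_all add: at)
    have "(V has_real_derivative (F y \<bullet> F' y + F' y \<bullet> F y) + (F' y \<bullet> F'' y + F'' y \<bullet> F' y)) (at y)"
      unfolding V_def has_real_derivative_iff_has_vector_derivative
      by (intro has_vector_derivative_add bounded_bilinear.has_vector_derivative[OF bounded_bilinear_inner] d)
    then have dV: "(V has_real_derivative 2 * (F y \<bullet> F' y) + 2 * (F' y \<bullet> F'' y)) (at y)"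
      by (simp add: inner_commute algebra_simps)
    have "(E has_real_derivative exp (- (A + 2) * y) * (2 * (F y \<bullet> F' y) + 2 * (F' y \<bullet> F'' y) - (A + 2) * (V y + D\<^sup>2))) (at y)"
      unfolding E_def using dV by (auto intro!: derivative_eq_intros simp: algebra_simps)
    moreover have "2 * (F y \<bullet> F' y) + 2 * (F' y \<bullet> F'' y) - (A + 2) * (V y + D\<^sup>2) \<le> 0"
    proof -
      define p q where "p = norm (F y)" and "q = norm (F' y)"
      have V: "V y = p\<^sup>2 + q\<^sup>2" by (simp add: V_def p_def q_def power2_norm_eq_inner)
      have "F y \<bullet> F' y \<le> p * q" by (simp add: p_def q_def norm_cauchy_schwarz)
      moreover have "F' y \<bullet> F'' y \<le> q * (A * p + D)"
      proof -
        have "F' y \<bullet> F'' y \<le> q * norm (F'' y)" by (simp add: q_def norm_cauchy_schwarz)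
        also have "\<dots> \<le> q * (A * p + D)" using le[OF y01] by (intro mult_left_mono) (auto simp: p_def q_def)
        finally show ?thesis .
      qed
      moreover have "2 * (p * q) \<le> p\<^sup>2 + q\<^sup>2" using sum_squares_bound[of p q] by simp
      moreover have "2 * (q * D) \<le> q\<^sup>2 + D\<^sup>2" using sum_squares_bound[of q D] by simp
      moreover have "A * (2 * (p * q)) \<le> A * (p\<^sup>2 + q\<^sup>2)"
        using sum_squares_bound[of p q] \<open>A \<ge> 0\<close> by (intro mult_left_mono) auto
      moreover have "0 \<le> A * D\<^sup>2" "0 \<le> D\<^sup>2" "0 \<le> p\<^sup>2" using \<open>A \<ge> 0\<close> by auto
      moreover have "(A + 2) * (p\<^sup>2 + q\<^sup>2 + D\<^sup>2) = A * (p\<^sup>2 + q\<^sup>2) + A * D\<^sup>2 + 2 * p\<^sup>2 + 2 * q\<^sup>2 + 2 * D\<^sup>2"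
        "2 * (q * (A * p + D)) = A * (2 * (p * q)) + 2 * (q * D)"
        by (simp_all add: algebra_simps)
      ultimately show ?thesis unfolding V by linarith
    qed
    ultimately show "\<exists>z. (E has_real_derivative z) (at y) \<and> z \<le> 0"
      by (meson exp_ge_zero mult_nonneg_nonpos)
  qed
  have "V x \<le> V x + D\<^sup>2" by simp
  also have "V x + D\<^sup>2 = exp ((A + 2) * x) * E x"
    by (simp add: E_def mult.assoc[symmetric] exp_add[symmetric]) (simp add: algebra_simps)
  also have "\<dots> \<le> exp (A + 2) * E 0"
  proof (rule mult_mono)
    have "(A + 2) * x \<le> (A + 2) * 1" using x \<open>A \<ge> 0\<close> by (intro mult_left_mono) auto
    then show "exp ((A + 2) * x) \<le> exp (A + 2)" by simp
    show "E x \<le> E 0" by fact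
    show "0 \<le> E x" using V0 by (simp add: E_def)
  qed simp
  finally show ?thesis by (simp add: E_def V_def power2_norm_eq_inner mult.commute)
qed

lemma norm_vec_mult_Sc: "norm (x v* Sc th) \<le> (1 + \<bar>th\<bar>) * norm x"
proof -
  have "norm (x v* Sc th) \<le> \<bar>(x v* Sc th) $ 1\<bar> + \<bar>(x v* Sc th) $ 2\<bar>"
    using norm_le_l1_cart[of "x v* Sc th"] by (simp add: sum_2)
  also have "\<dots> \<le> \<bar>th\<bar> * norm x + norm x"
    unfolding vec_mult_Sc abs_mult
    by (intro add_mono mult_mono component_le_norm_cart) auto
  finally show ?thesis by (simp add: algebra_simps)
qed

lemma vec_mult_Sc_diff: "x v* Sc th - x v* Sc th' = (th' - th) *\<^sub>R vector [x $ 2, 0]"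
  by (simp add: vec_eq_iff forall_2 vec_mult_Sc algebra_simps)

lemma bounded_linear_vec_mult: "bounded_linear (\<lambda>x. x v* M)" for M :: "real^2^2"
  unfolding linear_conv_bounded_linear[symmetric]
  by (rule linearI) (simp_all add: vec_eq_iff vector_matrix_mult_def sum.distrib sum_distrib_left algebra_simps)

lemma loclip_vec_mult_Sc:
  assumes "loclip g"
  shows "loclip (\<lambda>th. g th v* Sc th)"
proof -
  have c: "bounded_linear (\<lambda>x::real^2. vector [x $ 2, 0] :: real^2)" "bounded_linear (\<lambda>x::real^2. vector [0, x $ 1] :: real^2)"
    unfolding linear_conv_bounded_linear[symmetric]
    by (rule linearI; simp add: vec_eq_iff forall_2)+
  have "(\<lambda>th. g th v* Sc th) = (\<lambda>th. vector [0, g th $ 1] - th *\<^sub>R vector [g th $ 2, 0])"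
    by (simp add: fun_eq_iff vec_eq_iff forall_2 vec_mult_Sc)
  then show ?thesis
    by (simp only:) (intro loclip_diff loclip_bounded_bilinear[OF bounded_bilinear_scaleR] loclip_ident
        loclip_bounded_linear[OF c(1)] loclip_bounded_linear[OF c(2)] assms)
qed

text \<open>The profile is required for every real parameter, since the estimate of \<theta> may
  take any value on its way, negative ones included.\<close>

locale regulator_profile =
  fixes a :: real and N :: nat and l :: "nat \<Rightarrow> real" and f f' :: "real \<Rightarrow> real \<Rightarrow> real^2"
  assumes f_ode: "\<And>th x. x \<in> {0..1} \<Longrightarrow>
        ((\<lambda>y. f y th) has_vector_derivative f' x th) (at x within {0..1}) \<and>
        ((\<lambda>y. f' y th) has_vector_derivative
           (f x th v* Sc th - a *\<^sub>R f x th - (\<Sum>n\<le>N. l n * phi n x) *\<^sub>R f 0 th)) (at x within {0..1})"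
    and f_init: "\<And>th. f' 0 th = 0" "\<And>th. f 0 th = gamma_c"
begin

lemma continuous_f: "continuous_on {0..1} (\<lambda>x. f x th)"
  by (rule has_vector_derivative_imp_continuous_on) (use f_ode in blast)

lemma profile_bounded:
  obtains C where "C \<ge> 0" "\<And>x th. x \<in> {0..1} \<Longrightarrow> \<bar>th\<bar> \<le> B \<Longrightarrow> norm (f x th) \<le> C"
proof -
  define A where "A = 1 + \<bar>B\<bar> + \<bar>a\<bar>"
  define D where "D = (\<Sum>n\<le>N. \<bar>l n\<bar> * sqrt 2) * norm gamma_c"
  have D: "D \<ge> 0" by (simp add: D_def sum_nonneg)
  show thesis
  proof (rule that[of "sqrt (((norm gamma_c)\<^sup>2 + D\<^sup>2) * exp (A + 2))"])
    fix x th :: real assume x: "x \<in> {0..1}" and th: "\<bar>th\<bar> \<le> B"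
    let ?F'' = "\<lambda>x. f x th v* Sc th - a *\<^sub>R f x th - (\<Sum>n\<le>N. l n * phi n x) *\<^sub>R f 0 th"
    have "(norm (f x th))\<^sup>2 + (norm (f' x th))\<^sup>2 \<le> ((norm (f 0 th))\<^sup>2 + (norm (f' 0 th))\<^sup>2 + D\<^sup>2) * exp (A + 2)"
    proof (rule second_order_energy[where F''="?F''"])
      fix y :: real assume y: "y \<in> {0..1}"
      have L: "\<bar>\<Sum>n\<le>N. l n * phi n y\<bar> \<le> (\<Sum>n\<le>N. \<bar>l n\<bar> * sqrt 2)"
        by (rule order_trans[OF sum_abs]) (auto simp: abs_mult phi_abs_le intro!: sum_mono mult_left_mono)
      have "norm (?F'' y) \<le> norm (f y th v* Sc th) + norm (a *\<^sub>R f y th) + norm ((\<Sum>n\<le>N. l n * phi n y) *\<^sub>R f 0 th)"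
        by (intro order_trans[OF norm_triangle_ineq4] add_right_mono norm_triangle_ineq4)
      also have "\<dots> \<le> (1 + \<bar>B\<bar>) * norm (f y th) + \<bar>a\<bar> * norm (f y th) + D"
      proof (intro add_mono)
        show "norm (f y th v* Sc th) \<le> (1 + \<bar>B\<bar>) * norm (f y th)"
          by (rule order_trans[OF norm_vec_mult_Sc]) (use th in \<open>auto intro!: mult_right_mono\<close>)
        show "norm ((\<Sum>n\<le>N. l n * phi n y) *\<^sub>R f 0 th) \<le> D"
          using L by (simp add: D_def f_init mult_right_mono)
      qed simp
      finally show "norm (?F'' y) \<le> A * norm (f y th) + D" by (simp add: A_def algebra_simps)
    qed (use f_ode x D in \<open>auto simp: A_def\<close>)
    then have "(norm (f x th))\<^sup>2 + (norm (f' x th))\<^sup>2 \<le> ((norm gamma_c)\<^sup>2 + D\<^sup>2) * exp (A + 2)" by (simp add: f_init)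
    then have "(norm (f x th))\<^sup>2 \<le> ((norm gamma_c)\<^sup>2 + D\<^sup>2) * exp (A + 2)"
      using zero_le_power2[of "norm (f' x th)"] by linarith
    then show "norm (f x th) \<le> sqrt (((norm gamma_c)\<^sup>2 + D\<^sup>2) * exp (A + 2))"
      by (rule real_le_rsqrt)
  qed simp
qed

text \<open>The difference of two profiles has zero data at x = 0, and the injection terms cancel
  because both profiles start at \<open>gamma_c\<close>. The only forcing left comes from the
  difference of the two matrices; it is proportional to th - th' and bounded by the previous
  estimate.\<close>

lemma profile_lipschitz:
  obtains L where "L \<ge> 0"
    "\<And>x th th'. x \<in> {0..1} \<Longrightarrow> \<bar>th\<bar> \<le> B \<Longrightarrow> \<bar>th'\<bar> \<le> B \<Longrightarrow>
      norm (f x th - f x th') \<le> L * \<bar>th - th'\<bar> \<and> norm (f' x th - f' x th') \<le> L * \<bar>th - th'\<bar>"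
proof -
  obtain C where C: "C \<ge> 0" "\<And>x th. x \<in> {0..1} \<Longrightarrow> \<bar>th\<bar> \<le> B \<Longrightarrow> norm (f x th) \<le> C"
    by (rule profile_bounded[of B]) blast
  define A where "A = 1 + \<bar>B\<bar> + \<bar>a\<bar>"
  define L where "L = C * sqrt (exp (A + 2))"
  show thesis
  proof (rule that[of L])
    show "L \<ge> 0" using C by (simp add: L_def)
    fix x th th' :: real assume x: "x \<in> {0..1}" and th: "\<bar>th\<bar> \<le> B" "\<bar>th'\<bar> \<le> B"
    define D where "D = \<bar>th - th'\<bar> * C"
    have D: "D \<ge> 0" using C by (simp add: D_def)
    let ?F = "\<lambda>x. f x th - f x th'" and ?F' = "\<lambda>x. f' x th - f' x th'"
    let ?F'' = "\<lambda>x. (f x th v* Sc th - a *\<^sub>R f x th - (\<Sum>n\<le>N. l n * phi n x) *\<^sub>R f 0 th)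
      - (f x th' v* Sc th' - a *\<^sub>R f x th' - (\<Sum>n\<le>N. l n * phi n x) *\<^sub>R f 0 th')"
    have "(norm (?F x))\<^sup>2 + (norm (?F' x))\<^sup>2 \<le> ((norm (?F 0))\<^sup>2 + (norm (?F' 0))\<^sup>2 + D\<^sup>2) * exp (A + 2)"
    proof (rule second_order_energy[where F''="?F''"])
      fix y :: real assume y: "y \<in> {0..1}"
      have lin: "f y th v* Sc th - f y th' v* Sc th = ?F y v* Sc th"
        using bounded_linear.linear[OF bounded_linear_vec_mult[of "Sc th"], THEN linear_diff] by simp
      have "?F'' y = ?F y v* Sc th + (f y th' v* Sc th - f y th' v* Sc th') - a *\<^sub>R ?F y"
        by (simp add: f_init lin[symmetric] algebra_simps)
      also have "norm \<dots> \<le> norm (?F y v* Sc th) + norm (f y th' v* Sc th - f y th' v* Sc th') + norm (a *\<^sub>R ?F y)"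
        by (intro order_trans[OF norm_triangle_ineq4] add_right_mono norm_triangle_ineq)
      also have "\<dots> \<le> (1 + \<bar>B\<bar>) * norm (?F y) + D + \<bar>a\<bar> * norm (?F y)"
      proof (intro add_mono)
        show "norm (?F y v* Sc th) \<le> (1 + \<bar>B\<bar>) * norm (?F y)"
          by (rule order_trans[OF norm_vec_mult_Sc]) (use th in \<open>auto intro!: mult_right_mono\<close>)
        have "norm (vector [f y th' $ 2, 0] :: real^2) \<le> norm (f y th')"
          using norm_le_l1_cart[of "vector [f y th' $ 2, 0] :: real^2"] component_le_norm_cart[of "f y th'" 2]
          by (simp add: sum_2)
        then have "norm (vector [f y th' $ 2, 0] :: real^2) \<le> C" using C(2)[OF y th(2)] by linarith
        then show "norm (f y th' v* Sc th - f y th' v* Sc th') \<le> D"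
          unfolding vec_mult_Sc_diff D_def by (simp add: abs_minus_commute mult_left_mono)
      qed simp
      finally show "norm (?F'' y) \<le> A * norm (?F y) + D" by (simp add: A_def algebra_simps)
    qed (use f_ode x D in \<open>auto simp: A_def intro!: has_vector_derivative_diff\<close>)
    then have 1: "(norm (?F x))\<^sup>2 + (norm (?F' x))\<^sup>2 \<le> D\<^sup>2 * exp (A + 2)" by (simp add: f_init)
    have 2: "D\<^sup>2 * exp (A + 2) = (L * \<bar>th - th'\<bar>)\<^sup>2"
      by (simp add: D_def L_def power_mult_distrib)
    have "(norm (?F x))\<^sup>2 \<le> (L * \<bar>th - th'\<bar>)\<^sup>2" "(norm (?F' x))\<^sup>2 \<le> (L * \<bar>th - th'\<bar>)\<^sup>2"
      using 1 zero_le_power2[of "norm (?F x)"] zero_le_power2[of "norm (?F' x)"] unfolding 2 by linarith+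
    then show "norm (?F x) \<le> L * \<bar>th - th'\<bar> \<and> norm (?F' x) \<le> L * \<bar>th - th'\<bar>"
      using \<open>L \<ge> 0\<close> by (auto intro: power2_le_imp_le)
  qed
qed

lemma loclip_f'1: "loclip (\<lambda>th. f' 1 th)"
proof (rule loclipI)
  fix B :: real
  obtain L where "\<And>x th th'. x \<in> {0..1} \<Longrightarrow> \<bar>th\<bar> \<le> B \<Longrightarrow> \<bar>th'\<bar> \<le> B \<Longrightarrow>
      norm (f x th - f x th') \<le> L * \<bar>th - th'\<bar> \<and> norm (f' x th - f' x th') \<le> L * \<bar>th - th'\<bar>"
    by (rule profile_lipschitz[of B]) blast
  from this[of 1] show "\<exists>L. \<forall>x y. \<bar>x\<bar> \<le> B \<longrightarrow> \<bar>y\<bar> \<le> B \<longrightarrow> norm (f' 1 x - f' 1 y) \<le> L * \<bar>x - y\<bar>" by auto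
qed

lemma f_phi_integrable: "(\<lambda>x. phi n x *\<^sub>R f x th) integrable_on {0..1}"
  by (intro integrable_continuous_real continuous_intros continuous_f)

lemma loclip_modes: "loclip (\<lambda>th. ipv01 (\<lambda>x. f x th) (phi n))"
proof (rule loclipI)
  fix B :: real
  obtain L where L: "L \<ge> 0" "\<And>x th th'. x \<in> {0..1} \<Longrightarrow> \<bar>th\<bar> \<le> B \<Longrightarrow> \<bar>th'\<bar> \<le> B \<Longrightarrow>
      norm (f x th - f x th') \<le> L * \<bar>th - th'\<bar> \<and> norm (f' x th - f' x th') \<le> L * \<bar>th - th'\<bar>"
    by (rule profile_lipschitz[of B]) blast
  have "norm (ipv01 (\<lambda>x. f x u) (phi n) - ipv01 (\<lambda>x. f x v) (phi n)) \<le> (sqrt 2 * L) * \<bar>u - v\<bar>"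
    if uv: "\<bar>u\<bar> \<le> B" "\<bar>v\<bar> \<le> B" for u v
  proof -
    have "ipv01 (\<lambda>x. f x u) (phi n) - ipv01 (\<lambda>x. f x v) (phi n) = integral {0..1} (\<lambda>x. phi n x *\<^sub>R (f x u - f x v))"
      unfolding ipv01_def scaleR_diff_right
      by (rule Henstock_Kurzweil_Integration.integral_diff[symmetric]) (rule f_phi_integrable)+
    also have "norm \<dots> \<le> (sqrt 2 * (L * \<bar>u - v\<bar>)) * (1 - 0)"
    proof (rule integral_bound)
      show "continuous_on {0..1} (\<lambda>x. phi n x *\<^sub>R (f x u - f x v))" by (intro continuous_intros continuous_f)
      fix x :: real assume "x \<in> {0..1}"
      then show "norm (phi n x *\<^sub>R (f x u - f x v)) \<le> sqrt 2 * (L * \<bar>u - v\<bar>)"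
        unfolding norm_scaleR using L(2)[of x u v] uv by (intro mult_mono) (auto simp: phi_abs_le)
    qed simp
    finally show ?thesis by (simp add: mult.assoc)
  qed
  then show "\<exists>L. \<forall>x y. \<bar>x\<bar> \<le> B \<longrightarrow> \<bar>y\<bar> \<le> B \<longrightarrow>
      norm (ipv01 (\<lambda>xa. f xa x) (phi n) - ipv01 (\<lambda>x. f x y) (phi n)) \<le> L * \<bar>x - y\<bar>" by blast
qed

text \<open>Green's formula against \<open>phi n\<close>: as \<open>phi n\<close> has zero slope at
  both ends and f' vanishes at 0, only the boundary term at 1 survives. Read along a solution d' = S
  d, it says that the modes of f d behave like those of the observer with boundary input f'(1) d and
  with the first component of d injected through \<open>l\<close>. This is why the two can be
  added.\<close>

lemma mode_equation:
  defines "m \<equiv> \<lambda>n th. ipv01 (\<lambda>x. f x th) (phi n)"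
  shows "m n th v* Sc th = (a - (real n * pi)\<^sup>2) *\<^sub>R m n th + phi n 1 *\<^sub>R f' 1 th + (if n \<le> N then l n else 0) *\<^sub>R gamma_c"
proof -
  let ?L = "\<lambda>x. \<Sum>j\<le>N. l j * phi j x"
  let ?F'' = "\<lambda>x. f x th v* Sc th - a *\<^sub>R f x th - ?L x *\<^sub>R f 0 th"
  define c where "c = (if n = 0 then 1 else sqrt 2)"
  define lam where "lam = (real n * pi)\<^sup>2"
  define p' where "p' x = - c * (real n * pi) * sin (real n * pi * x)" for x
  have dphi: "(phi n has_real_derivative p' x) (at x within {0..1})" for x
    unfolding phi_alt[abs_def] p'_def c_def[symmetric] by (auto intro!: derivative_eq_intros)
  have dp': "(p' has_real_derivative - lam * phi n x) (at x within {0..1})" for x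
    unfolding phi_alt[abs_def] p'_def[abs_def] c_def[symmetric] lam_def
    by (auto intro!: derivative_eq_intros simp: power2_eq_square)
  have p0: "p' 0 = 0" "p' 1 = 0" by (simp_all add: p'_def sin_npi)
  \<comment> \<open>One application of the fundamental theorem to phi f' - phi' f replaces two
    integrations by parts.\<close>
  have int: "((\<lambda>x. (phi n x *\<^sub>R ?F'' x + p' x *\<^sub>R f' x th) - (p' x *\<^sub>R f' x th + (- lam * phi n x) *\<^sub>R f x th))
      has_integral ((phi n 1 *\<^sub>R f' 1 th - p' 1 *\<^sub>R f 1 th) - (phi n 0 *\<^sub>R f' 0 th - p' 0 *\<^sub>R f 0 th))) {0..1}"
  proof (rule fundamental_theorem_of_calculus)
    fix x :: real assume x: "x \<in> {0..1}"
    show "((\<lambda>x. phi n x *\<^sub>R f' x th - p' x *\<^sub>R f x th) has_vector_derivative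
        (phi n x *\<^sub>R ?F'' x + p' x *\<^sub>R f' x th) - (p' x *\<^sub>R f' x th + (- lam * phi n x) *\<^sub>R f x th)) (at x within {0..1})"
      using f_ode[OF x, of th]
      by (intro has_vector_derivative_diff has_vector_derivative_scaleR dphi dp') auto
  qed simp
  have mi: "((\<lambda>x. phi n x *\<^sub>R f x th) has_integral m n th) {0..1}"
    unfolding m_def ipv01_def by (rule integrable_integral[OF f_phi_integrable])
  have mi2: "((\<lambda>x. (phi n x *\<^sub>R f x th) v* Sc th) has_integral m n th v* Sc th) {0..1}"
    using has_integral_linear[OF mi bounded_linear_vec_mult[of "Sc th"]] by (simp add: o_def)
  have "((\<lambda>x. ?L x * phi n x) has_integral ip01 ?L (phi n)) {0..1}"
    unfolding ip01_def by (intro integrable_integral integrable_continuous_real continuous_intros)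
  then have "((\<lambda>x. ?L x * phi n x) has_integral (if n \<le> N then l n else 0)) {0..1}"
    by (simp only: ip01_sum_phi finite_atMost atMost_iff)
  then have li: "((\<lambda>x. (?L x * phi n x) *\<^sub>R gamma_c) has_integral (if n \<le> N then l n else 0) *\<^sub>R gamma_c) {0..1}"
    by (rule has_integral_scaleR_left)
  let ?c = "(if n \<le> N then l n else 0) *\<^sub>R gamma_c"
  have "((\<lambda>x. (phi n x *\<^sub>R f x th) v* Sc th - a *\<^sub>R (phi n x *\<^sub>R f x th) - (?L x * phi n x) *\<^sub>R gamma_c + lam *\<^sub>R (phi n x *\<^sub>R f x th))
      has_integral (m n th v* Sc th - a *\<^sub>R m n th - ?c + lam *\<^sub>R m n th)) {0..1}"
    by (intro has_integral_add has_integral_diff has_integral_cmul mi mi2 li)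
  moreover have "(phi n x *\<^sub>R f x th) v* Sc th - a *\<^sub>R (phi n x *\<^sub>R f x th) - (?L x * phi n x) *\<^sub>R gamma_c + lam *\<^sub>R (phi n x *\<^sub>R f x th)
      = (phi n x *\<^sub>R ?F'' x + p' x *\<^sub>R f' x th) - (p' x *\<^sub>R f' x th + (- lam * phi n x) *\<^sub>R f x th)" for x
    using bounded_linear.linear[OF bounded_linear_vec_mult[of "Sc th"], THEN linear_scale, of "phi n x" "f x th"]
    by (simp add: f_init scaleR_diff_right mult.commute)
  ultimately have "((\<lambda>x. (phi n x *\<^sub>R ?F'' x + p' x *\<^sub>R f' x th) - (p' x *\<^sub>R f' x th + (- lam * phi n x) *\<^sub>R f x th))
      has_integral (m n th v* Sc th - a *\<^sub>R m n th - ?c + lam *\<^sub>R m n th)) {0..1}"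
    by (simp only:)
  then have eq: "m n th v* Sc th - a *\<^sub>R m n th - ?c + lam *\<^sub>R m n th
      = (phi n 1 *\<^sub>R f' 1 th - p' 1 *\<^sub>R f 1 th) - (phi n 0 *\<^sub>R f' 0 th - p' 0 *\<^sub>R f 0 th)"
    using int by (rule has_integral_unique)
  have "m n th v* Sc th = (m n th v* Sc th - a *\<^sub>R m n th - ?c + lam *\<^sub>R m n th) + a *\<^sub>R m n th + ?c - lam *\<^sub>R m n th"
    by simp
  also have "\<dots> = phi n 1 *\<^sub>R f' 1 th + a *\<^sub>R m n th + ?c - lam *\<^sub>R m n th"
    unfolding eq by (simp add: p0 f_init)
  finally show ?thesis unfolding lam_def scaleR_diff_left by (simp only: add_ac diff_conv_add_uminus)
qed

end

section \<open>Modal asymptotics\<close>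

lemma summable_inverse_eigenvalue: "summable (\<lambda>n. 1 / \<bar>(real n * pi)\<^sup>2 - c\<bar>)"
proof (rule summable_comparison_test_ev)
  show "summable (\<lambda>n. inverse (real n ^ 2))" by (rule inverse_power_summable) simp
  show "\<forall>\<^sub>F n in sequentially. norm (1 / \<bar>(real n * pi)\<^sup>2 - c\<bar>) \<le> inverse (real n ^ 2)"
  proof (rule eventually_mono[OF eventually_ge_at_top[of "nat \<lceil>\<bar>c\<bar>\<rceil> + 1"]])
    fix n :: nat assume "nat \<lceil>\<bar>c\<bar>\<rceil> + 1 \<le> n"
    then have n: "1 \<le> real n" "\<bar>c\<bar> \<le> real n" by linarith+
    have "real n \<le> (real n)\<^sup>2" using n by (simp add: power2_eq_square)
    then have 1: "\<bar>c\<bar> \<le> (real n)\<^sup>2" using n by linarith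
    have "3\<^sup>2 \<le> pi\<^sup>2" using pi_gt3 by (intro power_mono) auto
    then have "(real n)\<^sup>2 * 2 \<le> (real n)\<^sup>2 * pi\<^sup>2" by (intro mult_left_mono) auto
    then have "(real n)\<^sup>2 \<le> (real n * pi)\<^sup>2 - c" using 1 by (simp add: power_mult_distrib)
    then have 2: "(real n)\<^sup>2 \<le> \<bar>(real n * pi)\<^sup>2 - c\<bar>" by linarith
    have "0 < (real n)\<^sup>2" using n by simp
    then show "norm (1 / \<bar>(real n * pi)\<^sup>2 - c\<bar>) \<le> inverse (real n ^ 2)"
      using 2 by (simp add: inverse_eq_divide frac_le)
  qed
qed

lemma exp_minus_le_inverse: "x > 0 \<Longrightarrow> exp (- x) \<le> 1 / x" for x :: real
proof -
  assume "x > 0"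
  moreover have "x \<le> exp x" using exp_ge_add_one_self[of x] by linarith
  ultimately show ?thesis by (simp add: exp_minus inverse_eq_divide frac_le)
qed

lemma summable_exp_eigenvalue:
  assumes "\<And>n. n > N \<Longrightarrow> a - (real n * pi)\<^sup>2 < 0"
  shows "summable (\<lambda>n. exp (a - (real n * pi)\<^sup>2))"
proof (rule summable_comparison_test'[OF summable_inverse_eigenvalue[of a], of "N + 1"])
  fix n assume "n \<ge> N + 1"
  then have "a - (real n * pi)\<^sup>2 < 0" by (intro assms) simp
  then show "norm (exp (a - (real n * pi)\<^sup>2)) \<le> 1 / \<bar>(real n * pi)\<^sup>2 - a\<bar>"
    using exp_minus_le_inverse[of "(real n * pi)\<^sup>2 - a"] by simp
qed

lemma mv_Amat: "i < m \<Longrightarrow> mv m (Amat a) x i = (a - (real i * pi)\<^sup>2) * x i"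
  by (simp add: mv_def Amat_def if_distrib[of "\<lambda>u. u * _"] cong: if_cong)

lemma exosystem_inner_deriv:
  fixes p :: "real \<Rightarrow> real^2"
  assumes "\<And>t. t \<ge> 0 \<Longrightarrow> (p has_vector_derivative (G *v p t)) (at t within {0..})" "t > 0"
  shows "((\<lambda>t. u \<bullet> p t) has_real_derivative u \<bullet> (G *v p t)) (at t)"
proof -
  have "(p has_vector_derivative (G *v p t)) (at t)"
    using has_vector_derivative_within_subset[OF assms(1)[of t], of "{0<..}"] assms(2)
    by (simp add: at_within_open[of t "{0<..}"] subset_eq)
  then show ?thesis
    unfolding has_real_derivative_iff_has_vector_derivative
    by (rule bounded_linear.has_vector_derivative[OF bounded_linear_inner_right])
qed

lemma linear_ode_exact:
  fixes x :: "real \<Rightarrow> real"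
  assumes "\<And>t. t \<ge> T \<Longrightarrow> (x has_real_derivative \<mu> * x t) (at t)" "t \<ge> T"
  shows "x t = exp (\<mu> * (t - T)) * x T"
proof -
  define y where "y t = exp (- \<mu> * t) * x t" for t
  have d: "(y has_real_derivative 0) (at s)" if "s \<ge> T" for s
    unfolding y_def[abs_def] using assms(1)[OF that] by (auto intro!: derivative_eq_intros)
  have "y t \<le> y T" by (rule deriv_nonpos_le[OF d _ assms(2)]) auto
  moreover have "- y t \<le> - y T" by (rule deriv_nonpos_le[OF DERIV_minus[OF d] _ assms(2)]) auto
  ultimately have "y t = y T" by simp
  then have "exp (\<mu> * t) * (exp (- \<mu> * t) * x t) = exp (\<mu> * t) * (exp (- \<mu> * T) * x T)" by (simp add: y_def)
  moreover have "exp (\<mu> * t) * exp (- \<mu> * t) = 1" "exp (\<mu> * t) * exp (- \<mu> * T) = exp (\<mu> * (t - T))"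
    by (simp_all add: exp_add[symmetric] algebra_simps)
  ultimately show ?thesis by (metis mult.assoc mult_1)
qed

text \<open>The system is triangular. Injection acts on the modes up to \<open>N\<close> only, so
  each higher mode is driven by \<open>p\<close> alone and differs from a steady response by a pure
  exponential. Together they contribute a fixed functional of \<open>p\<close> and a decaying
  remainder to the trace, which closes the equations of the first N + 1 modes with matrix A + L C.
  Continuity of the trace is obtained on the way, and without it the low modes could not be
  differentiated.\<close>

lemma observer_error_asymptotics:
  fixes E :: "nat \<Rightarrow> real \<Rightarrow> real" and v :: "real \<Rightarrow> real \<Rightarrow> real" and b :: "nat \<Rightarrow> real^2"
    and p :: "real \<Rightarrow> real^2" and G :: "real^2^2" and l :: "nat \<Rightarrow> real"
  assumes Q: "posdef (N + 1) Q"
    and neg: "negdef (N + 1) (\<lambda>i j. mmul (N + 1) Q (\<lambda>i j. Amat a i j + l i * Cvec j) i j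
        + mmul (N + 1) (mtr (\<lambda>i j. Amat a i j + l i * Cvec j)) Q i j + 2 * \<delta> * Q i j)"
    and "\<delta> > 0" and tail: "\<forall>n>N. a - (real n * pi)\<^sup>2 < - \<delta>"
    and G2: "\<And>u. G *v (G *v u) = - \<theta> *\<^sub>R u" and "\<theta> > 0"
    and p: "\<And>t. t \<ge> 0 \<Longrightarrow> (p has_vector_derivative (G *v p t)) (at t within {0..})"
    and b: "\<And>n. norm (b n) \<le> Bb"
    and v: "\<And>t. t > 0 \<Longrightarrow> continuous_on {0..1} (v t)"
    and Ev: "\<And>n t. t > 0 \<Longrightarrow> ip01 (v t) (phi n) = E n t"
    and modes: "\<And>n t. t \<ge> 0 \<Longrightarrow>
        ((\<lambda>s. (a - (real n * pi)\<^sup>2) * E n s + b n \<bullet> p s + (if n \<le> N then l n else 0) * v s 0)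
          has_integral (E n t - E n 0)) {0..t}"
  obtains q where "expdecay (\<lambda>t. v t 0 - q \<bullet> p t)" "continuous_on {2..} (\<lambda>t. v t 0)"
proof -
  define \<mu> where "\<mu> n = a - (real n * pi)\<^sup>2" for n :: nat
  have \<mu>: "\<mu> n < - \<delta>" if "n > N" for n using tail that by (simp add: \<mu>_def)
  have cp: "continuous_on {0..} p"
    by (rule has_vector_derivative_imp_continuous_on[OF p]) simp
  have dp: "((\<lambda>t. u \<bullet> p t) has_real_derivative u \<bullet> (G *v p t)) (at t)" if "t > 0" for u t
    using exosystem_inner_deriv[of p G t u] p that by blast
  have cE: "continuous_on {0..} (E n)" for n by (rule has_integral_imp_continuous[OF modes])
  \<comment> \<open>The steady response: c G = \<mu> c + b is solved explicitly, because (G + \<mu>)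
    (G - \<mu>) = - (\<theta> + \<mu>^2).\<close>
  define c where "c n = - (1 / (\<theta> + (\<mu> n)\<^sup>2)) *\<^sub>R (b n v* G + \<mu> n *\<^sub>R b n)" for n
  have pos: "\<theta> + (\<mu> n)\<^sup>2 > 0" for n using \<open>\<theta> > 0\<close> by (simp add: add_pos_nonneg)
  have cG: "c n \<bullet> (G *v u) = \<mu> n * (c n \<bullet> u) + b n \<bullet> u" for n u
  proof -
    have 1: "(b n v* G) \<bullet> (G *v u) = - \<theta> * (b n \<bullet> u)" by (simp add: dot_lmul_matrix G2)
    have 2: "(b n v* G) \<bullet> u = b n \<bullet> (G *v u)" by (simp add: dot_lmul_matrix)
    show ?thesis unfolding c_def inner_scaleR_left inner_add_left 1 2
      using pos[of n] by (simp add: field_simps power2_eq_square)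
  qed
  define x where "x n t = E n t - c n \<bullet> p t" for n t
  have dE: "(E n has_real_derivative \<mu> n * E n t + b n \<bullet> p t) (at t)" if "n > N" "t > 0" for n t
  proof -
    have "((\<lambda>s. \<mu> n * E n s + b n \<bullet> p s) has_integral (E n t - E n 0)) {0..t}" if "t \<ge> 0" for t
      using modes[OF that, of n] \<open>n > N\<close> by (simp add: \<mu>_def)
    then show ?thesis
      by (rule has_integral_imp_deriv[where T=0]) (use that in \<open>auto intro!: continuous_intros cE cp\<close>)
  qed
  have dx: "(x n has_real_derivative \<mu> n * x n t) (at t)" if "n > N" "t > 0" for n t
    unfolding x_def[abs_def]
    by (rule DERIV_cong[OF DERIV_diff[OF dE[OF that] dp[OF that(2)]]]) (simp add: cG x_def algebra_simps)
  \<comment> \<open>The exponential is started at time 1, when the error is already continuous in x,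
    so that its modes are bounded uniformly in n.\<close>
  have xt: "x n t = exp (\<mu> n * (t - 1)) * x n 1" if "n > N" "t \<ge> 1" for n t
    by (rule linear_ode_exact) (use dx that in auto)
  obtain KG where KG: "\<And>u. norm (u v* G) \<le> norm u * KG" "KG > 0"
    using bounded_linear.pos_bounded[OF bounded_linear_vec_mult[of G]] by blast
  have Bb0: "Bb \<ge> 0" using norm_ge_zero[of "b 0"] b[of 0] by linarith
  define Kc where "Kc = Bb * KG / \<delta> + Bb"
  have Kc0: "Kc \<ge> 0" using Bb0 KG \<open>\<delta> > 0\<close> by (simp add: Kc_def)
  have cb: "norm (c n) \<le> Kc * (1 / \<bar>\<mu> n\<bar>)" if "n > N" for n
  proof -
    have m: "\<bar>\<mu> n\<bar> > \<delta>" "\<bar>\<mu> n\<bar> > 0" using \<mu>[OF that] \<open>\<delta> > 0\<close> by auto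
    have "norm (c n) = (1 / (\<theta> + (\<mu> n)\<^sup>2)) * norm (b n v* G + \<mu> n *\<^sub>R b n)"
      using pos[of n] by (simp add: c_def)
    also have "\<dots> \<le> (1 / \<bar>\<mu> n\<bar>\<^sup>2) * (Bb * KG + \<bar>\<mu> n\<bar> * Bb)"
    proof (rule mult_mono)
      show "1 / (\<theta> + (\<mu> n)\<^sup>2) \<le> 1 / \<bar>\<mu> n\<bar>\<^sup>2" using m \<open>\<theta> > 0\<close> by (intro divide_left_mono) (auto intro!: mult_pos_pos add_pos_nonneg)
      have "norm (b n v* G) \<le> Bb * KG" by (rule order_trans[OF KG(1)]) (use b KG in \<open>auto intro!: mult_right_mono\<close>)
      moreover have "norm (\<mu> n *\<^sub>R b n) \<le> \<bar>\<mu> n\<bar> * Bb" using b by (simp add: mult_left_mono)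
      ultimately show "norm (b n v* G + \<mu> n *\<^sub>R b n) \<le> Bb * KG + \<bar>\<mu> n\<bar> * Bb"
        by (rule norm_triangle_mono)
    qed auto
    also have "\<dots> = Bb * KG * (1 / \<bar>\<mu> n\<bar>) * (1 / \<bar>\<mu> n\<bar>) + Bb * (1 / \<bar>\<mu> n\<bar>)"
      using m by (simp add: field_simps power2_eq_square)
    also have "\<dots> \<le> Bb * KG * (1 / \<delta>) * (1 / \<bar>\<mu> n\<bar>) + Bb * (1 / \<bar>\<mu> n\<bar>)"
      using m Bb0 KG \<open>\<delta> > 0\<close> by (intro add_right_mono mult_right_mono mult_left_mono divide_left_mono) auto
    also have "\<dots> = Kc * (1 / \<bar>\<mu> n\<bar>)" by (simp add: Kc_def algebra_simps add_divide_distrib)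
    finally show ?thesis .
  qed
  have s1: "summable (\<lambda>n. 1 / \<bar>\<mu> n\<bar>)"
    using summable_inverse_eigenvalue[of a] unfolding \<mu>_def by (simp add: abs_minus_commute)
  have sexp: "summable (\<lambda>n. exp (\<mu> n))"
    unfolding \<mu>_def by (rule summable_exp_eigenvalue[of N]) (use tail \<open>\<delta> > 0\<close> in force)
  have "bounded (v 1 ` {0..1})" by (intro compact_imp_bounded compact_continuous_image v) auto
  then obtain Bv where "\<forall>y\<in>{0..1}. \<bar>v 1 y\<bar> \<le> Bv" by (auto simp: bounded_iff)
  then have Bv: "\<bar>v 1 y\<bar> \<le> Bv" if "y \<in> {0..1}" for y using that by blast
  define M where "M = Bv * sqrt 2 + Kc / \<delta> * norm (p 1)"
  have xM: "\<bar>x n 1\<bar> \<le> M" if "n > N" for n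
  proof -
    have "\<bar>E n 1\<bar> \<le> Bv * sqrt 2" using ip01_phi_bound[OF v[of 1] Bv, of n] Ev[of 1 n] by simp
    moreover have "\<bar>c n \<bullet> p 1\<bar> \<le> Kc / \<delta> * norm (p 1)"
    proof -
      have "1 / \<bar>\<mu> n\<bar> \<le> 1 / \<delta>" using \<mu>[OF that] \<open>\<delta> > 0\<close> by (intro frac_le) auto
      then have "Kc * (1 / \<bar>\<mu> n\<bar>) \<le> Kc * (1 / \<delta>)" using Kc0 by (intro mult_left_mono)
      then have "norm (c n) \<le> Kc / \<delta>" using cb[OF that] by simp
      then have "norm (c n) * norm (p 1) \<le> Kc / \<delta> * norm (p 1)" by (intro mult_right_mono) auto
      then show ?thesis using Cauchy_Schwarz_ineq2[of "c n" "p 1"] by linarith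
    qed
    ultimately show ?thesis unfolding x_def M_def by linarith
  qed
  have M0: "M \<ge> 0" using xM[of "N + 1"] by simp
  define h where "h n t = (if n \<le> N then 0 else phi n 0 * x n t)" for n t
  define cc where "cc n = (if n \<le> N then 0 else phi n 0 *\<^sub>R c n)" for n
  \<comment> \<open>The elapsed time t - 1 is split: one unit yields exp (\<mu> n), which is
    summable over the modes, and the rest t - 2 yields the decay in time.\<close>
  have hb: "norm (h n t) \<le> sqrt 2 * M * exp (\<mu> n) * exp (- \<delta> * (t - 2))" if t: "t \<ge> 2" for n t
  proof (cases "n \<le> N")
    case False
    then have n: "n > N" by simp
    have "\<mu> n * (t - 2) \<le> - \<delta> * (t - 2)" using \<mu>[OF n] t by (intro mult_right_mono) auto
    then have e: "exp (\<mu> n * (t - 1)) \<le> exp (\<mu> n) * exp (- \<delta> * (t - 2))"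
      unfolding exp_add[symmetric] by (simp add: algebra_simps)
    have "norm (h n t) = \<bar>phi n 0\<bar> * \<bar>x n 1\<bar> * exp (\<mu> n * (t - 1))"
      using n t xt[OF n, of t] by (simp add: h_def abs_mult)
    also have "\<dots> \<le> sqrt 2 * M * (exp (\<mu> n) * exp (- \<delta> * (t - 2)))"
      using e xM[OF n] M0 by (intro mult_mono) (auto simp: phi_abs_le)
    finally show ?thesis by (simp add: mult.assoc)
  qed (use M0 in \<open>simp add: h_def\<close>)
  have hb2: "norm (h n t) \<le> sqrt 2 * M * exp (\<mu> n)" if t: "t \<ge> 2" for n t
  proof -
    have "sqrt 2 * M * exp (\<mu> n) * exp (- \<delta> * (t - 2)) \<le> sqrt 2 * M * exp (\<mu> n) * 1"
      using t M0 \<open>\<delta> > 0\<close> by (intro mult_left_mono) auto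
    from order_trans[OF hb[OF t, of n] this] show ?thesis by simp
  qed
  have shb: "summable (\<lambda>n. sqrt 2 * M * exp (\<mu> n))" by (intro summable_mult sexp)
  define \<rho> where "\<rho> t = (\<Sum>n. h n t)" for t
  have sh: "summable (\<lambda>n. h n t)" if "t \<ge> 2" for t
    by (rule summable_comparison_test'[OF shb]) (use hb2[OF that] in auto)
  have \<rho>d: "expdecay \<rho>"
  proof (rule expdecayI[OF \<open>\<delta> > 0\<close>, of 2 _ "(\<Sum>n. sqrt 2 * M * exp (\<mu> n)) * exp (2 * \<delta>)"])
    fix t :: real assume t: "t \<ge> 2"
    have "norm (\<rho> t) \<le> (\<Sum>n. sqrt 2 * M * exp (\<mu> n) * exp (- \<delta> * (t - 2)))"
      unfolding \<rho>_def by (rule norm_suminf_le[OF hb[OF t] summable_mult2[OF shb]])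
    also have "\<dots> = (\<Sum>n. sqrt 2 * M * exp (\<mu> n)) * exp (- \<delta> * (t - 2))" by (rule suminf_mult2[OF shb, symmetric])
    also have "exp (- \<delta> * (t - 2)) = exp (2 * \<delta>) * exp (- \<delta> * t)" by (simp add: exp_add[symmetric] algebra_simps)
    finally show "norm (\<rho> t) \<le> (\<Sum>n. sqrt 2 * M * exp (\<mu> n)) * exp (2 * \<delta>) * exp (- \<delta> * t)" by (simp add: mult.assoc)
  qed
  have ch: "continuous_on {2..} (h n)" for n
    unfolding h_def[abs_def] x_def[abs_def]
    by (cases "n \<le> N") (auto intro!: continuous_intros continuous_on_subset[OF cE] continuous_on_subset[OF cp])
  have c\<rho>: "continuous_on {2..} \<rho>"
  proof (rule uniform_limit_theorem)
    show "uniform_limit {2..} (\<lambda>n t. \<Sum>i<n. h i t) \<rho> sequentially"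
      unfolding \<rho>_def[abs_def] by (rule Weierstrass_m_test[OF _ shb]) (use hb2 in auto)
    show "\<forall>\<^sub>F n in sequentially. continuous_on {2..} (\<lambda>t. \<Sum>i<n. h i t)"
      by (intro always_eventually allI continuous_intros ch)
  qed simp
  have scn: "summable (\<lambda>n. norm (cc n))"
  proof (rule summable_comparison_test'[OF summable_mult[OF s1, of "sqrt 2 * Kc"]])
    fix n
    show "norm (norm (cc n)) \<le> sqrt 2 * Kc * (1 / \<bar>\<mu> n\<bar>)"
    proof (cases "n \<le> N")
      case False
      then have "norm (cc n) \<le> sqrt 2 * (Kc * (1 / \<bar>\<mu> n\<bar>))"
        using cb[of n] by (simp only: cc_def if_False norm_scaleR real_norm_def) (intro mult_mono, auto simp: phi_abs_le)
      then show ?thesis by (simp add: mult.assoc)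
    qed (use Kc0 in \<open>simp add: cc_def\<close>)
  qed
  then have scc: "summable cc" by (rule summable_norm_cancel)
  define c\<zeta> where "c\<zeta> = suminf cc"
  have e0: "v t 0 = (\<Sum>j<N+1. phi j 0 * E j t) + c\<zeta> \<bullet> p t + \<rho> t" if t: "t \<ge> 2" for t
  proof -
    have sc: "(\<lambda>n. cc n \<bullet> p t) sums (c\<zeta> \<bullet> p t)"
      unfolding c\<zeta>_def
      by (rule bounded_linear.sums[OF bounded_linear_inner_left summable_sums[OF scc]])
    have "(\<lambda>n. (if n \<in> {..<N+1} then phi n 0 * E n t else 0)) sums (\<Sum>j<N+1. phi j 0 * E j t)"
      by (rule sums_If_finite_set) simp
    then have "(\<lambda>n. (if n \<in> {..<N+1} then phi n 0 * E n t else 0) + cc n \<bullet> p t + h n t) sums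
        ((\<Sum>j<N+1. phi j 0 * E j t) + c\<zeta> \<bullet> p t + \<rho> t)"
      unfolding \<rho>_def by (intro sums_add sc summable_sums[OF sh[OF t]])
    moreover have "(if n \<in> {..<N+1} then phi n 0 * E n t else 0) + cc n \<bullet> p t + h n t = E n t * phi n 0" for n
      by (simp add: cc_def h_def x_def algebra_simps)
    ultimately have 1: "(\<lambda>n. E n t * phi n 0) sums ((\<Sum>j<N+1. phi j 0 * E j t) + c\<zeta> \<bullet> p t + \<rho> t)" by (simp only:)
    have t0: "t > 0" using t by simp
    have "summable (\<lambda>n. \<bar>E n t\<bar>)"
    proof (rule summable_comparison_test'[where N="N + 1" and g="\<lambda>n. Kc * (1 / \<bar>\<mu> n\<bar>) * norm (p t) + M * exp (\<mu> n)"])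
      show "summable (\<lambda>n. Kc * (1 / \<bar>\<mu> n\<bar>) * norm (p t) + M * exp (\<mu> n))"
        by (intro summable_add summable_mult summable_mult2 s1 sexp)
      fix n assume "n \<ge> N + 1"
      then have n: "n > N" by simp
      have "\<mu> n * (t - 1) \<le> \<mu> n * 1" using \<mu>[OF n] \<open>\<delta> > 0\<close> t by (intro mult_left_mono_neg) auto
      then have "\<bar>x n t\<bar> \<le> exp (\<mu> n) * M"
        using xt[OF n, of t] t xM[OF n] by (simp add: abs_mult) (intro mult_mono, auto)
      moreover have "\<bar>c n \<bullet> p t\<bar> \<le> Kc * (1 / \<bar>\<mu> n\<bar>) * norm (p t)"
        by (rule order_trans[OF Cauchy_Schwarz_ineq2]) (intro mult_right_mono cb[OF n], simp)
      moreover have "E n t = x n t + c n \<bullet> p t" by (simp add: x_def)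
      ultimately show "norm \<bar>E n t\<bar> \<le> Kc * (1 / \<bar>\<mu> n\<bar>) * norm (p t) + M * exp (\<mu> n)"
        by (simp add: mult.commute)
    qed
    then have "(\<lambda>n. E n t * phi n 0) sums v t 0"
      using fourier_sums[OF v[OF t0], of 0] Ev[OF t0] by simp
    then show ?thesis using 1 sums_unique2 by blast
  qed
  have cv: "continuous_on {2..} (\<lambda>t. v t 0)"
    by (rule continuous_on_eq[of _ "\<lambda>t. (\<Sum>j<N+1. phi j 0 * E j t) + c\<zeta> \<bullet> p t + \<rho> t"])
       (auto intro!: continuous_intros c\<rho> continuous_on_subset[OF cE] continuous_on_subset[OF cp] simp: e0)
  define A where "A = (\<lambda>i j. Amat a i j + l i * Cvec j)"
  \<comment> \<open>The share \<open>c\<zeta>\<close> of the higher modes in the trace is fed back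
    through the injection, hence its appearance beside the direct forcing \<open>b\<close>.\<close>
  define Y where "Y i = l i *\<^sub>R c\<zeta> + b i" for i
  obtain k where k: "\<And>i. i < N + 1 \<Longrightarrow> k i v* G - (\<Sum>j<N+1. A i j *\<^sub>R k j) = Y i"
    using sylvester_solvable[OF Q neg \<open>\<delta> > 0\<close> G2 \<open>\<theta> > 0\<close>, of Y] unfolding A_def by blast
  define D where "D i t = E i t - k i \<bullet> p t" for i t
  have Dd: "expdecay (D i)" if "i < N + 1" for i
  proof (rule finite_dim_expdecay[OF Q neg \<open>\<delta> > 0\<close>, of 3 D "\<lambda>i t. l i * \<rho> t"])
    fix i and t :: real assume i: "i < N + 1" and t: "t \<ge> 3"
    have "(E i has_real_derivative (a - (real i * pi)\<^sup>2) * E i t + b i \<bullet> p t + (if i \<le> N then l i else 0) * v t 0) (at t)"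
      by (rule has_integral_imp_deriv[OF modes, of _ 2])
         (use t in \<open>auto intro!: continuous_intros cv continuous_on_subset[OF cE] continuous_on_subset[OF cp]\<close>)
    then have "(D i has_real_derivative (\<mu> i * E i t + b i \<bullet> p t + l i * v t 0) - k i \<bullet> (G *v p t)) (at t)"
      unfolding D_def[abs_def] using i t by (intro DERIV_diff dp) (auto simp: \<mu>_def)
    moreover have "(\<mu> i * E i t + b i \<bullet> p t + l i * v t 0) - k i \<bullet> (G *v p t) = mv (N + 1) A (\<lambda>j. D j t) i + l i * \<rho> t"
    proof -
      have "k i \<bullet> (G *v p t) = (k i v* G) \<bullet> p t" by (simp add: dot_lmul_matrix)
      also have "\<dots> = (\<Sum>j<N+1. A i j * (k j \<bullet> p t)) + Y i \<bullet> p t"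
        using k[OF i] by (simp add: algebra_simps inner_add_left inner_sum_left)
      finally have 1: "k i \<bullet> (G *v p t) = (\<Sum>j<N+1. A i j * (k j \<bullet> p t)) + Y i \<bullet> p t" .
      have "(\<Sum>j<N+1. A i j * E j t) = \<mu> i * E i t + l i * (\<Sum>j<N+1. phi j 0 * E j t)"
      proof -
        have "(\<Sum>j<N+1. Amat a i j * E j t) = \<mu> i * E i t"
          using mv_Amat[OF i, of a "\<lambda>j. E j t"] by (simp add: mv_def \<mu>_def)
        then show ?thesis
          unfolding A_def distrib_right sum.distrib by (simp only: sum_distrib_left Cvec_def mult.assoc)
      qed
      then have 2: "mv (N + 1) A (\<lambda>j. D j t) i = \<mu> i * E i t + l i * (\<Sum>j<N+1. phi j 0 * E j t) - (\<Sum>j<N+1. A i j * (k j \<bullet> p t))"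
        unfolding mv_def D_def right_diff_distrib sum_subtractf by simp
      show ?thesis unfolding 1 2 e0[of t, OF order_trans[OF _ t], simplified] Y_def
        by (simp add: inner_add_left algebra_simps)
    qed
    ultimately show "(D i has_real_derivative mv (N + 1) (\<lambda>i j. Amat a i j + l i * Cvec j) (\<lambda>j. D j t) i + l i * \<rho> t) (at t)"
      by (simp add: A_def)
  qed (use \<rho>d that in auto)
  show thesis
  proof (rule that[OF _ cv])
    have "expdecay (\<lambda>t. (\<Sum>j<N+1. phi j 0 * D j t) + \<rho> t)"
      by (intro expdecay_add expdecay_sum expdecay_cmult \<rho>d Dd) simp
    then show "expdecay (\<lambda>t. v t 0 - ((\<Sum>j<N+1. phi j 0 *\<^sub>R k j) + c\<zeta>) \<bullet> p t)"
      by (rule expdecay_cong[of _ 2])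
         (simp only: e0 D_def inner_add_left inner_sum_left inner_scaleR_left right_diff_distrib sum_subtractf algebra_simps)
  qed
qed

text \<open>The input involves only the first N + 1 modes, which therefore form a closed delay
  system, governed by the matrix inequality. Its solution makes the input a known decaying function,
  to which a higher mode responds with gain 1 / (- \<mu> n - \<alpha>). These gains are summable
  although the coefficients \<open>phi n 1\<close> are not.\<close>

lemma closed_loop_modes_expdecay:
  fixes Z :: "nat \<Rightarrow> real \<Rightarrow> real" and z :: "real \<Rightarrow> real \<Rightarrow> real" and v r :: "real \<Rightarrow> real"
  assumes P1: "posdef (N + 1) P1" and S: "posdef (N + 1) S" and R: "posdef (N + 1) R"
    and neg: "negdef (3 * (N + 1)) (Phi a N k \<delta> \<tau> P1 P2 P3 S R)"
    and "\<delta> > 0" "\<tau> > 0" and tail: "\<forall>n>N. a - (real n * pi)\<^sup>2 < - \<delta>"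
    and dZ: "\<And>n t. t \<ge> T \<Longrightarrow> (Z n has_real_derivative (a - (real n * pi)\<^sup>2) * Z n t
        + phi n 1 * ((\<Sum>j\<le>N. k j * Z j (t - \<tau>)) + v t) - (if n \<le> N then l n else 0) * r t) (at t)"
    and v: "expdecay v" "continuous_on {T..} v" and r: "expdecay r" "continuous_on {T..} r"
    and z: "\<And>t. t \<ge> T \<Longrightarrow> continuous_on {0..1} (z t)"
    and Zz: "\<And>n t. t \<ge> T \<Longrightarrow> ip01 (z t) (phi n) = Z n t"
  shows "expdecay (\<lambda>t. z t 0)"
proof -
  define \<mu> where "\<mu> n = a - (real n * pi)\<^sup>2" for n :: nat
  have \<mu>: "\<mu> n < - \<delta>" if "n > N" for n using tail that by (simp add: \<mu>_def)
  have cZ: "continuous_on {T..} (Z n)" for n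
    by (intro continuous_at_imp_continuous_on ballI, rule DERIV_isCont[OF dZ]) simp
  have cZ\<tau>: "continuous_on {T + \<tau>..} (\<lambda>t. Z n (t - \<tau>))" for n
    by (rule continuous_on_compose2[OF cZ]) (auto intro!: continuous_intros)
  define u where "u t = (\<Sum>j\<le>N. k j * Z j (t - \<tau>)) + v t" for t
  have Zd: "expdecay (Z i)" if "i < N + 1" for i
  proof (rule delay_lmi_expdecay[OF P1 S R neg \<open>\<delta> > 0\<close> \<open>\<tau> > 0\<close>, where T="T + \<tau>"
        and X'="\<lambda>i t. \<mu> i * Z i t + phi i 1 * u t - l i * r t" and g="\<lambda>i t. phi i 1 * v t - l i * r t"])
    fix i and t :: real assume i: "i < N + 1" and t: "t \<ge> T + \<tau>"
    show "(Z i has_real_derivative \<mu> i * Z i t + phi i 1 * u t - l i * r t) (at t)"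
      using dZ[of t i] i t \<open>\<tau> > 0\<close> by (simp add: \<mu>_def u_def)
    have "mv (N + 1) (Amat a) (\<lambda>j. Z j t) i = \<mu> i * Z i t"
      unfolding \<mu>_def by (rule mv_Amat[OF i])
    moreover have "mv (N + 1) (\<lambda>i j. Bvec i * k j) (\<lambda>j. Z j (t - \<tau>)) i = phi i 1 * (\<Sum>j\<le>N. k j * Z j (t - \<tau>))"
      unfolding mv_def Bvec_def by (simp add: sum_distrib_left mult.assoc lessThan_Suc_atMost)
    ultimately show "\<mu> i * Z i t + phi i 1 * u t - l i * r t = mv (N + 1) (Amat a) (\<lambda>j. Z j t) i
        + mv (N + 1) (\<lambda>i j. Bvec i * k j) (\<lambda>j. Z j (t - \<tau>)) i + (phi i 1 * v t - l i * r t)"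
      by (simp add: u_def algebra_simps)
  next
    fix i
    show "continuous_on {T + \<tau>..} (\<lambda>t. \<mu> i * Z i t + phi i 1 * u t - l i * r t)"
      unfolding u_def using \<open>\<tau> > 0\<close>
      by (intro continuous_intros cZ\<tau> continuous_on_subset[OF cZ] continuous_on_subset[OF v(2)] continuous_on_subset[OF r(2)]) auto
  qed (use v r that in auto)
  have "expdecay u" unfolding u_def[abs_def]
    by (intro expdecay_add expdecay_sum expdecay_cmult v expdecay_shift Zd) simp
  \<comment> \<open>A rate below \<delta> stays below - \<mu> n for every n > N, so each of these
    modes is faster than its input.\<close>
  then obtain \<alpha> K T2 where u: "0 < \<alpha>" "\<alpha> < \<delta>" "K \<ge> 0" "T2 \<ge> T" "\<And>t. t \<ge> T2 \<Longrightarrow> norm (u t) \<le> K * exp (- \<alpha> * t)"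
    by (rule expdecayE[OF _ \<open>\<delta> > 0\<close>, where Tm=T]) blast
  have "bounded (z T2 ` {0..1})" by (intro compact_imp_bounded compact_continuous_image z u) auto
  then obtain Bz where "\<forall>y\<in>{0..1}. \<bar>z T2 y\<bar> \<le> Bz" by (auto simp: bounded_iff)
  then have Bz: "\<bar>z T2 y\<bar> \<le> Bz" if "y \<in> {0..1}" for y using that by blast
  have Bz0: "Bz \<ge> 0" using Bz[of 0] by simp
  \<comment> \<open>The first term stems from the value at \<open>T2\<close>, where one unit of time
    provides exp (\<mu> n); the second is the response to the input. The absolute value keeps
    \<open>A n\<close> nonnegative at the low indices as well.\<close>
  define A where "A n = exp (\<mu> n) * (Bz * sqrt 2 * exp (\<alpha> * (T2 + 1))) + (sqrt 2 * K) * (1 / \<bar>- \<mu> n - \<alpha>\<bar>)" for n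
  have Zb: "\<bar>Z n t\<bar> \<le> A n * exp (- \<alpha> * t)" if n: "n > N" and t: "t \<ge> T2 + 1" for n t
  proof -
    have m: "- \<mu> n > \<alpha>" using \<mu>[OF n] u by simp
    have "\<bar>Z n t\<bar> \<le> exp (- (- \<mu> n) * (t - T2)) * \<bar>Z n T2\<bar> + (sqrt 2 * K) / (- \<mu> n - \<alpha>) * exp (- \<alpha> * t)"
    proof (rule mode_bound[where g="\<lambda>t. phi n 1 * u t"])
      fix s assume s: "s \<ge> T2"
      show "(Z n has_real_derivative - (- \<mu> n) * Z n s + phi n 1 * u s) (at s)"
        using dZ[of s n] s n u(4) by (simp add: \<mu>_def u_def)
      have "\<bar>phi n 1\<bar> * \<bar>u s\<bar> \<le> sqrt 2 * (K * exp (- \<alpha> * s))"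
        using u(5)[OF s] by (intro mult_mono) (auto simp: phi_abs_le)
      then show "\<bar>phi n 1 * u s\<bar> \<le> sqrt 2 * K * exp (- \<alpha> * s)" by (simp add: abs_mult mult.assoc)
    qed (use m u t in auto)
    also have "exp (- (- \<mu> n) * (t - T2)) * \<bar>Z n T2\<bar> \<le> (exp (\<mu> n) * (exp (\<alpha> * (T2 + 1)) * exp (- \<alpha> * t))) * (Bz * sqrt 2)"
    proof (rule mult_mono)
      have "\<mu> n * (t - T2 - 1) \<le> - \<alpha> * (t - T2 - 1)" using m t by (intro mult_right_mono) auto
      then show "exp (- (- \<mu> n) * (t - T2)) \<le> exp (\<mu> n) * (exp (\<alpha> * (T2 + 1)) * exp (- \<alpha> * t))"
        unfolding exp_add[symmetric] by (simp add: algebra_simps)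
      show "\<bar>Z n T2\<bar> \<le> Bz * sqrt 2" using ip01_phi_bound[OF z[OF u(4)] Bz, of n] Zz[OF u(4), of n] by simp
    qed auto
    finally show ?thesis using m by (simp add: A_def algebra_simps)
  qed
  have A0: "A n \<ge> 0" for n unfolding A_def using Bz0 u by (intro add_nonneg_nonneg mult_nonneg_nonneg) auto
  have sA: "summable A"
    unfolding A_def
  proof (intro summable_add summable_mult summable_mult2)
    have "summable (\<lambda>n. 1 / \<bar>(real n * pi)\<^sup>2 - (a + \<alpha>)\<bar>)" by (rule summable_inverse_eigenvalue)
    moreover have "(real n * pi)\<^sup>2 - (a + \<alpha>) = - \<mu> n - \<alpha>" for n by (simp add: \<mu>_def)
    ultimately show "summable (\<lambda>n. 1 / \<bar>- \<mu> n - \<alpha>\<bar>)" by (simp only:)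
    show "summable (\<lambda>n. exp (\<mu> n))"
      unfolding \<mu>_def by (rule summable_exp_eigenvalue[of N]) (use tail \<open>\<delta> > 0\<close> in force)
  qed
  define tl where "tl t = (\<Sum>n. Z (n + (N + 1)) t * phi (n + (N + 1)) 0)" for t
  have sZ: "summable (\<lambda>n. \<bar>Z n t\<bar>)" if t: "t \<ge> T2 + 1" for t
    by (rule summable_comparison_test'[OF summable_mult2[OF sA, of "exp (- \<alpha> * t)"], where N="N + 1"]) (use Zb t in auto)
  have split: "z t 0 = (\<Sum>n<N+1. Z n t * phi n 0) + tl t" if t: "t \<ge> T2 + 1" for t
  proof -
    have tT: "t \<ge> T" using t u(4) by simp
    have s: "(\<lambda>n. Z n t * phi n 0) sums z t 0"
      using fourier_sums[OF z[OF tT], of 0] Zz[OF tT] sZ[OF t] by simp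
    show ?thesis unfolding tl_def
      using suminf_split_initial_segment[OF sums_summable[OF s], of "N + 1"] sums_unique[OF s] by simp
  qed
  have "expdecay tl"
  proof (rule expdecayI[OF u(1), of "T2 + 1" _ "(\<Sum>n. A (n + (N + 1))) * sqrt 2"])
    fix t assume t: "t \<ge> T2 + 1"
    have sA': "summable (\<lambda>n. A (n + (N + 1)))" using sA by (rule summable_ignore_initial_segment)
    have "norm (tl t) \<le> (\<Sum>n. A (n + (N + 1)) * (sqrt 2 * exp (- \<alpha> * t)))"
      unfolding tl_def
    proof (rule norm_suminf_le)
      fix n
      have "\<bar>Z (n + (N + 1)) t\<bar> * \<bar>phi (n + (N + 1)) 0\<bar> \<le> (A (n + (N + 1)) * exp (- \<alpha> * t)) * sqrt 2"
        using Zb[of "n + (N + 1)" t] t A0 by (intro mult_mono) (auto simp: phi_abs_le)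
      then show "norm (Z (n + (N + 1)) t * phi (n + (N + 1)) 0) \<le> A (n + (N + 1)) * (sqrt 2 * exp (- \<alpha> * t))"
        by (simp add: abs_mult algebra_simps)
    qed (intro summable_mult2 sA')
    also have "\<dots> = (\<Sum>n. A (n + (N + 1))) * (sqrt 2 * exp (- \<alpha> * t))" by (rule suminf_mult2[OF sA', symmetric])
    finally show "norm (tl t) \<le> (\<Sum>n. A (n + (N + 1))) * sqrt 2 * exp (- \<alpha> * t)" by (simp add: mult.assoc)
  qed
  then have "expdecay (\<lambda>t. (\<Sum>n<N+1. Z n t * phi n 0) + tl t)"
    by (intro expdecay_add expdecay_sum expdecay_multc Zd) auto
  then show ?thesis by (rule expdecay_cong) (rule split)
qed

section \<open>The closed loop\<close>

lemma loclip_compose: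
  assumes "loclip g" "loclip h"
  shows "loclip (\<lambda>x. g (h x))"
proof (rule loclipI)
  fix B :: real
  obtain C where C: "\<And>x. \<bar>x\<bar> \<le> B \<Longrightarrow> norm (h x) \<le> C"
    by (rule loclip_bounded[OF assms(2), of B]) blast
  obtain L1 where L1: "L1 \<ge> 0" "\<And>x y. \<bar>x\<bar> \<le> C \<Longrightarrow> \<bar>y\<bar> \<le> C \<Longrightarrow> norm (g x - g y) \<le> L1 * \<bar>x - y\<bar>"
    by (rule loclipE[OF assms(1), of C]) blast
  obtain L2 where L2: "\<And>x y. \<bar>x\<bar> \<le> B \<Longrightarrow> \<bar>y\<bar> \<le> B \<Longrightarrow> norm (h x - h y) \<le> L2 * \<bar>x - y\<bar>"
    by (rule loclipE[OF assms(2), of B]) blast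
  have "norm (g (h x) - g (h y)) \<le> (L1 * L2) * \<bar>x - y\<bar>" if xy: "\<bar>x\<bar> \<le> B" "\<bar>y\<bar> \<le> B" for x y
  proof -
    have "norm (g (h x) - g (h y)) \<le> L1 * \<bar>h x - h y\<bar>" using C[OF xy(1)] C[OF xy(2)] by (intro L1) auto
    also have "\<dots> \<le> L1 * (L2 * \<bar>x - y\<bar>)" using L2[OF xy] L1(1) by (intro mult_left_mono) auto
    finally show ?thesis by (simp add: mult.assoc)
  qed
  then show "\<exists>L. \<forall>x y. \<bar>x\<bar> \<le> B \<longrightarrow> \<bar>y\<bar> \<le> B \<longrightarrow> norm (g (h x) - g (h y)) \<le> L * \<bar>x - y\<bar>" by blast
qed

text \<open>The difference is split at \<psi> (th) x0. In the first part x - x0 decays against a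
  bounded factor. In the second either the estimate converges and the Lipschitz bound applies, or x0
  vanishes from \<open>T\<close> on and the whole term with it.\<close>

lemma loclip_product_expdecay:
  fixes \<psi> :: "real \<Rightarrow> real" and x x0 th :: "real \<Rightarrow> real"
  assumes \<psi>: "loclip \<psi>" and th: "evbounded th" and x: "expdecay (\<lambda>t. x t - x0 t)" and x0: "evbounded x0"
    and alt: "expdecay (\<lambda>t. th t - \<theta>) \<or> (\<forall>t\<ge>T. x0 t = 0)"
  shows "expdecay (\<lambda>t. \<psi> (th t) * x t - \<psi> \<theta> * x0 t)"
proof -
  obtain B T1 where B: "B > 0" "\<And>t. t \<ge> T1 \<Longrightarrow> norm (th t) \<le> B"
    by (rule evboundedE[OF th]) blast
  obtain C where C: "\<And>x. \<bar>x\<bar> \<le> B \<Longrightarrow> norm (\<psi> x) \<le> C"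
    by (rule loclip_bounded[OF \<psi>, of B]) blast
  have b: "evbounded (\<lambda>t. \<psi> (th t))" by (rule evboundedI[of T1 _ C]) (use B C in auto)
  have 1: "expdecay (\<lambda>t. (x t - x0 t) * \<psi> (th t))" by (rule expdecay_mult_bounded[OF x b])
  have 2: "expdecay (\<lambda>t. (\<psi> (th t) - \<psi> \<theta>) * x0 t)"
    using alt
  proof
    assume e: "expdecay (\<lambda>t. th t - \<theta>)"
    obtain L where L: "\<And>x y. \<bar>x\<bar> \<le> B + \<bar>\<theta>\<bar> \<Longrightarrow> \<bar>y\<bar> \<le> B + \<bar>\<theta>\<bar> \<Longrightarrow> norm (\<psi> x - \<psi> y) \<le> L * \<bar>x - y\<bar>"
      by (rule loclipE[OF \<psi>, of "B + \<bar>\<theta>\<bar>"]) blast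
    have "expdecay (\<lambda>t. \<psi> (th t) - \<psi> \<theta>)"
    proof (rule expdecay_mono[OF e])
      fix t assume "t \<ge> T1"
      then show "norm (\<psi> (th t) - \<psi> \<theta>) \<le> L * norm (th t - \<theta>)"
        using B(2)[of t] B(1) by (simp del: real_norm_def add: real_norm_def[symmetric]) (use L[of "th t" \<theta>] in auto)
    qed
    then show ?thesis by (rule expdecay_mult_bounded[OF _ x0])
  next
    assume "\<forall>t\<ge>T. x0 t = 0"
    then show ?thesis by (intro expdecay_cong[OF expdecay_zero, of T]) auto
  qed
  show ?thesis by (rule expdecay_cong[OF expdecay_add[OF 1 2], of 0]) (simp add: algebra_simps)
qed

lemma norm_ipv01_phi_le:
  assumes "\<And>x. x \<in> {0..1} \<Longrightarrow> norm (g x) \<le> B"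
  shows "norm (ipv01 g (phi n)) \<le> sqrt 2 * B"
proof (cases "(\<lambda>x. phi n x *\<^sub>R g x) integrable_on {0..1}")
  case True
  have "norm (integral {0..1} (\<lambda>x. phi n x *\<^sub>R g x)) \<le> integral {0..1} (\<lambda>x::real. sqrt 2 * B)"
  proof (rule Henstock_Kurzweil_Integration.integral_norm_bound_integral[OF True])
    fix x :: real assume "x \<in> {0..1}"
    then show "norm (phi n x *\<^sub>R g x) \<le> sqrt 2 * B"
      unfolding norm_scaleR using assms by (intro mult_mono) (auto simp: phi_abs_le)
  qed auto
  then show ?thesis by (simp add: ipv01_def)
next
  case False
  \<comment> \<open>The \<open>integral\<close> of a non-integrable function is 0 by convention, so
    only the sign of \<open>B\<close> matters here; it follows from the bound at x = 0.\<close>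
  have "B \<ge> 0" using order_trans[OF norm_ge_zero assms[of 0]] by simp
  then show ?thesis using False by (simp add: ipv01_def not_integrable_integral)
qed

lemma inner_vector_2: "x \<bullet> (vector [s, t] :: real^2) = x $ 1 * s + x $ 2 * t"
  by (simp add: inner_vec_def sum_2)

lemma (in regulator_profile) ip01_inner:
  "ip01 (\<lambda>x. f x th \<bullet> d) (phi n) = ipv01 (\<lambda>x. f x th) (phi n) \<bullet> d"
proof -
  have "integral {0..1} (\<lambda>x. (phi n x *\<^sub>R f x th) \<bullet> d) = integral {0..1} (\<lambda>x. phi n x *\<^sub>R f x th) \<bullet> d"
    by (rule integral_component_eq[OF f_phi_integrable])
  then show ?thesis by (simp add: ip01_def ipv01_def mult.commute)
qed

text \<open>The row vector that multiplies the estimate of d in the control. At the true \<theta>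
  and the true d it makes U(t - \<tau>) + f'(1) d(t) equal to the feedback of the shifted modes at
  time t - \<tau>, as f'(1) is paired with d propagated over the delay.\<close>

definition (in regulator_profile) control_gain :: "(nat \<Rightarrow> real) \<Rightarrow> real \<Rightarrow> real \<Rightarrow> real^2" where
  "control_gain k \<tau> th = (\<Sum>n\<le>N. k n *\<^sub>R ipv01 (\<lambda>x. f x th) (phi n)) - f' 1 th v* mexp (\<tau> *\<^sub>R Sc th)"

lemma (in regulator_profile) loclip_control_gain: "loclip (control_gain k \<tau>)"
proof -
  have "f' 1 th v* mexp (\<tau> *\<^sub>R Sc th) = cosh_sqrt (- (th * \<tau>\<^sup>2)) *\<^sub>R f' 1 th
      + (\<tau> * sinhc_sqrt (- (th * \<tau>\<^sup>2))) *\<^sub>R (f' 1 th v* Sc th)" for th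
    unfolding mexp_Sc
    by (simp add: vec_eq_iff forall_2 vector_matrix_mult_def sum_2 mat_def Sc_def algebra_simps)
  then have eq: "control_gain k \<tau> = (\<lambda>th. (\<Sum>n\<le>N. k n *\<^sub>R ipv01 (\<lambda>x. f x th) (phi n)) -
      (cosh_sqrt (- (th * \<tau>\<^sup>2)) *\<^sub>R f' 1 th + (\<tau> * sinhc_sqrt (- (th * \<tau>\<^sup>2))) *\<^sub>R (f' 1 th v* Sc th)))"
    by (simp add: control_gain_def fun_eq_iff)
  have u: "loclip (\<lambda>th. - (th * \<tau>\<^sup>2))"
    using loclip_bounded_bilinear[OF bounded_bilinear_mult loclip_ident loclip_const[of "- \<tau>\<^sup>2"]] by simp
  note sc = loclip_bounded_bilinear[OF bounded_bilinear_scaleR]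
  show ?thesis unfolding eq
    by (intro loclip_diff loclip_add loclip_sum sc loclip_const loclip_modes loclip_f'1 loclip_vec_mult_Sc
        loclip_bounded_bilinear[OF bounded_bilinear_mult] loclip_compose[OF loclip_cosh_sqrt u] loclip_compose[OF loclip_sinhc_sqrt u])
qed

text \<open>The partial differential equations enter through their cosine moments, integrated in
  time: testing with \<open>phi n\<close> turns the boundary inputs into terms with the factors
  \<open>phi n 1\<close> and \<open>phi n 0\<close>. Continuity in x at positive times gives a
  meaning to the traces at x = 0.\<close>

theorem theorem2:
  fixes a \<tau> \<delta> \<iota> \<mu>0 \<mu>1 :: real
    and d1 :: "real \<Rightarrow> real^2" and d2 d3 d4 :: "real^2" and G :: "real^2^2"
    and N :: nat and k l :: "nat \<Rightarrow> real"
    and f f' :: "real \<Rightarrow> real \<Rightarrow> real^2"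
    and w eh :: "real \<Rightarrow> real \<Rightarrow> real"
    and p :: "real \<Rightarrow> real^2"
    and \<xi> \<chi>1 \<phi>h \<theta>h U :: "real \<Rightarrow> real"
  assumes tau_pos: "\<tau> > 0"
    and d1_Linf: "Linf_01 d1"
    and G_spec: "\<exists>\<omega>>0. cspectrum G = {\<i> * complex_of_real \<omega>, - \<i> * complex_of_real \<omega>}"
    and delta_pos: "\<delta> > 0"
    and N_tail: "\<forall>n>N. a - (real n * pi)\<^sup>2 < - \<delta>"
    and LMI: "\<exists>P1 P2 P3 S R Q :: nat \<Rightarrow> nat \<Rightarrow> real.
        posdef (N+1) P1 \<and> posdef (N+1) S \<and> posdef (N+1) R \<and> posdef (N+1) Q \<and>
        negdef (3 * (N+1)) (Phi a N k \<delta> \<tau> P1 P2 P3 S R) \<and>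
        negdef (N+1) (\<lambda>i j. let ALC = (\<lambda>i j. Amat a i j + l i * Cvec j) in
             mmul (N+1) Q ALC i j + mmul (N+1) (mtr ALC) Q i j + 2 * \<delta> * Q i j)"
    and gains: "\<iota> > 0" "\<mu>0 > 1 / (4 * \<iota>)" "\<mu>1 > 0"
    \<comment> \<open>f(.,theta) solves f'' = f S_c(theta) - a f - L(x) f(0), f'(0) = 0, f(0) = gamma_c on [0,1];
        f' is its x-derivative\<close>
    and f_ode: "\<And>th x. x \<in> {0..1} \<Longrightarrow>
        ((\<lambda>y. f y th) has_vector_derivative f' x th) (at x within {0..1}) \<and>
        ((\<lambda>y. f' y th) has_vector_derivative
           (f x th v* Sc th - a *\<^sub>R f x th - (\<Sum>n\<le>N. l n * phi n x) *\<^sub>R f 0 th)) (at x within {0..1})"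
    and f_init: "\<And>th. f' 0 th = 0" "\<And>th. f 0 th = gamma_c"
    \<comment> \<open>initial data of the PDE states in L2(0,1)\<close>
    and w0_L2: "L2_01 (\<lambda>x. w x 0)" and eh0_L2: "L2_01 (\<lambda>x. eh x 0)"
    \<comment> \<open>(weak) solution of the closed-loop system for t \<ge> 0\<close>
    and w_L2: "\<And>t. t \<ge> 0 \<Longrightarrow> L2_01 (\<lambda>x. w x t)"
    and w_cont: "\<And>t. t > 0 \<Longrightarrow> continuous_on {0..1} (\<lambda>x. w x t)"
    and w_modes: "\<And>n t. t \<ge> 0 \<Longrightarrow>
        ((\<lambda>s. (a - (real n * pi)\<^sup>2) * ip01 (\<lambda>x. w x s) (phi n)
              + phi n 1 * (U (s - \<tau>) + d3 \<bullet> p s) - phi n 0 * (d2 \<bullet> p s)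
              + ipv01 d1 (phi n) \<bullet> p s)
          has_integral (ip01 (\<lambda>x. w x t) (phi n) - ip01 (\<lambda>x. w x 0) (phi n))) {0..t}"
    and p_ode: "\<And>t. t \<ge> 0 \<Longrightarrow> (p has_vector_derivative (G *v p t)) (at t within {0..})"
    and eh_L2: "\<And>t. t \<ge> 0 \<Longrightarrow> L2_01 (\<lambda>x. eh x t)"
    and eh_cont: "\<And>t. t > 0 \<Longrightarrow> continuous_on {0..1} (\<lambda>x. eh x t)"
    and eh_modes: "\<And>n t. t \<ge> 0 \<Longrightarrow>
        ((\<lambda>s. (a - (real n * pi)\<^sup>2) * ip01 (\<lambda>x. eh x s) (phi n)
              + phi n 1 * U (s - \<tau>)
              + ip01 (\<lambda>x. \<Sum>j\<le>N. l j * phi j x) (phi n) * (eh 0 s - (w 0 s - d4 \<bullet> p s)))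
          has_integral (ip01 (\<lambda>x. eh x t) (phi n) - ip01 (\<lambda>x. eh x 0) (phi n))) {0..t}"
    and xi_ode: "\<And>t. t \<ge> 0 \<Longrightarrow>
        ((\<lambda>s. - \<iota> * \<xi> s - ((w 0 s - d4 \<bullet> p s) - eh 0 s)) has_integral (\<xi> t - \<xi> 0)) {0..t}"
    and chi_ode: "\<And>t. t \<ge> 0 \<Longrightarrow>
        ((\<lambda>s. \<phi>h s + \<iota> * ((w 0 s - d4 \<bullet> p s) - eh 0 s) + \<theta>h s * \<xi> s
              + \<mu>0 * (((w 0 s - d4 \<bullet> p s) - eh 0 s) - \<chi>1 s)) has_integral (\<chi>1 t - \<chi>1 0)) {0..t}"
    and phi_ode: "\<And>t. t \<ge> 0 \<Longrightarrow>
        ((\<lambda>s. - \<iota> * \<phi>h s - \<iota>\<^sup>2 * ((w 0 s - d4 \<bullet> p s) - eh 0 s)) has_integral (\<phi>h t - \<phi>h 0)) {0..t}"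
    and theta_ode: "\<And>t. t \<ge> 0 \<Longrightarrow>
        ((\<lambda>s. \<mu>1 * \<xi> s * (((w 0 s - d4 \<bullet> p s) - eh 0 s) - \<chi>1 s)) has_integral (\<theta>h t - \<theta>h 0)) {0..t}"
    and U_neg: "\<And>s. s < 0 \<Longrightarrow> U s = 0"
    and U_def: "\<And>t. t \<ge> 0 \<Longrightarrow>
        U t = (let dh = vector [\<chi>1 t, \<phi>h t + \<xi> t * \<theta>h t + \<iota> * \<chi>1 t] :: real^2 in
                 (\<Sum>n\<le>N. k n * ip01 (\<lambda>x. eh x t) (phi n))
               + (\<Sum>n\<le>N. k n *\<^sub>R ipv01 (\<lambda>x. f x (\<theta>h t)) (phi n)) \<bullet> dh
               - f' 1 (\<theta>h t) \<bullet> (mexp (\<tau> *\<^sub>R Sc (\<theta>h t)) *v dh))"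
  shows "((\<lambda>t. \<bar>w 0 t - d4 \<bullet> p t\<bar>) \<longlongrightarrow> 0) at_top \<and>
         (\<exists>\<alpha>>0. \<exists>M T. \<forall>t\<ge>T. \<bar>w 0 t - d4 \<bullet> p t\<bar> \<le> M * exp (- \<alpha> * t))"
proof -
  obtain \<omega> where \<omega>: "\<omega> > 0" "cspectrum G = {\<i> * complex_of_real \<omega>, - \<i> * complex_of_real \<omega>}"
    using G_spec by blast
  define \<theta> where "\<theta> = \<omega>\<^sup>2"
  have \<theta>: "\<theta> > 0" using \<omega> by (simp add: \<theta>_def)
  have G2: "G *v (G *v u) = - \<theta> *\<^sub>R u" for u unfolding \<theta>_def by (rule cspectrum_imaginary_square[OF \<omega>])
  obtain P1 P2 P3 S R Q where P1: "posdef (N+1) P1" and S: "posdef (N+1) S" and R: "posdef (N+1) R"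
    and Q: "posdef (N+1) Q" and Phi_neg: "negdef (3 * (N+1)) (Phi a N k \<delta> \<tau> P1 P2 P3 S R)"
    and Q_neg: "negdef (N + 1) (\<lambda>i j. mmul (N + 1) Q (\<lambda>i j. Amat a i j + l i * Cvec j) i j
        + mmul (N + 1) (mtr (\<lambda>i j. Amat a i j + l i * Cvec j)) Q i j + 2 * \<delta> * Q i j)"
    using LMI unfolding Let_def by blast
  interpret regulator_profile a N l f f' by unfold_locales (use f_ode f_init in blast)+

  \<comment> \<open>Modes of plant, observer and observer error\<close>
  define W H where "W n t = ip01 (\<lambda>x. w x t) (phi n)" and "H n t = ip01 (\<lambda>x. eh x t) (phi n)" for n t
  define L where "L n = (if n \<le> N then l n else 0)" for n
  define yd where "yd t = (w 0 t - d4 \<bullet> p t) - eh 0 t" for t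
  \<comment> \<open>All the ways in which \<open>p\<close> drives the n-th mode of the observer
    error. The last term is there because the observer injects the tracking error rather than w(0,
    t).\<close>
  define b where "b n = phi n 1 *\<^sub>R d3 - phi n 0 *\<^sub>R d2 + ipv01 d1 (phi n) - L n *\<^sub>R d4" for n
  have Lip: "ip01 (\<lambda>x. \<Sum>j\<le>N. l j * phi j x) (phi n) = L n" for n by (simp add: ip01_sum_phi L_def)
  have H_int: "((\<lambda>s. (a - (real n * pi)\<^sup>2) * H n s + phi n 1 * U (s - \<tau>) - L n * yd s)
      has_integral (H n t - H n 0)) {0..t}" if "t \<ge> 0" for n t
    using eh_modes[OF that, of n] unfolding H_def Lip yd_def by (simp add: algebra_simps)
  have E_int: "((\<lambda>s. (a - (real n * pi)\<^sup>2) * (W n s - H n s) + b n \<bullet> p s + (if n \<le> N then l n else 0) * (w 0 s - eh 0 s))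
      has_integral ((W n t - H n t) - (W n 0 - H n 0))) {0..t}" if "t \<ge> 0" for n t
    using has_integral_diff[OF w_modes[OF that, of n] eh_modes[OF that, of n]]
    unfolding Lip L_def[symmetric] b_def W_def H_def inner_diff_left inner_add_left inner_scaleR_left
    by (simp add: algebra_simps)
  obtain B1 where B1: "\<And>x. x \<in> {0..1} \<Longrightarrow> norm (d1 x) \<le> B1" using d1_Linf unfolding Linf_01_def by blast
  have b_bound: "norm (b n) \<le> sqrt 2 * norm d3 + sqrt 2 * norm d2 + sqrt 2 * B1 + (\<Sum>j\<le>N. \<bar>l j\<bar>) * norm d4" for n
  proof -
    have 1: "norm (phi n 1 *\<^sub>R d3) \<le> sqrt 2 * norm d3" "norm (phi n 0 *\<^sub>R d2) \<le> sqrt 2 * norm d2"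
      by (simp_all add: phi_abs_le mult_right_mono)
    have "\<bar>L n\<bar> \<le> (\<Sum>j\<le>N. \<bar>l j\<bar>)"
      unfolding L_def by (cases "n \<le> N") (auto intro: member_le_sum sum_nonneg)
    then have 2: "norm (L n *\<^sub>R d4) \<le> (\<Sum>j\<le>N. \<bar>l j\<bar>) * norm d4" by (simp add: mult_right_mono)
    have 3: "norm (ipv01 d1 (phi n)) \<le> sqrt 2 * B1" by (rule norm_ipv01_phi_le[OF B1])
    have "norm (b n) \<le> norm (phi n 1 *\<^sub>R d3) + norm (phi n 0 *\<^sub>R d2) + norm (ipv01 d1 (phi n)) + norm (L n *\<^sub>R d4)"
      unfolding b_def
      using norm_triangle_ineq4[of "phi n 1 *\<^sub>R d3 - phi n 0 *\<^sub>R d2 + ipv01 d1 (phi n)" "L n *\<^sub>R d4"]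
        norm_triangle_ineq[of "phi n 1 *\<^sub>R d3 - phi n 0 *\<^sub>R d2" "ipv01 d1 (phi n)"]
        norm_triangle_ineq4[of "phi n 1 *\<^sub>R d3" "phi n 0 *\<^sub>R d2"] by linarith
    then show ?thesis using 1 2 3 by linarith
  qed
  obtain q0 where q0: "expdecay (\<lambda>t. (w 0 t - eh 0 t) - q0 \<bullet> p t)" and ce: "continuous_on {2..} (\<lambda>t. w 0 t - eh 0 t)"
  proof (rule observer_error_asymptotics[OF Q Q_neg delta_pos N_tail G2 \<theta> p_ode b_bound, where v="\<lambda>t x. w x t - eh x t" and E="\<lambda>n t. W n t - H n t"])
    show "continuous_on {0..1} (\<lambda>x. w x t - eh x t)" if "t > 0" for t
      by (intro continuous_intros w_cont eh_cont that)
    show "ip01 (\<lambda>x. w x t - eh x t) (phi n) = W n t - H n t" if "t > 0" for n t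
      unfolding W_def H_def by (intro ip01_diff_left w_cont eh_cont that continuous_on_phi)
    show "((\<lambda>s. (a - (real n * pi)\<^sup>2) * (W n s - H n s) + b n \<bullet> p s + (if n \<le> N then l n else 0) * (w 0 s - eh 0 s))
      has_integral ((W n t - H n t) - (W n 0 - H n 0))) {0..t}" if "t \<ge> 0" for n t
      by (rule E_int[OF that])
  qed auto

  \<comment> \<open>The asymptotic sinusoid in \<open>yd\<close> and its estimation\<close>
  have cp: "continuous_on {0..} p"
    by (rule has_vector_derivative_imp_continuous_on[OF p_ode]) simp
  have dp: "((\<lambda>t. u \<bullet> p t) has_real_derivative u \<bullet> (G *v p t)) (at t)" if "t > 0" for u t
    using exosystem_inner_deriv[of p G t u] p_ode that by blast
  \<comment> \<open>\<open>yd\<close> contains the reference as well, hence the shift by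
    \<open>d4\<close>.\<close>
  define q where "q = q0 - d4"
  define e1 where "e1 t = q \<bullet> p t" for t
  define e2 where "e2 t = q \<bullet> (G *v p t)" for t
  have de1: "(e1 has_real_derivative e2 t) (at t)" if "t \<ge> 3" for t
    unfolding e1_def[abs_def] e2_def using dp that by simp
  have de2: "(e2 has_real_derivative - \<theta> * e1 t) (at t)" if "t \<ge> 3" for t
  proof -
    have "((\<lambda>t. (q v* G) \<bullet> p t) has_real_derivative (q v* G) \<bullet> (G *v p t)) (at t)" using dp that by simp
    then show ?thesis unfolding e2_def[abs_def] e1_def by (simp add: dot_lmul_matrix G2)
  qed
  have "(e2 t)\<^sup>2 + \<theta> * (e1 t)\<^sup>2 = (e2 3)\<^sup>2 + \<theta> * (e1 3)\<^sup>2" if "t \<ge> 3" for t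
    by (rule oscillator_energy[OF de1 de2 that])
  then have bnd: "evbounded e1" "evbounded e2"
    using oscillator_bounded[of 3 e2 \<theta> e1 "(e2 3)\<^sup>2 + \<theta> * (e1 3)\<^sup>2"] \<theta> by blast+
  define r where "r t = yd t - e1 t" for t
  have r: "expdecay r"
    using q0 unfolding r_def[abs_def] yd_def e1_def q_def by (simp add: algebra_simps inner_diff_left)
  have ce1: "continuous_on {0..} e1" "continuous_on {0..} e2"
    unfolding e1_def[abs_def] e2_def[abs_def]
    by (intro continuous_intros cp bounded_linear.continuous_on[OF matrix_vector_mul_bounded_linear])+
  \<comment> \<open>With this the right-hand sides of the adaptive observer are continuous from time
    2 on, so its integral equations can be differentiated at all later times; the derivatives are
    used from time 3 on.\<close>
  have cyd: "continuous_on {2..} yd"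
  proof -
    have "continuous_on {2..} (\<lambda>t. (w 0 t - eh 0 t) - d4 \<bullet> p t)"
      by (intro continuous_intros ce continuous_on_subset[OF cp]) auto
    then show ?thesis unfolding yd_def[abs_def] by (simp add: algebra_simps)
  qed
  have c\<xi>: "continuous_on {0..} \<xi>" by (rule has_integral_imp_continuous[OF xi_ode])
  have c\<chi>: "continuous_on {0..} \<chi>1" by (rule has_integral_imp_continuous[OF chi_ode])
  have c\<phi>: "continuous_on {0..} \<phi>h" by (rule has_integral_imp_continuous[OF phi_ode])
  have c\<theta>: "continuous_on {0..} \<theta>h" by (rule has_integral_imp_continuous[OF theta_ode])
  have cH: "continuous_on {0..} (H n)" for n by (rule has_integral_imp_continuous[OF H_int])
  note c2 = continuous_on_subset[OF c\<xi>] continuous_on_subset[OF c\<chi>] continuous_on_subset[OF c\<phi>] continuous_on_subset[OF c\<theta>]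
  define D where "D t = \<phi>h t + \<xi> t * \<theta>h t + \<iota> * \<chi>1 t" for t
  have \<mu>0: "\<mu>0 > 0" using gains by (smt (verit) divide_pos_pos zero_less_mult_iff)
  have obs: "evbounded \<theta>h" "expdecay (\<lambda>t. \<chi>1 t - e1 t)" "expdecay (\<lambda>t. D t - e2 t)"
    "expdecay (\<lambda>t. \<theta>h t - \<theta>) \<or> (\<forall>t\<ge>3. e1 t = 0 \<and> e2 t = 0)"
  proof -
    have 1: "(\<xi> has_real_derivative - \<iota> * \<xi> t - yd t) (at t)" if "t \<ge> 3" for t
      by (rule has_integral_imp_deriv[OF xi_ode[folded yd_def], where T=2])
         (use that in \<open>auto intro!: continuous_intros c2 cyd\<close>)
    have 2: "(\<chi>1 has_real_derivative \<phi>h t + \<iota> * yd t + \<theta>h t * \<xi> t + \<mu>0 * (yd t - \<chi>1 t)) (at t)" if "t \<ge> 3" for t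
      by (rule has_integral_imp_deriv[OF chi_ode[folded yd_def], where T=2])
         (use that in \<open>auto intro!: continuous_intros c2 cyd\<close>)
    have 3: "(\<phi>h has_real_derivative - \<iota> * \<phi>h t - \<iota>\<^sup>2 * yd t) (at t)" if "t \<ge> 3" for t
      by (rule has_integral_imp_deriv[OF phi_ode[folded yd_def], where T=2])
         (use that in \<open>auto intro!: continuous_intros c2 cyd\<close>)
    have 4: "(\<theta>h has_real_derivative \<mu>1 * \<xi> t * (yd t - \<chi>1 t)) (at t)" if "t \<ge> 3" for t
      by (rule has_integral_imp_deriv[OF theta_ode[folded yd_def], where T=2])
         (use that in \<open>auto intro!: continuous_intros c2 cyd\<close>)
    note conv = adaptive_observer_convergence[OF gains(1) \<mu>0 gains(3) \<theta> de1 de2 r[unfolded r_def[abs_def]] 1 2 3 4]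
    show "evbounded \<theta>h" "expdecay (\<lambda>t. \<chi>1 t - e1 t)" by (rule conv; assumption)+
    show "expdecay (\<lambda>t. D t - e2 t)" unfolding D_def by (rule conv; assumption)
    show "expdecay (\<lambda>t. \<theta>h t - \<theta>) \<or> (\<forall>t\<ge>3. e1 t = 0 \<and> e2 t = 0)" by (rule conv; assumption)
  qed

  \<comment> \<open>The control and the shifted modes\<close>
  define \<Psi> where "\<Psi> = control_gain k \<tau>"
  have l\<Psi>: "loclip (\<lambda>th. \<Psi> th $ i)" for i
    unfolding \<Psi>_def by (rule loclip_bounded_linear[OF bounded_linear_vec_nth loclip_control_gain])
  have U: "U t = (\<Sum>n\<le>N. k n * H n t) + (\<Psi> (\<theta>h t) $ 1 * \<chi>1 t + \<Psi> (\<theta>h t) $ 2 * D t)" if "t \<ge> 0" for t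
    unfolding U_def[OF that] Let_def H_def[symmetric] D_def[symmetric] \<Psi>_def control_gain_def
      inner_vector_2[symmetric] inner_diff_left dot_lmul_matrix by simp
  have cU: "continuous_on {0..} U"
  proof (rule continuous_on_eq)
    have "continuous_on {0..} (\<lambda>t. \<Psi> (\<theta>h t))"
      unfolding \<Psi>_def by (rule continuous_on_compose2[OF loclip_continuous[OF loclip_control_gain] c\<theta>]) simp
    then show "continuous_on {0..} (\<lambda>t. (\<Sum>n\<le>N. k n * H n t) + (\<Psi> (\<theta>h t) $ 1 * \<chi>1 t + \<Psi> (\<theta>h t) $ 2 * D t))"
      unfolding D_def by (intro continuous_intros cH c\<xi> c\<chi> c\<phi> c\<theta>)
  qed (use U in auto)
  \<comment> \<open>Delayed times t - \<tau> must stay in the range from 3 on, where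
    \<open>e1\<close> and \<open>e2\<close> are known to form an oscillator.\<close>
  define T where "T = \<tau> + 3"
  have cU\<tau>: "continuous_on {\<tau> + 2..} (\<lambda>t. U (t - \<tau>))"
    by (rule continuous_on_compose2[OF cU]) (auto intro!: continuous_intros)
  define m where "m n = ipv01 (\<lambda>x. f x \<theta>) (phi n)" for n
  define d :: "real \<Rightarrow> real^2" where "d t = vector [e1 t, e2 t]" for t
  \<comment> \<open>Modes of eh + f d with the true \<theta> and the exact sinusoid. The estimate
    \<open>\<theta>h\<close> would bring its own derivative into the equation of
    \<open>Z\<close>.\<close>
  define Z where "Z n t = H n t + m n \<bullet> d t" for n t
  \<comment> \<open>The mismatch between the boundary input which the shifted modes receive and the
    delayed feedback covered by the matrix inequality.\<close>
  define V where "V t = U (t - \<tau>) + f' 1 \<theta> \<bullet> d t - (\<Sum>j\<le>N. k j * Z j (t - \<tau>))" for t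
  have cd: "continuous_on {0..} (\<lambda>t. u \<bullet> d t)" for u
    unfolding d_def inner_vector_2 by (intro continuous_intros ce1)
  have dd: "((\<lambda>t. u \<bullet> d t) has_real_derivative u \<bullet> (Sc \<theta> *v d t)) (at t)" if "t \<ge> 3" for u t
  proof -
    have "Sc \<theta> *v d t = vector [e2 t, - \<theta> * e1 t]" by (simp add: vec_eq_iff forall_2 Sc_mult_vec d_def)
    then show ?thesis unfolding d_def inner_vector_2 using de1[OF that] de2[OF that]
      by (auto intro!: derivative_eq_intros simp: inner_vector_2)
  qed
  have cZ: "continuous_on {0..} (Z n)" for n unfolding Z_def[abs_def] by (intro continuous_intros cH cd)
  have cZ\<tau>: "continuous_on {T..} (\<lambda>t. Z n (t - \<tau>))" for n
    by (rule continuous_on_compose2[OF cZ]) (auto intro!: continuous_intros simp: T_def)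
  have dZ: "(Z n has_real_derivative (a - (real n * pi)\<^sup>2) * Z n t
      + phi n 1 * ((\<Sum>j\<le>N. k j * Z j (t - \<tau>)) + V t) - (if n \<le> N then l n else 0) * r t) (at t)" if t: "t \<ge> T" for n t
  proof -
    have t3: "t \<ge> 3" using t tau_pos by (simp add: T_def)
    have "(H n has_real_derivative (a - (real n * pi)\<^sup>2) * H n t + phi n 1 * U (t - \<tau>) - L n * yd t) (at t)"
      by (rule has_integral_imp_deriv[OF H_int, where T="\<tau> + 2"])
         (use t tau_pos in \<open>auto simp: T_def intro!: continuous_intros cU\<tau> continuous_on_subset[OF cH] continuous_on_subset[OF cyd]\<close>)
    from DERIV_add[OF this dd[OF t3, of "m n"]]
    have 1: "(Z n has_real_derivative (a - (real n * pi)\<^sup>2) * H n t + phi n 1 * U (t - \<tau>) - L n * yd t + m n \<bullet> (Sc \<theta> *v d t)) (at t)"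
      unfolding Z_def[abs_def] .
    have "m n \<bullet> (Sc \<theta> *v d t) = (m n v* Sc \<theta>) \<bullet> d t" by (simp add: dot_lmul_matrix)
    also have "\<dots> = (a - (real n * pi)\<^sup>2) * (m n \<bullet> d t) + phi n 1 * (f' 1 \<theta> \<bullet> d t) + L n * (gamma_c \<bullet> d t)"
      unfolding m_def mode_equation L_def by (simp add: inner_add_left)
    also have "gamma_c \<bullet> d t = e1 t" by (simp add: gamma_c_def d_def inner_vector_2)
    finally have 2: "m n \<bullet> (Sc \<theta> *v d t) = (a - (real n * pi)\<^sup>2) * (m n \<bullet> d t) + phi n 1 * (f' 1 \<theta> \<bullet> d t) + L n * e1 t" .
    show ?thesis
      by (rule DERIV_cong[OF 1]) (simp add: 2 V_def r_def Z_def L_def[symmetric] algebra_simps)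
  qed
  have V: "expdecay V"
  proof -
    \<comment> \<open>The estimation error contained in the control when it was issued. The matrix
      exponential in the gain carries d(t - \<tau>) to d(t), so its contribution cancels f'(1) d(t)
      exactly and \<open>V t\<close> reduces to \<open>\<kappa> (t - \<tau>)\<close>.\<close>
    define \<kappa> where "\<kappa> t = (\<Psi> (\<theta>h t) $ 1 * \<chi>1 t - \<Psi> \<theta> $ 1 * e1 t) + (\<Psi> (\<theta>h t) $ 2 * D t - \<Psi> \<theta> $ 2 * e2 t)" for t
    have "expdecay \<kappa>"
      unfolding \<kappa>_def[abs_def]
      by (intro expdecay_add loclip_product_expdecay[OF l\<Psi> obs(1), where T=3] obs(2,3) bnd) (use obs(4) in auto)
    from expdecay_shift[OF this, of \<tau>] show ?thesis
    proof (rule expdecay_cong)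
      fix t assume t: "t \<ge> T"
      define s where "s = t - \<tau>"
      have s: "s \<ge> 3" "s \<ge> 0" "t = s + \<tau>" using t by (auto simp: T_def s_def)
      have "d (s + \<tau>) = mexp (\<tau> *\<^sub>R Sc \<theta>) *v d s"
        unfolding d_def \<theta>_def
        by (rule oscillator_flow[of 3]) (use de1 de2 s tau_pos \<omega> in \<open>auto simp: \<theta>_def\<close>)
      then have "f' 1 \<theta> \<bullet> d t = (f' 1 \<theta> v* mexp (\<tau> *\<^sub>R Sc \<theta>)) \<bullet> d s" by (simp add: s dot_lmul_matrix)
      moreover have "(\<Sum>j\<le>N. k j * Z j s) = (\<Sum>j\<le>N. k j * H j s) + (\<Sum>j\<le>N. k j *\<^sub>R m j) \<bullet> d s"
        by (simp add: Z_def distrib_left sum.distrib inner_sum_left)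
      moreover have "\<Psi> \<theta> \<bullet> d s = (\<Sum>j\<le>N. k j *\<^sub>R m j) \<bullet> d s - (f' 1 \<theta> v* mexp (\<tau> *\<^sub>R Sc \<theta>)) \<bullet> d s"
        by (simp add: \<Psi>_def control_gain_def m_def inner_diff_left)
      moreover have "\<Psi> \<theta> \<bullet> d s = \<Psi> \<theta> $ 1 * e1 s + \<Psi> \<theta> $ 2 * e2 s" by (simp add: d_def inner_vector_2)
      ultimately show "V t = \<kappa> (t - \<tau>)"
        unfolding V_def s_def[symmetric] \<kappa>_def using U[OF s(2)] by linarith
    qed
  qed
  have cV: "continuous_on {T..} V"
    unfolding V_def[abs_def]
    by (intro continuous_intros cZ\<tau> continuous_on_subset[OF cd] continuous_on_subset[OF cU\<tau>])
       (use tau_pos in \<open>auto simp: T_def\<close>)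
  have cr: "continuous_on {T..} r"
    unfolding r_def[abs_def]
    by (intro continuous_intros continuous_on_subset[OF cyd] continuous_on_subset[OF ce1(1)])
       (use tau_pos in \<open>auto simp: T_def\<close>)
  have "expdecay (\<lambda>t. eh 0 t + f 0 \<theta> \<bullet> d t)"
  proof (rule closed_loop_modes_expdecay[OF P1 S R Phi_neg delta_pos tau_pos N_tail dZ V cV r cr,
        where z="\<lambda>t x. eh x t + f x \<theta> \<bullet> d t"])
    fix t assume "t \<ge> T"
    then have t: "t > 0" using tau_pos by (simp add: T_def)
    have cf: "continuous_on {0..1} (\<lambda>x. f x \<theta> \<bullet> d t)" by (intro continuous_intros continuous_f)
    show "continuous_on {0..1} (\<lambda>x. eh x t + f x \<theta> \<bullet> d t)" by (intro continuous_intros cf eh_cont t)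
    show "ip01 (\<lambda>x. eh x t + f x \<theta> \<bullet> d t) (phi n) = Z n t" for n
      unfolding Z_def H_def m_def ip01_inner[symmetric] by (intro ip01_add_left eh_cont t cf continuous_on_phi)
  qed
  \<comment> \<open>At x = 0 the profile equals \<open>gamma_c\<close>, so the decaying trace is
    eh(0, t) + e1(t); adding r = yd - e1 turns it into the tracking error.\<close>
  from expdecay_add[OF this r] have "expdecay (\<lambda>t. w 0 t - d4 \<bullet> p t)"
    by (simp add: f_init gamma_c_def d_def inner_vector_2 r_def yd_def)
  then obtain \<alpha> M T' where fin: "\<alpha> > 0" "\<And>t. t \<ge> T' \<Longrightarrow> \<bar>w 0 t - d4 \<bullet> p t\<bar> \<le> M * exp (- \<alpha> * t)"
    unfolding expdecay_def by auto
  have "((\<lambda>t. \<bar>w 0 t - d4 \<bullet> p t\<bar>) \<longlongrightarrow> 0) at_top"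
  proof (rule Lim_null_comparison)
    show "\<forall>\<^sub>F t in at_top. norm \<bar>w 0 t - d4 \<bullet> p t\<bar> \<le> M * exp (- \<alpha> * t)"
      by (rule eventually_mono[OF eventually_ge_at_top[of T']]) (use fin in auto)
    have "LIM t at_top. - \<alpha> * t :> at_bot"
      by (rule filterlim_tendsto_neg_mult_at_bot[OF tendsto_const _ filterlim_ident]) (use fin in auto)
    then have "((\<lambda>t. exp (- \<alpha> * t)) \<longlongrightarrow> 0) at_top" by (rule filterlim_compose[OF exp_at_bot])
    then show "((\<lambda>t. M * exp (- \<alpha> * t)) \<longlongrightarrow> 0) at_top" by (rule tendsto_mult_right_zero)
  qed
  then show ?thesis using fin by blast
qed

end
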